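(* Let $A$ be a finite abelian group and let $\mathscr G$ be the groupoid associated to a Skipper–Steinberg self-similar action of the lamplighter group $A\wr\mathbb Z$ on $A$. Then $H_0(\mathscr G)\cong\mathbb Z/(|A|-1)\mathbb Z\cong H_1(\mathscr G)$ and $H_n(\mathscr G)=0$ for $n\ge2$.
   Context: Self-similar group action $(G,X,\sigma)$: a discrete group $G$, a finite set $X$ with $|X|\ge2$, a left action $(g,x)\mapsto g(x)$ of $G$ on $X$, and a map $\sigma\colon G\times X\to G$, $(g,x)\mapsto g|_x$, with $(hg)|_x=h|_{g(x)}g|_x$. These extend to words by $g(\emptyset)=\emptyset$, $g|_\emptyset=g$, $g(xw)=g(x)g|_x(w)$, $g|_{xw}=(g|_x)|_w$, and to an action on $X^{\mathbb N}$. Lamplighter group: $A\wr\mathbb Z=\left(\bigoplus_{i\in\mathbb Z}A\delta_i\right)\rtimes\mathbb Z$, the generator $t$ of $\mathbb Z$ acting by the shift $a\delta_i\mapsto a\delta_{i+1}$. Skipper–Steinberg self-similar action: realize $A$ (with $|A|\ge2$) as the additive group of a finite commutative unital ring $R$ and identify $A^{\mathbb N}$ with the power series ring $R[[x]]$ (infinite word = sequence of coefficients). Fix $f=r\,\frac{1-ax}{1-bx}\in R[[x]]$ with $a,b\in R$, $r\in R^\times$ and $a-b\in R^\times$. Then $A\wr\mathbb Z$ acts faithfully on $R[[x]]$ with $t$ acting as multiplication by $f$ and $s\delta_i$ ($s\in A$, $i\in\mathbb Z$) acting as addition of $s(-ar+bf)f^i$. This action is self-similar over the alphabet $A$: for $g\in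 A\wr\mathbb Z$ and $d\in A$, the letter $g(d)$ and the section $g|_d\in A\wr\mathbb Z$ are determined by $g(d+xh)=g(d)+x\cdot g|_d(h)$ for all $h\in R[[x]]$; in particular $t|_d=(d\delta_0)t$. Groupoid $\mathscr G=\mathscr G_{(G,X)}$ of a self-similar group action: let $S$ be the inverse semigroup consisting of $0$ and all triples $(p,g,q)$ with $p,q$ finite words and $g\in G$, with product $(p,g,q)(p',h,q')=(p\,g(v),g|_v h,q')$ if $p'=qv$, $=(p,g\,h|_{h^{-1}(v)},q'h^{-1}(v))$ if $q=p'v$, and $0$ otherwise. It acts on $X^{\mathbb N}$ by $(p,g,q)\colon qX^{\mathbb N}\to pX^{\mathbb N}$, $qw\mapsto p\,g(w)$. $\mathscr G$ is the ample groupoid of classes $[\alpha,w]$, $w\in\mathrm{dom}(\alpha)$, where $[\alpha,w]=[\beta,w']$ iff $w=w'$ and $\alpha e=\beta e$ for some idempotent $e=(u,1,u)$ with $w\in uX^{\mathbb N}$; $[\alpha,\beta(w)][\beta,w]=[\alpha\beta,w]$; basic open sets $\{[\alpha,w]:w\in U\}$, $U\subseteq\mathrm{dom}(\alpha)$ open. Homology of an ample groupoid $\mathscr G$: homology of the complex $C_n=\mathbb Z\mathscr G^n$ (functions on composable $n$-tuples spanned by indicator functions of compact open Hausdorff subsets; $\mathscr G^0$ = units), $\partial_n=\sum_{i=0}^n(-1)^i(d_i)_*$, where $d_0$ drops $g_1$, $d_i$ multiplies $g_ig_{i+1}$ for $1\le i\le n-1$, $d_n$ drops $g_n$ (for $n=1$: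 $d_0$ = source, $d_1$ = range), and $f_*(h)(y)=\sum_{f(x)=y}h(x)$. *)

theory Defs
  imports
    "HOL-Algebra.Elementary_Groups"
    "HOL-Analysis.Function_Topology"
    "HOL-Analysis.T1_Spaces"
    "HOL-Computational_Algebra.Formal_Power_Series"
    "HOL-Library.Cardinality"
    "HOL-Library.Omega_Words_Fun"
    "HOL-Library.Poly_Mapping"
    "HOL-Library.Sublist"
begin

hide_const (open) Omega_Words_Fun.prefix Omega_Words_Fun.suffix

section \<open>Homology of topological groupoids\<close>

text \<open>A groupoid is given by its set of arrows only; units are particular arrows, and \<open>src\<close> and
  \<open>tgt\<close> take values in arrows. The product \<open>comp g h\<close> is meaningful if \<open>src g = tgt h\<close>.\<close>

record 'a topological_groupoid =
  arrow_space :: "'a topology"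
  src :: "'a \<Rightarrow> 'a"
  tgt :: "'a \<Rightarrow> 'a"
  comp :: "'a \<Rightarrow> 'a \<Rightarrow> 'a"

definition unit_arrows :: "'a topological_groupoid \<Rightarrow> 'a set" where
  "unit_arrows \<G> = src \<G> ` topspace (arrow_space \<G>)"

text \<open>A composable tuple \<open>(g\<^sub>1, \<dots>, g\<^sub>n)\<close> is an extensional function on \<open>{1..n}\<close>, while a unit \<open>u\<close>
  is stored as the function \<open>0 \<mapsto> u\<close> on \<open>{0}\<close>, so that all degrees live in one type.\<close>

definition nerve :: "'a topological_groupoid \<Rightarrow> nat \<Rightarrow> (nat \<Rightarrow> 'a) topology" where
  "nerve \<G> n =
    (if n = 0
     then subtopology (product_topology (\<lambda>_. arrow_space \<G>) {0}) {u. u 0 \<in> unit_arrows \<G>}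
     else subtopology (product_topology (\<lambda>_. arrow_space \<G>) {1..n})
            {g. \<forall>i\<in>{1..<n}. src \<G> (g i) = tgt \<G> (g (Suc i))})"

text \<open>For \<open>n \<ge> 2\<close> the formula drops \<open>g\<^sub>1\<close> if \<open>i = 0\<close>, drops \<open>g\<^sub>n\<close> if \<open>i = n\<close>, and multiplies
  \<open>g\<^sub>i\<close> with \<open>g\<^sub>i\<^sub>+\<^sub>1\<close> otherwise.\<close>

definition face :: "'a topological_groupoid \<Rightarrow> nat \<Rightarrow> nat \<Rightarrow> (nat \<Rightarrow> 'a) \<Rightarrow> (nat \<Rightarrow> 'a)" where
  "face \<G> n i g =
    (if n = 1 then (\<lambda>j\<in>{0}. if i = 0 then src \<G> (g 1) else tgt \<G> (g 1))
     else (\<lambda>j\<in>{1..n-1}. if j < i then g j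
                        else if j = i then comp \<G> (g i) (g (Suc i))
                        else g (Suc j)))"

definition int_functions :: "('b \<Rightarrow> int) monoid" where
  "int_functions = \<lparr>carrier = UNIV, monoid.mult = (\<lambda>h k x. h x + k x), one = (\<lambda>_. 0)\<rparr>"

definition groupoid_chains :: "'a topological_groupoid \<Rightarrow> nat \<Rightarrow> ((nat \<Rightarrow> 'a) \<Rightarrow> int) monoid" where
  "groupoid_chains \<G> n = subgroup_generated int_functions
     {indicator U | U. compactin (nerve \<G> n) U \<and> openin (nerve \<G> n) U \<and>
                       Hausdorff_space (subtopology (nerve \<G> n) U)}"

text \<open>The restriction to \<open>h x \<noteq> 0\<close> makes this a finite sum whenever \<open>h\<close> meets every fibre of \<open>f\<close> in
  finitely many points, as is the case for chains and the (etale) face maps of an ample groupoid.\<close>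

definition pushforward :: "'b topology \<Rightarrow> ('b \<Rightarrow> 'c) \<Rightarrow> ('b \<Rightarrow> int) \<Rightarrow> ('c \<Rightarrow> int)" where
  "pushforward T f h y = (\<Sum>x | x \<in> topspace T \<and> f x = y \<and> h x \<noteq> 0. h x)"

definition boundary ::
    "'a topological_groupoid \<Rightarrow> nat \<Rightarrow> ((nat \<Rightarrow> 'a) \<Rightarrow> int) \<Rightarrow> ((nat \<Rightarrow> 'a) \<Rightarrow> int)" where
  "boundary \<G> n h =
    (if n = 0 then (\<lambda>_. 0)
     else (\<lambda>y. \<Sum>i\<le>n. (-1) ^ i * pushforward (nerve \<G> n) (face \<G> n i) h y))"

definition groupoid_homology ::
    "'a topological_groupoid \<Rightarrow> nat \<Rightarrow> ((nat \<Rightarrow> 'a) \<Rightarrow> int) set monoid" where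
  "groupoid_homology \<G> n =
     subgroup_generated (groupoid_chains \<G> n) (kernel (groupoid_chains \<G> n) int_functions (boundary \<G> n))
       Mod (boundary \<G> (Suc n) ` carrier (groupoid_chains \<G> (Suc n)))"


section \<open>Self-similar group actions and their groupoids\<close>

locale self_similar_action = group G for G (structure) +
  fixes X :: "'x set"
    and act :: "'a \<Rightarrow> 'x \<Rightarrow> 'x"
    and sec :: "'a \<Rightarrow> 'x \<Rightarrow> 'a"
  assumes finite_alphabet: "finite X"
    and card_alphabet: "2 \<le> card X"
    and act_closed: "\<lbrakk>g \<in> carrier G; x \<in> X\<rbrakk> \<Longrightarrow> act g x \<in> X"
    and act_one: "x \<in> X \<Longrightarrow> act \<one> x = x"
    and act_mult: "\<lbrakk>h \<in> carrier G; g \<in> carrier G; x \<in> X\<rbrakk> \<Longrightarrow> act (h \<otimes> g) x = act h (act g x)"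
    and sec_closed: "\<lbrakk>g \<in> carrier G; x \<in> X\<rbrakk> \<Longrightarrow> sec g x \<in> carrier G"
    and sec_mult: "\<lbrakk>h \<in> carrier G; g \<in> carrier G; x \<in> X\<rbrakk>
      \<Longrightarrow> sec (h \<otimes> g) x = sec h (act g x) \<otimes> sec g x"
begin

primrec act_word :: "'a \<Rightarrow> 'x list \<Rightarrow> 'x list" where
  "act_word g [] = []"
| "act_word g (x # w) = act g x # act_word (sec g x) w"

primrec sec_word :: "'a \<Rightarrow> 'x list \<Rightarrow> 'a" where
  "sec_word g [] = g"
| "sec_word g (x # w) = sec_word (sec g x) w"

definition act_seq :: "'a \<Rightarrow> 'x word \<Rightarrow> 'x word" where
  "act_seq g w n = act (sec_word g (map w [0..<n])) (w n)"

definition sequences :: "'x word topology" where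
  "sequences = product_topology (\<lambda>_. discrete_topology X) UNIV"

definition cylinder :: "'x list \<Rightarrow> 'x word set" where
  "cylinder q = {q \<frown> w | w. w \<in> topspace sequences}"

text \<open>The element \<open>0\<close> of the inverse semigroup is \<open>None\<close>.\<close>

definition triples :: "('x list \<times> 'a \<times> 'x list) option set" where
  "triples = insert None (Some ` (lists X \<times> carrier G \<times> lists X))"

fun triple_mult ::
    "('x list \<times> 'a \<times> 'x list) option \<Rightarrow> ('x list \<times> 'a \<times> 'x list) option
      \<Rightarrow> ('x list \<times> 'a \<times> 'x list) option" where
  "triple_mult (Some (p, g, q)) (Some (p', h, q')) =
    (if prefix q p' then
       (let v = drop (length q) p' in Some (p @ act_word g v, sec_word g v \<otimes> h, q'))
     else if prefix p' q then
       (let v = drop (length p') q; v' = act_word (inv h) v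
        in Some (p, g \<otimes> sec_word h v', q' @ v'))
     else None)"
| "triple_mult _ _ = None"

fun triple_dom :: "('x list \<times> 'a \<times> 'x list) option \<Rightarrow> 'x word set" where
  "triple_dom (Some (p, g, q)) = cylinder q"
| "triple_dom None = {}"

fun triple_act :: "('x list \<times> 'a \<times> 'x list) option \<Rightarrow> 'x word \<Rightarrow> 'x word" where
  "triple_act (Some (p, g, q)) w = p \<frown> act_seq g (Omega_Words_Fun.suffix (length q) w)"
| "triple_act None w = w"

definition germ_rel ::
    "((('x list \<times> 'a \<times> 'x list) option \<times> 'x word) \<times> (('x list \<times> 'a \<times> 'x list) option \<times> 'x word)) set"
  where
  "germ_rel = {((\<alpha>, w), (\<beta>, w')).
     \<alpha> \<in> triples \<and> \<beta> \<in> triples \<and> w \<in> triple_dom \<alpha> \<and> w' \<in> triple_dom \<beta> \<and> w = w' \<and>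
     (\<exists>u\<in>lists X. w \<in> cylinder u \<and>
        triple_mult \<alpha> (Some (u, \<one>, u)) = triple_mult \<beta> (Some (u, \<one>, u)))}"

definition germ ::
    "('x list \<times> 'a \<times> 'x list) option \<Rightarrow> 'x word \<Rightarrow> (('x list \<times> 'a \<times> 'x list) option \<times> 'x word) set"
  where "germ \<alpha> w = germ_rel `` {(\<alpha>, w)}"

definition unit_germ :: "'x word \<Rightarrow> (('x list \<times> 'a \<times> 'x list) option \<times> 'x word) set" where
  "unit_germ w = germ (Some ([], \<one>, [])) w"

definition germ_topology :: "(('x list \<times> 'a \<times> 'x list) option \<times> 'x word) set topology" where
  "germ_topology = topology_generated_by
     {germ \<alpha> ` U | \<alpha> U. \<alpha> \<in> triples \<and> U \<subseteq> triple_dom \<alpha> \<and> openin sequences U}"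

definition action_groupoid ::
    "(('x list \<times> 'a \<times> 'x list) option \<times> 'x word) set topological_groupoid" where
  "action_groupoid =
    \<lparr>arrow_space = germ_topology,
     src = (\<lambda>\<gamma>. THE u. \<exists>\<alpha>\<in>triples. \<exists>w\<in>triple_dom \<alpha>. \<gamma> = germ \<alpha> w \<and> u = unit_germ w),
     tgt = (\<lambda>\<gamma>. THE u. \<exists>\<alpha>\<in>triples. \<exists>w\<in>triple_dom \<alpha>. \<gamma> = germ \<alpha> w \<and> u = unit_germ (triple_act \<alpha> w)),
     comp = (\<lambda>\<gamma> \<delta>. THE \<epsilon>. \<exists>\<alpha>\<in>triples. \<exists>\<beta>\<in>triples. \<exists>w\<in>triple_dom \<beta>.
       triple_act \<beta> w \<in> triple_dom \<alpha> \<and>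
       \<gamma> = germ \<alpha> (triple_act \<beta> w) \<and> \<delta> = germ \<beta> w \<and> \<epsilon> = germ (triple_mult \<alpha> \<beta>) w)\<rparr>"

end


section \<open>The lamplighter group and Skipper--Steinberg actions\<close>

text \<open>The pair \<open>(s, m)\<close> stands for the product of \<open>s\<close> (a finitely supported function on \<open>\<int>\<close>) and
  \<open>t\<close> to the power \<open>m\<close>; conjugation by the latter moves the value at \<open>i\<close> to \<open>i + m\<close>.\<close>

definition lamplighter :: "((int \<Rightarrow>\<^sub>0 'r::ab_group_add) \<times> int) monoid" where
  "lamplighter =
    \<lparr>carrier = UNIV,
     monoid.mult = (\<lambda>(s, m) (s', n). (s + Poly_Mapping.map_key (\<lambda>i. i - m) s', m + n)),
     one = (0, 0)\<rparr>"

definition unit_inv :: "'c::comm_ring_1 \<Rightarrow> 'c" where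
  "unit_inv u = (THE v. u * v = 1)"

definition unit_power :: "'c::comm_ring_1 \<Rightarrow> int \<Rightarrow> 'c" where
  "unit_power u i = (if 0 \<le> i then u ^ nat i else unit_inv u ^ nat (- i))"

definition ss_series :: "'r::comm_ring_1 \<Rightarrow> 'r \<Rightarrow> 'r \<Rightarrow> 'r fps" where
  "ss_series r a b =
     fps_const r * ((1 - fps_const a * fps_X) * unit_inv (1 - fps_const b * fps_X))"

definition ss_act ::
    "'r::comm_ring_1 \<Rightarrow> 'r \<Rightarrow> 'r \<Rightarrow> (int \<Rightarrow>\<^sub>0 'r) \<times> int \<Rightarrow> 'r fps \<Rightarrow> 'r fps" where
  "ss_act r a b g h = (case g of (s, m) \<Rightarrow>
     (let f = ss_series r a b in
       unit_power f m * h +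
       (\<Sum>i\<in>Poly_Mapping.keys s. fps_const (Poly_Mapping.lookup s i) *
          (- fps_const (a * r) + fps_const b * f) * unit_power f i)))"

text \<open>The letter \<open>g(d)\<close> and the section of \<open>g\<close> at \<open>d\<close>.\<close>

definition ss_local ::
    "'r::comm_ring_1 \<Rightarrow> 'r \<Rightarrow> 'r \<Rightarrow> (int \<Rightarrow>\<^sub>0 'r) \<times> int \<Rightarrow> 'r \<Rightarrow> 'r \<times> ((int \<Rightarrow>\<^sub>0 'r) \<times> int)" where
  "ss_local r a b g d = (THE (c, k).
     \<forall>h. ss_act r a b g (fps_const d + fps_X * h) = fps_const c + fps_X * ss_act r a b k h)"

definition ss_letter :: "'r::comm_ring_1 \<Rightarrow> 'r \<Rightarrow> 'r \<Rightarrow> (int \<Rightarrow>\<^sub>0 'r) \<times> int \<Rightarrow> 'r \<Rightarrow> 'r" where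
  "ss_letter r a b g d = fst (ss_local r a b g d)"

definition ss_section ::
    "'r::comm_ring_1 \<Rightarrow> 'r \<Rightarrow> 'r \<Rightarrow> (int \<Rightarrow>\<^sub>0 'r) \<times> int \<Rightarrow> 'r \<Rightarrow> (int \<Rightarrow>\<^sub>0 'r) \<times> int" where
  "ss_section r a b g d = snd (ss_local r a b g d)"

abbreviation ss_groupoid where
  "ss_groupoid r a b \<equiv>
     self_similar_action.action_groupoid lamplighter UNIV (ss_letter r a b) (ss_section r a b)"


subsection \<open>Sections of the Skipper--Steinberg action exist and are unique\<close>

lemma unit_inv:
  assumes "u dvd 1"
  shows "u * unit_inv u = 1"
proof -
  obtain v where v: "u * v = 1"
    using assms by (auto elim: dvdE)
  have "w = v" if "u * w = 1" for w
    by (metis v that mult.assoc mult.commute mult_1)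
  then have "\<exists>!w. u * w = 1"
    using v by blast
  then show ?thesis
    unfolding unit_inv_def by (rule theI')
qed

lemma unit_cancel:
  fixes u :: "'c::comm_ring_1"
  assumes "u dvd 1" "u * p = u * q"
  shows "p = q"
proof -
  have "unit_inv u * u * p = unit_inv u * u * q"
    using assms(2) by (simp add: mult.assoc)
  then show ?thesis
    using unit_inv[OF assms(1)] by (simp add: mult.commute)
qed

lemma unit_power_0 [simp]: "unit_power u 0 = 1"
  by (simp add: unit_power_def)

lemma unit_power_Suc:
  assumes "u dvd 1"
  shows "unit_power u (i + 1) = u * unit_power u i"
proof (cases "0 \<le> i")
  case True
  then have "nat (i + 1) = Suc (nat i)" by simp
  then show ?thesis using True by (simp add: unit_power_def)
next
  case False
  define n where "n = nat (- (i + 1))"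
  have n: "nat (- i) = Suc n" using False by (simp add: n_def)
  have "unit_power u (i + 1) = unit_inv u ^ n"
    using False by (cases "i = -1") (auto simp: unit_power_def n_def)
  also have "\<dots> = u * unit_power u i"
    using False unit_inv[OF assms] by (simp add: unit_power_def n flip: mult.assoc)
  finally show ?thesis .
qed

lemma unit_power_add:
  assumes "u dvd 1"
  shows "unit_power u (i + j) = unit_power u i * unit_power u j"
proof (induction i rule: int_induct[where k = 0])
  case base
  show ?case by simp
next
  case (step1 i)
  have "unit_power u (i + 1 + j) = u * unit_power u (i + j)"
    using unit_power_Suc[OF assms, of "i + j"] by (simp add: ac_simps)
  then show ?case
    using step1 unit_power_Suc[OF assms, of i] by (simp add: mult.assoc)
next
  case (step2 i)
  have "u * unit_power u (i - 1 + j) = unit_power u (i + j)"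
    using unit_power_Suc[OF assms, of "i - 1 + j"] by simp
  also have "\<dots> = u * (unit_power u (i - 1) * unit_power u j)"
    using step2 unit_power_Suc[OF assms, of "i - 1"] by (simp add: mult.assoc)
  finally show ?case
    by (rule unit_cancel[OF assms])
qed

lemma fps_unit_iff:
  fixes p :: "'r::comm_ring_1 fps"
  assumes "fps_nth p 0 dvd 1"
  shows "p dvd 1"
proof -
  obtain v where v: "1 = fps_nth p 0 * v" using assms by (auto elim: dvdE)
  have "p * fps_right_inverse p v = 1"
    using v by (intro fps_right_inverse) simp
  then show ?thesis by (metis dvd_triv_left)
qed

context
  fixes r a b :: "'r::{finite,comm_ring_1}"
  assumes r: "r dvd 1" and ab: "(a - b) dvd 1"
begin

private abbreviation "f \<equiv> ss_series r a b"
private abbreviation "c \<equiv> - fps_const (a * r) + fps_const b * f"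
private definition S where
  "S s = (\<Sum>i\<in>Poly_Mapping.keys s. fps_const (Poly_Mapping.lookup s i) * c * unit_power f i)"

private lemma ss_act_eq: "ss_act r a b (s, m) h = unit_power f m * h + S s"
  by (simp add: ss_act_def S_def Let_def)

private lemma f_eq: "f * (1 - fps_const b * fps_X) = fps_const r * (1 - fps_const a * fps_X)"
proof -
  have "(1 - fps_const b * fps_X) dvd 1"
    by (rule fps_unit_iff) simp
  from unit_inv[OF this] show ?thesis
    by (simp add: ss_series_def ac_simps)
qed

private lemma f_eq': "f = fps_const r + fps_X * c"
proof -
  have 1: "fps_const (a * r) = fps_const a * fps_const r" by simp
  show ?thesis
    unfolding 1 using f_eq by (simp add: algebra_simps del: fps_const_mult)
qed

private lemma f_0: "fps_nth f 0 = r"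
  by (subst f_eq') simp

private lemma f_unit: "f dvd 1"
  by (rule fps_unit_iff) (simp add: f_0 r)

private lemma c_0: "fps_nth c 0 dvd 1"
proof -
  have "fps_nth c 0 = - (r * (a - b))"
    by (simp add: f_0 algebra_simps)
  moreover have "r * (a - b) dvd 1"
    using mult_dvd_mono[OF r ab] by simp
  ultimately show ?thesis by simp
qed

private lemma c_unit: "c dvd 1"
  by (rule fps_unit_iff) (rule c_0)

private lemma unit_pow: "(u::'c::comm_ring_1) dvd 1 \<Longrightarrow> u ^ n dvd 1"
  using dvd_power_same[of u 1 n] by simp

private lemma S_add: "S (s + s') = S s + S s'"
  unfolding S_def
  by (rule setsum_keys_plus_distrib) (simp_all add: algebra_simps flip: fps_const_add)

private lemma S_single: "S (Poly_Mapping.single i d) = fps_const d * c * unit_power f i"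
  by (simp add: S_def)

private lemma S_0: "S 0 = 0"
  by (simp add: S_def)

private lemma S_shift: "S (Poly_Mapping.map_key (\<lambda>i. i - m) s) = unit_power f m * S s"
proof -
  have inj: "inj (\<lambda>i::int. i - m)" by (simp add: inj_def)
  have *: "(\<lambda>i. i - m) -` Poly_Mapping.keys s = (\<lambda>i. i + m) ` Poly_Mapping.keys s"
    by force
  have "S (Poly_Mapping.map_key (\<lambda>i. i - m) s) =
     (\<Sum>i\<in>(\<lambda>i. i + m) ` Poly_Mapping.keys s.
        fps_const (Poly_Mapping.lookup s (i - m)) * c * unit_power f i)"
    by (simp add: S_def keys_map_key[OF inj] map_key.rep_eq[OF inj] *)
  also have "\<dots> = (\<Sum>i\<in>Poly_Mapping.keys s.
        fps_const (Poly_Mapping.lookup s i) * c * unit_power f (i + m))"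
    by (subst sum.reindex) (auto simp: inj_on_def)
  also have "\<dots> = unit_power f m * S s"
    by (simp add: S_def sum_distrib_left unit_power_add[OF f_unit] ac_simps)
  finally show ?thesis .
qed

lemma ss_act_one: "ss_act r a b \<one>\<^bsub>lamplighter\<^esub> h = h"
  by (simp add: lamplighter_def ss_act_eq S_0)

lemma ss_act_mult:
  "ss_act r a b (g \<otimes>\<^bsub>lamplighter\<^esub> g') h = ss_act r a b g (ss_act r a b g' h)"
proof (cases g; cases g')
  fix s m s' m' assume "g = (s, m)" "g' = (s', m')"
  moreover have "unit_power f (m + m') * h + S (s + Poly_Mapping.map_key (\<lambda>i. i - m) s') =
      unit_power f m * (unit_power f m' * h + S s') + S s"
    unfolding S_add S_shift unit_power_add[OF f_unit] distrib_left mult.assoc by (simp only: ac_simps)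
  ultimately show ?thesis
    by (simp add: lamplighter_def ss_act_eq)
qed

private lemma y_expand:
  "\<exists>q. (\<Sum>i\<le>N. fps_const (p i) * f ^ i) = (\<Sum>k\<le>N. fps_const (q k) * (fps_X * c) ^ k) \<and> q N = p N"
proof (induction N arbitrary: p)
  case 0
  show ?case by auto
next
  case (Suc N)
  define y where "y = fps_X * c"
  obtain q where q: "(\<Sum>i\<le>N. fps_const (p (Suc i)) * f ^ i) = (\<Sum>k\<le>N. fps_const (q k) * y ^ k)"
    "q N = p (Suc N)"
    using Suc[of "\<lambda>i. p (Suc i)"] unfolding y_def by blast
  define q' where
    "q' k = (if k = 0 then p 0 else q (k - 1)) + (if k \<le> N then r * q k else 0)" for k
  have fy: "f = fps_const r + y" unfolding y_def by (rule f_eq')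
  have "(\<Sum>i\<le>Suc N. fps_const (p i) * f ^ i) =
      fps_const (p 0) + f * (\<Sum>i\<le>N. fps_const (p (Suc i)) * f ^ i)"
    by (simp add: sum.atMost_Suc_shift sum_distrib_left ac_simps del: sum.atMost_Suc)
  also have "\<dots> = fps_const (p 0) + (fps_const r + y) * (\<Sum>k\<le>N. fps_const (q k) * y ^ k)"
    by (simp only: q(1) flip: fy)
  also have "\<dots> = (fps_const (p 0) + (\<Sum>k\<le>N. fps_const (q k) * y ^ Suc k))
      + (\<Sum>k\<le>N. fps_const (r * q k) * y ^ k)"
    by (simp add: sum_distrib_left sum.distrib algebra_simps flip: fps_const_mult)
  also have "fps_const (p 0) + (\<Sum>k\<le>N. fps_const (q k) * y ^ Suc k) =
      (\<Sum>k\<le>Suc N. fps_const (if k = 0 then p 0 else q (k - 1)) * y ^ k)"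
    by (simp add: sum.atMost_Suc_shift del: sum.atMost_Suc)
  also have "(\<Sum>k\<le>N. fps_const (r * q k) * y ^ k) =
      (\<Sum>k\<le>Suc N. fps_const (if k \<le> N then r * q k else 0) * y ^ k)"
    by simp
  also have "(\<Sum>k\<le>Suc N. fps_const (if k = 0 then p 0 else q (k - 1)) * y ^ k) +
      (\<Sum>k\<le>Suc N. fps_const (if k \<le> N then r * q k else 0) * y ^ k) =
      (\<Sum>k\<le>Suc N. fps_const (q' k) * y ^ k)"
    unfolding sum.distrib[symmetric] q'_def by (intro sum.cong) (simp_all add: distrib_right flip: fps_const_add)
  finally have "(\<Sum>i\<le>Suc N. fps_const (p i) * f ^ i) = (\<Sum>k\<le>Suc N. fps_const (q' k) * y ^ k)" .
  moreover have "q' (Suc N) = p (Suc N)" by (simp add: q'_def q)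
  ultimately show ?case unfolding y_def by blast
qed

private lemma y_independent:
  assumes "(\<Sum>k\<le>N. fps_const (q k) * (fps_X * c) ^ k) = 0" "k \<le> N"
  shows "q k = 0"
  using assms(2)
proof (induction k rule: less_induct)
  case (less k)
  have nth: "fps_nth (fps_const (q j) * (fps_X * c) ^ j) k = (if j = k then q k * fps_nth c 0 ^ k else 0)"
    if "j \<le> N" for j
  proof -
    have eq: "fps_const (q j) * (fps_X * c) ^ j = fps_X ^ j * (fps_const (q j) * c ^ j)"
      by (simp add: power_mult_distrib ac_simps)
    consider "j < k" | "j = k" | "j > k" by linarith
    then show ?thesis
    proof cases
      case 1
      then have "q j = 0" using less by auto
      then show ?thesis using 1 by simp
    next
      case 2
      have "fps_nth (fps_X ^ k * (fps_const (q k) * c ^ k)) k = fps_nth (fps_const (q k) * c ^ k) 0"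
        by (simp only: fps_X_power_mult_nth) simp
      then show ?thesis using 2 unfolding eq by (simp only: fps_mult_nth_0 fps_power_zeroth fps_nth_fps_const if_True refl)
    next
      case 3
      then show ?thesis unfolding eq by (simp only: fps_X_power_mult_nth) simp
    qed
  qed
  have "0 = fps_nth (\<Sum>j\<le>N. fps_const (q j) * (fps_X * c) ^ j) k"
    using assms(1) by simp
  also have "\<dots> = (\<Sum>j\<le>N. if j = k then q k * fps_nth c 0 ^ k else 0)"
    unfolding fps_sum_nth by (intro sum.cong) (auto simp only: nth atMost_iff)
  also have "\<dots> = q k * fps_nth c 0 ^ k"
    using less.prems by simp
  finally have "fps_nth c 0 ^ k * q k = fps_nth c 0 ^ k * 0"
    by (simp add: mult.commute)
  then show ?case
    by (rule unit_cancel[OF unit_pow[OF c_0]])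
qed

private lemma f_independent:
  assumes "(\<Sum>i\<le>N. fps_const (p i) * f ^ i) = 0"
  shows "p N = 0"
proof -
  obtain q where "(\<Sum>i\<le>N. fps_const (p i) * f ^ i) = (\<Sum>k\<le>N. fps_const (q k) * (fps_X * c) ^ k)"
    "q N = p N"
    using y_expand by blast
  then show ?thesis
    using y_independent[where q = q and N = N and k = N] assms by simp
qed

private lemma f_infinite_order:
  assumes "unit_power f m = 1"
  shows "m = 0"
proof (rule ccontr)
  assume "m \<noteq> 0"
  define n where "n = nat \<bar>m\<bar>"
  have n: "n > 0" using \<open>m \<noteq> 0\<close> by (simp add: n_def)
  have "unit_power f \<bar>m\<bar> = 1"
    using assms unit_power_add[OF f_unit, of m "- m"] by (cases "m \<ge> 0") auto
  then have "f ^ n = 1" by (simp add: unit_power_def n_def)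
  define p where "p i = (if i = 0 then - 1 else if i = n then 1 else (0::'r))" for i
  have "(\<Sum>i\<le>n. fps_const (p i) * f ^ i) = (\<Sum>i\<in>{0, n}. fps_const (p i) * f ^ i)"
    by (rule sum.mono_neutral_right) (auto simp: p_def)
  also have "\<dots> = 0"
    using n \<open>f ^ n = 1\<close> by (simp add: p_def fps_const_neg[symmetric] del: fps_const_neg)
  finally have "p n = 0" by (rule f_independent)
  then show False using n by (simp add: p_def)
qed

private lemma S_eq_0:
  assumes "S s = 0"
  shows "s = 0"
proof (rule ccontr)
  assume "s \<noteq> 0"
  let ?K = "Poly_Mapping.keys s"
  have K: "finite ?K" "?K \<noteq> {}" using \<open>s \<noteq> 0\<close> by simp_all
  define l where "l = Min ?K"
  define N where "N = nat (Max ?K - l)"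
  have l: "l \<le> Max ?K" unfolding l_def using K by auto
  define p where "p j = Poly_Mapping.lookup s (l + int j)" for j
  have sub: "?K \<subseteq> (\<lambda>j. l + int j) ` {..N}"
  proof
    fix i assume i: "i \<in> ?K"
    then have "l \<le> i" "i \<le> Max ?K" using K by (auto simp: l_def)
    then have "i = l + int (nat (i - l))" "nat (i - l) \<le> N" by (auto simp: N_def)
    then show "i \<in> (\<lambda>j. l + int j) ` {..N}" by blast
  qed
  have "S s = (\<Sum>i\<in>(\<lambda>j. l + int j) ` {..N}. fps_const (Poly_Mapping.lookup s i) * c * unit_power f i)"
    unfolding S_def by (rule sum.mono_neutral_left) (use sub in \<open>auto simp: in_keys_iff\<close>)
  also have "\<dots> = (\<Sum>j\<le>N. fps_const (p j) * c * unit_power f (l + int j))"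
    by (subst sum.reindex) (auto simp: inj_on_def p_def)
  also have "\<dots> = c * (unit_power f l * (\<Sum>j\<le>N. fps_const (p j) * f ^ j))"
    unfolding unit_power_add[OF f_unit] sum_distrib_left
    by (intro sum.cong refl) (simp add: unit_power_def ac_simps)
  finally have "c * (unit_power f l * (\<Sum>j\<le>N. fps_const (p j) * f ^ j)) = c * 0"
    using assms by simp
  then have "unit_power f l * (\<Sum>j\<le>N. fps_const (p j) * f ^ j) = 0"
    by (rule unit_cancel[OF c_unit])
  then have "unit_power f (- l) * unit_power f l * (\<Sum>j\<le>N. fps_const (p j) * f ^ j) = 0"
    by (simp add: mult.assoc)
  then have "(\<Sum>j\<le>N. fps_const (p j) * f ^ j) = 0"
    using unit_power_add[OF f_unit, of "- l" l] by simp
  then have "p N = 0" by (rule f_independent)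
  moreover have "p N = Poly_Mapping.lookup s (Max ?K)" using l by (simp add: p_def N_def)
  ultimately show False using Max_in[OF K] by (simp add: in_keys_iff)
qed

lemma ss_act_faithful:
  assumes "\<And>h. ss_act r a b g h = ss_act r a b g' h"
  shows "g = g'"
proof -
  obtain s m s' m' where g: "g = (s, m)" "g' = (s', m')" by (cases g; cases g')
  have S: "S s = S s'" using assms[of 0] by (simp add: g ss_act_eq)
  have "S (s - s') = 0" using S_add[of "s - s'" s'] S by simp
  then have "s = s'" using S_eq_0 by fastforce
  have "unit_power f m = unit_power f m'" using assms[of 1] S by (simp add: g ss_act_eq)
  then have "unit_power f (m + - m') = unit_power f (m' + - m')"
    by (simp only: unit_power_add[OF f_unit])
  then have "m - m' = 0" by (intro f_infinite_order) simp
  with \<open>s = s'\<close> show ?thesis by (simp add: g)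
qed

text \<open>\<open>V\<close> collects the series of the form constant plus \<open>x\<close> times a lamp translation; it contains all
  powers of \<open>f\<close>, which is why sections exist.\<close>

private definition V where "V = {fps_const d + fps_X * S s | d s. True}"

private lemma V_add: "p \<in> V \<Longrightarrow> q \<in> V \<Longrightarrow> p + q \<in> V"
proof -
  assume "p \<in> V" "q \<in> V"
  then obtain d s d' s' where "p = fps_const d + fps_X * S s" "q = fps_const d' + fps_X * S s'"
    by (auto simp: V_def)
  then have "p + q = fps_const (d + d') + fps_X * S (s + s')"
    by (simp add: S_add algebra_simps flip: fps_const_add)
  then show "p + q \<in> V" unfolding V_def by blast
qed

private lemma V_const: "fps_const d \<in> V"
proof -
  have "fps_const d = fps_const d + fps_X * S 0" by (simp add: S_0)
  then show ?thesis unfolding V_def by blast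
qed

private lemma V_X: "fps_X * S s \<in> V"
proof -
  have "fps_X * S s = fps_const 0 + fps_X * S s" by simp
  then show ?thesis unfolding V_def by blast
qed

private lemma V_power: "fps_const d * unit_power f i \<in> V"
proof (induction i arbitrary: d rule: int_induct[where k = 0])
  case base
  show ?case using V_const by simp
next
  case (step1 i)
  have "fps_const d * unit_power f (i + 1) = fps_const d * (fps_const r + fps_X * c) * unit_power f i"
    unfolding unit_power_Suc[OF f_unit] by (subst (1) f_eq') (simp only: mult.assoc)
  also have "\<dots> = fps_const (d * r) * unit_power f i + fps_X * S (Poly_Mapping.single i d)"
    by (simp add: S_single algebra_simps flip: fps_const_mult)
  finally show ?case using step1 V_add V_X by metis
next
  case (step2 i)
  define r' where "r' = unit_inv r"
  have r': "fps_const r' * fps_const r = 1"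
    using unit_inv[OF r] by (simp add: r'_def mult.commute)
  have "unit_power f i = (fps_const r + fps_X * c) * unit_power f (i - 1)"
    using unit_power_Suc[OF f_unit, of "i - 1"] f_eq' by simp
  then have "fps_const (d * r') * unit_power f i =
      fps_const d * (fps_const r' * fps_const r) * unit_power f (i - 1)
      + fps_X * (fps_const (d * r') * c * unit_power f (i - 1))"
    by (simp only: fps_const_mult[symmetric] algebra_simps)
  moreover have "S (Poly_Mapping.single (i - 1) (- (d * r'))) =
      - (fps_const (d * r') * c * unit_power f (i - 1))"
    unfolding S_single fps_const_neg[symmetric] by (simp only: mult_minus_left)
  ultimately have "fps_const d * unit_power f (i - 1) =
      fps_const (d * r') * unit_power f i + fps_X * S (Poly_Mapping.single (i - 1) (- (d * r')))"
    unfolding r' by (simp only: mult_1_right mult_minus_right add_diff_cancel_right' flip: diff_conv_add_uminus)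
  then show ?case using step2 V_add V_X by metis
qed

private lemma V_S: "S s \<in> V"
proof -
  have *: "fps_const d * c * unit_power f i \<in> V" for d i
  proof -
    have "fps_const d * c * unit_power f i =
        fps_const (- (d * (a * r))) * unit_power f i + fps_const (d * b) * unit_power f (i + 1)"
      unfolding unit_power_Suc[OF f_unit]
      by (simp only: fps_const_neg[symmetric] fps_const_mult[symmetric] algebra_simps
          mult_minus_left mult_minus_right)
    then show ?thesis using V_power V_add by metis
  qed
  have "(\<Sum>i\<in>I. fps_const (e i) * c * unit_power f i) \<in> V" if "finite I" for I e
    using that
  proof induction
    case empty
    show ?case using V_const[of 0] by simp
  next
    case (insert i I)
    then show ?case using V_add[OF *] by simp
  qed
  then show ?thesis by (simp add: S_def)
qed

lemma ss_section_exists: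
  "\<exists>d' k. \<forall>h. ss_act r a b g (fps_const d + fps_X * h) = fps_const d' + fps_X * ss_act r a b k h"
proof -
  obtain s m where g: "g = (s, m)" by (cases g)
  have "fps_const d * unit_power f m + S s \<in> V"
    by (intro V_add V_power V_S)
  then obtain d' s' where eq: "fps_const d * unit_power f m + S s = fps_const d' + fps_X * S s'"
    by (auto simp: V_def)
  have "ss_act r a b g (fps_const d + fps_X * h) = fps_const d' + fps_X * ss_act r a b (s', m) h" for h
  proof -
    have "ss_act r a b g (fps_const d + fps_X * h) =
        (fps_const d * unit_power f m + S s) + fps_X * (unit_power f m * h)"
      by (simp add: g ss_act_eq algebra_simps)
    also have "\<dots> = fps_const d' + fps_X * ss_act r a b (s', m) h"
      unfolding eq ss_act_eq by (simp only: distrib_left ac_simps)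
    finally show ?thesis .
  qed
  then show ?thesis by blast
qed

private lemma X_split:
  assumes "fps_const d + fps_X * p = fps_const d' + fps_X * (q :: 'r fps)"
  shows "d = d'" "p = q"
proof -
  show "d = d'" using arg_cong[OF assms, of "\<lambda>p. fps_nth p 0"] by simp
  then have "fps_X * p = fps_X * q" using assms by simp
  then have "fps_nth (fps_X * p) (Suc n) = fps_nth (fps_X * q) (Suc n)" for n by simp
  then show "p = q" by (simp add: fps_eq_iff)
qed

lemma ss_local_spec:
  "ss_act r a b g (fps_const d + fps_X * h) =
     fps_const (ss_letter r a b g d) + fps_X * ss_act r a b (ss_section r a b g d) h"
  and ss_local_unique:
  "(\<And>h. ss_act r a b g (fps_const d + fps_X * h) = fps_const d' + fps_X * ss_act r a b k h) \<Longrightarrow>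
     ss_letter r a b g d = d' \<and> ss_section r a b g d = k"
proof -
  let ?P = "\<lambda>(d', k). \<forall>h. ss_act r a b g (fps_const d + fps_X * h) =
    fps_const d' + fps_X * ss_act r a b k h"
  have uniq: "x = y" if "?P x" "?P y" for x y
  proof -
    obtain d1 k1 d2 k2 where xy: "x = (d1, k1)" "y = (d2, k2)" by (cases x; cases y)
    have eq: "fps_const d1 + fps_X * ss_act r a b k1 h = fps_const d2 + fps_X * ss_act r a b k2 h" for h
      using that unfolding xy by simp
    have "k1 = k2" by (rule ss_act_faithful) (rule X_split(2)[OF eq])
    then show ?thesis using X_split(1)[OF eq] xy by simp
  qed
  obtain x where x: "?P x" using ss_section_exists[of g d] by auto
  have the: "ss_local r a b g d = y" if "?P y" for y
    unfolding ss_local_def by (rule the_equality[of ?P y]) (use that uniq in blast)+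
  have "?P (ss_local r a b g d)" using the[OF x] x by simp
  then show "ss_act r a b g (fps_const d + fps_X * h) =
      fps_const (ss_letter r a b g d) + fps_X * ss_act r a b (ss_section r a b g d) h"
    by (simp add: ss_letter_def ss_section_def split_beta)
  show "ss_letter r a b g d = d' \<and> ss_section r a b g d = k"
    if "\<And>h. ss_act r a b g (fps_const d + fps_X * h) = fps_const d' + fps_X * ss_act r a b k h"
    using the[of "(d', k)"] that by (simp add: ss_letter_def ss_section_def)
qed

lemma ss_t: "ss_section r a b (0, 1) d = (Poly_Mapping.single 0 d, 1)"
proof -
  have f1: "unit_power f 1 = f" by (simp add: unit_power_def)
  have "f * (fps_const d + fps_X * h) =
      fps_const (d * r) + fps_X * (f * h + fps_const d * c)" for h
  proof -
    have "f * (fps_const d + fps_X * h) = f * fps_const d + fps_X * (f * h)"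
      by (simp only: distrib_left ac_simps)
    also have "f * fps_const d = (fps_const r + fps_X * c) * fps_const d"
      by (rule arg_cong[OF f_eq'])
    also have "\<dots> = fps_const (d * r) + fps_X * (fps_const d * c)"
    proof -
      have "(fps_const r + fps_X * p) * fps_const d = fps_const (d * r) + fps_X * (fps_const d * p)" for p
        by (simp add: algebra_simps flip: fps_const_mult)
      then show ?thesis .
    qed
    finally show ?thesis
      by (simp only: distrib_left ac_simps)
  qed
  then show ?thesis
    using ss_local_unique[of "(0, 1)" d "d * r" "(Poly_Mapping.single 0 d, 1)"]
    by (simp add: ss_act_eq f1 S_0 S_single)
qed

end

lemma map_key_shift:
  fixes s :: "int \<Rightarrow>\<^sub>0 'r::zero"
  shows "Poly_Mapping.lookup (Poly_Mapping.map_key (\<lambda>i. i - m) s) i = Poly_Mapping.lookup s (i - m)"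
  by (simp add: map_key.rep_eq inj_def)

lemma group_lamplighter: "group lamplighter"
proof (rule groupI)
  show "\<exists>y\<in>carrier lamplighter. y \<otimes>\<^bsub>lamplighter\<^esub> x = \<one>\<^bsub>lamplighter\<^esub>"
    if "x \<in> carrier lamplighter" for x :: "(int \<Rightarrow>\<^sub>0 'a) \<times> int"
  proof (cases x)
    case (Pair s m)
    show ?thesis
      by (rule bexI[of _ "(- Poly_Mapping.map_key (\<lambda>i. i - (- m)) s, - m)"])
        (simp_all add: Pair lamplighter_def)
  qed
qed (auto simp: lamplighter_def map_key_shift map_key_id lookup_add algebra_simps intro!: poly_mapping_eqI)

theorem self_similar_action_ss:
  fixes r a b :: "'r::{finite,comm_ring_1}"
  assumes r: "r dvd 1" and ab: "(a - b) dvd 1"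
  shows "self_similar_action lamplighter UNIV (ss_letter r a b) (ss_section r a b)"
proof -
  interpret group "lamplighter :: ((int \<Rightarrow>\<^sub>0 'r) \<times> int) monoid" by (rule group_lamplighter)
  note spec = ss_local_spec[OF r ab] and unique = ss_local_unique[OF r ab]
  have one: "ss_letter r a b \<one>\<^bsub>lamplighter\<^esub> d = d" for d
    using unique[of "\<one>\<^bsub>lamplighter\<^esub>" d d "\<one>\<^bsub>lamplighter\<^esub>"] by (simp add: ss_act_one[OF r ab])
  have mult: "ss_letter r a b (g \<otimes>\<^bsub>lamplighter\<^esub> g') d = ss_letter r a b g (ss_letter r a b g' d) \<and>
      ss_section r a b (g \<otimes>\<^bsub>lamplighter\<^esub> g') d =
        ss_section r a b g (ss_letter r a b g' d) \<otimes>\<^bsub>lamplighter\<^esub> ss_section r a b g' d" for g g' d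
    by (rule unique) (subst ss_act_mult[OF r ab], simp only: spec ss_act_mult[OF r ab])
  have "card {0, 1 :: 'r} \<le> CARD('r)" by (intro card_mono) auto
  then have "2 \<le> CARD('r)" by simp
  then show ?thesis
    by unfold_locales (simp_all add: one mult, simp_all add: lamplighter_def)
qed

text \<open>Under the identification of sequences with power series, the extension of the letterwise
  action to sequences is the original action.\<close>

lemma act_seq_ss:
  fixes r a b :: "'r::{finite,comm_ring_1}"
  assumes r: "r dvd 1" and ab: "(a - b) dvd 1"
  shows "self_similar_action.act_seq (ss_letter r a b) (ss_section r a b) g (fps_nth p) =
    fps_nth (ss_act r a b g p)"
proof
  interpret self_similar_action lamplighter UNIV "ss_letter r a b" "ss_section r a b"
    using self_similar_action_ss[OF r ab] .
  show "act_seq g (fps_nth p) n = fps_nth (ss_act r a b g p) n" for n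
  proof (induction n arbitrary: g p)
    case 0
    have "p = fps_const (fps_nth p 0) + fps_X * fps_shift 1 p"
      by (simp add: fps_eq_iff fps_mult_fps_X_commute)
    then have "ss_act r a b g p = fps_const (ss_letter r a b g (fps_nth p 0)) +
        fps_X * ss_act r a b (ss_section r a b g (fps_nth p 0)) (fps_shift 1 p)"
      using ss_local_spec[OF r ab] by metis
    then show ?case by (simp add: act_seq_def)
  next
    case (Suc n)
    have "p = fps_const (fps_nth p 0) + fps_X * fps_shift 1 p"
      by (simp add: fps_eq_iff fps_mult_fps_X_commute)
    then have "ss_act r a b g p = fps_const (ss_letter r a b g (fps_nth p 0)) +
        fps_X * ss_act r a b (ss_section r a b g (fps_nth p 0)) (fps_shift 1 p)"
      using ss_local_spec[OF r ab] by metis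
    then have "fps_nth (ss_act r a b g p) (Suc n) =
        act_seq (ss_section r a b g (fps_nth p 0)) (fps_nth (fps_shift 1 p)) n"
      by (simp add: Suc)
    also have "\<dots> = act_seq g (fps_nth p) (Suc n)"
    proof -
      have "fps_nth (fps_shift 1 p) = (\<lambda>i. fps_nth p (Suc i))"
        by (simp add: fun_eq_iff)
      then show ?thesis by (simp add: act_seq_def map_upt_Suc del: upt_Suc)
    qed
    finally show ?case ..
  qed
qed

end

theory Submission
  imports Defs "HOL-Library.Function_Algebras" "HOL-Computational_Algebra.Formal_Laurent_Series"
begin

text \<open>In the ring of formal Laurent series every germ of \<open>\<G>\<close> is the germ of an affine map
  \<open>z \<mapsto> x\<^sup>k f\<^sup>m z + e\<close>, with \<open>e\<close> in a locally finite group of translations that is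
  stable under multiplication by \<open>x\<close> and \<open>f\<close>. Hence \<open>\<G>\<close> is the quotient, by the
  group of shifts \<open>x\<^sup>k f\<^sup>m\<close>, of an equivalence relation on pairs of a level \<open>(k, m)\<close> and a series in
  \<open>x\<^sup>k R[[x]]\<close>, and composable \<open>n\<close>-tuples are \<open>n\<close>-simplices of this relation up to shifts. The
  relation is AF, so its homology vanishes in positive degrees, and \<open>H\<^sub>0\<close> is \<open>\<int>[1/q]\<close> with
  \<open>q = |R|\<close>, through the invariant measure. Two exact sequences of Wang type then divide out the
  shifts one at a time: \<open>x\<close> acts on \<open>\<int>[1/q]\<close> as division by \<open>q\<close>, which leaves
  \<open>\<int>/(q - 1)\<close> in degree \<open>0\<close>, and \<open>f\<close> acts trivially on this, which puts a copy of it in each of the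
  degrees \<open>0\<close> and \<open>1\<close>.\<close>

section \<open>Spans and pushforwards of integer-valued functions\<close>

text \<open>An element of the lamplighter group is determined by its exponent of \<open>t\<close>
  and its value at a single sequence, because two elements of equal exponent differ by a
  translation. A germ is therefore determined by its two ends and its degree in Z^2, so chains,
  faces and topology can all be expressed through Laurent series. Quotients of chain groups are
  avoided: an orbit of shifts is represented by its simplex whose first vertex has level zero in the
  coordinates divided out. All complexes then consist of functions on one type, the chain groups of
  a quotient are subgroups of those upstairs, and \<open>normalise\<close> is the projection onto
  them. Let T be the push along a shift that generates the next group to be divided out. On chains 1
  - T is injective, since the levels in a support are bounded, and its image is the kernel of the
  projection; this short exact sequence is what lies behind each Wang step. For x, 1 - T acts on
  Z[1/q] as 1 - 1/q, which is injective with cokernel Z/(q - 1). For f, a unit of R[[x]], balls keep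
  their radius, so T preserves the measure and acts as the identity on that cokernel.\<close>

inductive_set zspan :: "'a::ab_group_add set \<Rightarrow> 'a set" for A where
  zero: "0 \<in> zspan A"
| add: "h \<in> zspan A \<Longrightarrow> g \<in> A \<Longrightarrow> h + g \<in> zspan A"
| diff: "h \<in> zspan A \<Longrightarrow> g \<in> A \<Longrightarrow> h - g \<in> zspan A"

lemma zspan_base: "g \<in> A \<Longrightarrow> g \<in> zspan A"
  using zspan.add[OF zspan.zero] by simp

lemma zspan_uminus: "h \<in> zspan A \<Longrightarrow> - h \<in> zspan A"
proof (induction rule: zspan.induct)
  case (add h g)
  then show ?case using zspan.diff[of "- h" A g] by simp
next
  case (diff h g)
  then show ?case using zspan.add[of "- h" A g] by simp
qed (simp add: zspan.zero)

lemma zspan_add: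
  assumes "h \<in> zspan A" "k \<in> zspan A" shows "h + k \<in> zspan A"
  using assms(2,1)
proof (induction k rule: zspan.induct)
  case (add k g)
  then show ?case using zspan.add[of "h + k" A g] by (simp add: add.assoc)
next
  case (diff k g)
  then show ?case using zspan.diff[of "h + k" A g] by (simp add: add_diff_eq)
qed simp

lemma zspan_diff: "h \<in> zspan A \<Longrightarrow> k \<in> zspan A \<Longrightarrow> h - k \<in> zspan A"
  using zspan_add[of h A "- k"] zspan_uminus[of k A] by simp

lemma zspan_sum: "(\<And>i. i \<in> I \<Longrightarrow> h i \<in> zspan A) \<Longrightarrow> sum h I \<in> zspan A"
  by (induction I rule: infinite_finite_induct) (auto intro: zspan.zero zspan_add)

lemma zspan_sign: "h \<in> zspan A \<Longrightarrow> (- 1) ^ i * h \<in> zspan A" for h :: "'a::comm_ring_1"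
  by (cases "even i") (auto intro: zspan_uminus)

lemma zspan_of_int: "h \<in> zspan A \<Longrightarrow> of_int j * h \<in> zspan A" for h :: "'a::comm_ring_1"
  by (induction j rule: int_induct[where k = 0])
    (auto simp: algebra_simps intro: zspan.zero zspan_add zspan_diff)

lemma zspan_subset: "A \<subseteq> zspan B \<Longrightarrow> zspan A \<subseteq> zspan B"
proof
  fix h assume "A \<subseteq> zspan B" "h \<in> zspan A"
  from this(2) show "h \<in> zspan B"
    by induction (use \<open>A \<subseteq> zspan B\<close> in \<open>auto intro: zspan.zero zspan_add zspan_diff\<close>)
qed

lemma zspan_mono: "A \<subseteq> B \<Longrightarrow> zspan A \<subseteq> zspan B"
  using zspan_subset[of A B] zspan_base by blast

text \<open>A cycle will have to be confined to finitely many cells, so that only finitely many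
  translations occur in it.\<close>

lemma zspan_finite:
  assumes "h \<in> zspan A" shows "\<exists>A0. finite A0 \<and> A0 \<subseteq> A \<and> h \<in> zspan A0"
  using assms
proof induction
  case zero
  show ?case using zspan.zero by (intro exI[of _ "{}"]) auto
next
  case (add h g)
  then obtain A0 where "finite A0" "A0 \<subseteq> A" "h \<in> zspan A0" by blast
  moreover from this have "h + g \<in> zspan (insert g A0)"
    using zspan_mono[of A0 "insert g A0"] by (intro zspan.add) auto
  ultimately show ?case using add by (intro exI[of _ "insert g A0"]) auto
next
  case (diff h g)
  then obtain A0 where "finite A0" "A0 \<subseteq> A" "h \<in> zspan A0" by blast
  moreover from this have "h - g \<in> zspan (insert g A0)"
    using zspan_mono[of A0 "insert g A0"] by (intro zspan.diff) auto
  ultimately show ?case using diff by (intro exI[of _ "insert g A0"]) auto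
qed

text \<open>The induction principle for chains. Typical choices of \<open>P\<close> conjoin
  finiteness of fibres with the property of interest, because additivity of \<open>push\<close>
  needs finite fibres of both summands.\<close>

lemma zspan_closed:
  assumes "h \<in> zspan A" "P 0" "\<And>g. g \<in> A \<Longrightarrow> P g"
    and "\<And>h k. P h \<Longrightarrow> P k \<Longrightarrow> P (h + k)" "\<And>h k. P h \<Longrightarrow> P k \<Longrightarrow> P (h - k)"
  shows "P h"
  using assms(1) by induction (simp_all add: assms(2-))

lemma sum_fun_apply [simp]: "(\<Sum>i\<in>I. f i) x = (\<Sum>i\<in>I. f i x)"
  for f :: "'i \<Rightarrow> 'a \<Rightarrow> 'b::comm_monoid_add"
  by (induction I rule: infinite_finite_induct) simp_all

lemma of_int_fun_apply [simp]: "(of_int j :: 'a \<Rightarrow> 'b::comm_ring_1) x = of_int j"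
  by (induction j rule: int_induct[where k = 0]) simp_all

lemma sign_fun_apply [simp]: "((- 1) ^ i :: 'a \<Rightarrow> 'b::comm_ring_1) x = (- 1) ^ i"
  by (cases "even i") simp_all

text \<open>Over a fibre that meets the support infinitely often the sum takes the default value 0.
  Additivity and functoriality are therefore tied to \<open>finite_fibres\<close>.\<close>

definition push :: "('a \<Rightarrow> 'b) \<Rightarrow> ('a \<Rightarrow> int) \<Rightarrow> 'b \<Rightarrow> int" where
  "push \<phi> h y = (\<Sum>x | \<phi> x = y \<and> h x \<noteq> 0. h x)"

definition finite_fibres :: "('a \<Rightarrow> 'b) \<Rightarrow> ('a \<Rightarrow> int) \<Rightarrow> bool" where
  "finite_fibres \<phi> h \<longleftrightarrow> (\<forall>y. finite {x. \<phi> x = y \<and> h x \<noteq> 0})"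

lemma push_eq_sum:
  assumes "finite Y" "{x. \<phi> x = y \<and> h x \<noteq> 0} \<subseteq> Y" "Y \<subseteq> {x. \<phi> x = y}"
  shows "push \<phi> h y = sum h Y"
  unfolding push_def using assms by (intro sum.mono_neutral_left) auto

lemma finite_fibres_zero [simp]: "finite_fibres \<phi> 0"
  by (simp add: finite_fibres_def)

lemma finite_fibres_add: "finite_fibres \<phi> h \<Longrightarrow> finite_fibres \<phi> k \<Longrightarrow> finite_fibres \<phi> (h + k)"
  unfolding finite_fibres_def
proof
  fix y assume "\<forall>y. finite {x. \<phi> x = y \<and> h x \<noteq> 0}" "\<forall>y. finite {x. \<phi> x = y \<and> k x \<noteq> 0}"
  then have "finite ({x. \<phi> x = y \<and> h x \<noteq> 0} \<union> {x. \<phi> x = y \<and> k x \<noteq> 0})" by simp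
  then show "finite {x. \<phi> x = y \<and> (h + k) x \<noteq> 0}" by (rule rev_finite_subset) auto
qed

lemma finite_fibres_uminus [simp]: "finite_fibres \<phi> (- h) = finite_fibres \<phi> h"
  by (simp add: finite_fibres_def)

lemma finite_fibres_diff: "finite_fibres \<phi> h \<Longrightarrow> finite_fibres \<phi> k \<Longrightarrow> finite_fibres \<phi> (h - k)"
  using finite_fibres_add[of \<phi> h "- k"] by simp

lemma finite_fibres_sign: "finite_fibres \<phi> h \<Longrightarrow> finite_fibres \<phi> ((- 1) ^ i * h)"
  by (cases "even i") simp_all

lemma finite_fibres_indicator: "inj_on \<phi> U \<Longrightarrow> finite_fibres \<phi> (indicator U)"
  unfolding finite_fibres_def
proof
  fix y assume "inj_on \<phi> U"
  then have "finite (\<phi> -` {y} \<inter> U)" by (intro finite_vimage_IntI) auto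
  then show "finite {x. \<phi> x = y \<and> (indicator U x :: int) \<noteq> 0}"
    by (rule rev_finite_subset) (auto simp: indicator_def split: if_splits)
qed

lemma finite_fibres_zspan:
  assumes "h \<in> zspan \<H>" "\<And>g. g \<in> \<H> \<Longrightarrow> finite_fibres \<phi> g"
  shows "finite_fibres \<phi> h"
  by (rule zspan_closed[where P = "finite_fibres \<phi>", OF assms(1)])
    (simp_all only: finite_fibres_zero assms(2) finite_fibres_add finite_fibres_diff)

lemma finite_fibres_cong:
  "(\<And>x. h x \<noteq> 0 \<Longrightarrow> \<phi> x = \<psi> x) \<Longrightarrow> finite_fibres \<phi> h \<longleftrightarrow> finite_fibres \<psi> h"
  unfolding finite_fibres_def by (intro all_cong1 arg_cong[where f = finite]) auto

lemma finite_fibres_inj_on: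
  assumes "finite_fibres \<phi> h" "inj_on \<psi> A" "\<And>x. h x \<noteq> 0 \<Longrightarrow> \<phi> x \<in> A"
  shows "finite_fibres (\<psi> \<circ> \<phi>) h"
  unfolding finite_fibres_def
proof
  fix y
  show "finite {x. (\<psi> \<circ> \<phi>) x = y \<and> h x \<noteq> 0}"
  proof (cases "\<exists>x0. (\<psi> \<circ> \<phi>) x0 = y \<and> h x0 \<noteq> 0")
    case True
    then obtain x0 where x0: "\<psi> (\<phi> x0) = y" "h x0 \<noteq> 0" by auto
    have "{x. (\<psi> \<circ> \<phi>) x = y \<and> h x \<noteq> 0} \<subseteq> {x. \<phi> x = \<phi> x0 \<and> h x \<noteq> 0}"
      using inj_onD[OF assms(2)] assms(3) x0 by fastforce
    then show ?thesis using assms(1) finite_subset unfolding finite_fibres_def by blast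
  next
    case False
    then have "{x. (\<psi> \<circ> \<phi>) x = y \<and> h x \<noteq> 0} = {}" by blast
    then show ?thesis by (simp only: finite.emptyI)
  qed
qed

lemma push_zero [simp]: "push \<phi> 0 = 0"
  by (simp add: push_def fun_eq_iff)

lemma push_add:
  assumes "finite_fibres \<phi> h" "finite_fibres \<phi> k"
  shows "push \<phi> (h + k) = push \<phi> h + push \<phi> k"
proof
  fix y
  let ?Y = "{x. \<phi> x = y \<and> h x \<noteq> 0} \<union> {x. \<phi> x = y \<and> k x \<noteq> 0}"
  have fin: "finite ?Y" using assms by (simp add: finite_fibres_def)
  have "push \<phi> (h + k) y = sum (h + k) ?Y" "push \<phi> h y = sum h ?Y" "push \<phi> k y = sum k ?Y"
    by (rule push_eq_sum[OF fin]; auto)+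
  then show "push \<phi> (h + k) y = (push \<phi> h + push \<phi> k) y" by (simp add: sum.distrib)
qed

lemma push_uminus: "push \<phi> (- h) = - push \<phi> h"
  by (simp add: push_def fun_eq_iff sum_negf)

lemma push_diff:
  "finite_fibres \<phi> h \<Longrightarrow> finite_fibres \<phi> k \<Longrightarrow> push \<phi> (h - k) = push \<phi> h - push \<phi> k"
  using push_add[of \<phi> h "- k"] by (simp add: push_uminus)

lemma push_sign: "push \<phi> ((- 1) ^ i * h) = (- 1) ^ i * push \<phi> h"
  by (cases "even i") (simp_all add: push_uminus)

lemma push_of_int: "push \<phi> (of_int j * h) = of_int j * push \<phi> h"
  by (cases "j = 0") (simp_all add: push_def fun_eq_iff sum_distrib_left)

lemma push_sum:
  assumes "\<And>i. i \<in> I \<Longrightarrow> finite_fibres \<phi> (h i)"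
  shows "push \<phi> (\<Sum>i\<in>I. h i) = (\<Sum>i\<in>I. push \<phi> (h i))"
proof -
  have "finite_fibres \<phi> (\<Sum>i\<in>I. h i) \<and> push \<phi> (\<Sum>i\<in>I. h i) = (\<Sum>i\<in>I. push \<phi> (h i))"
    using assms
    by (induction I rule: infinite_finite_induct) (auto simp: push_add intro: finite_fibres_add)
  then show ?thesis ..
qed

text \<open>A fibre of \<open>\<psi>\<close> lies in a fibre of the composite, and the support of
  \<open>push \<psi> h\<close> lies in the image of the support of \<open>h\<close>.\<close>

lemma finite_fibres_comp:
  assumes "finite_fibres (\<phi> \<circ> \<psi>) h" shows "finite_fibres \<psi> h" "finite_fibres \<phi> (push \<psi> h)"
proof -
  show fib: "finite_fibres \<psi> h"
    unfolding finite_fibres_def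
  proof
    fix y
    have "finite {x. (\<phi> \<circ> \<psi>) x = \<phi> y \<and> h x \<noteq> 0}" using assms by (simp add: finite_fibres_def)
    then show "finite {x. \<psi> x = y \<and> h x \<noteq> 0}" by (rule rev_finite_subset) auto
  qed
  show "finite_fibres \<phi> (push \<psi> h)"
    unfolding finite_fibres_def
  proof
    fix z
    have "finite (\<psi> ` {x. (\<phi> \<circ> \<psi>) x = z \<and> h x \<noteq> 0})" using assms by (simp add: finite_fibres_def)
    moreover have "\<exists>x. \<psi> x = y \<and> h x \<noteq> 0" if "push \<psi> h y \<noteq> 0" for y
      using that unfolding push_def by (metis (mono_tags, lifting) mem_Collect_eq sum.neutral)
    ultimately show "finite {y. \<phi> y = z \<and> push \<psi> h y \<noteq> 0}"
      by (elim rev_finite_subset) force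
  qed
qed

text \<open>The finite fibre of the composite is sorted by the values of
  \<open>\<psi>\<close>.\<close>

lemma push_push:
  assumes "finite_fibres (\<phi> \<circ> \<psi>) h"
  shows "push \<phi> (push \<psi> h) = push (\<phi> \<circ> \<psi>) h"
proof
  fix z
  let ?Z = "{x. (\<phi> \<circ> \<psi>) x = z \<and> h x \<noteq> 0}"
  have fin: "finite ?Z" using assms by (simp add: finite_fibres_def)
  have "push (\<phi> \<circ> \<psi>) h z = sum h ?Z" by (simp add: push_def)
  also have "\<dots> = (\<Sum>y\<in>\<psi> ` ?Z. sum h {x \<in> ?Z. \<psi> x = y})"
    using fin by (subst sum.group) auto
  also have "\<dots> = (\<Sum>y\<in>\<psi> ` ?Z. push \<psi> h y)"
    unfolding push_def by (intro sum.cong refl arg_cong[where f = "sum h"]) auto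
  also have "\<dots> = push \<phi> (push \<psi> h) z"
  proof (rule push_eq_sum[symmetric])
    have "\<exists>x. \<psi> x = y \<and> h x \<noteq> 0" if "push \<psi> h y \<noteq> 0" for y
      using that unfolding push_def by (metis (mono_tags, lifting) mem_Collect_eq sum.neutral)
    then show "{x. \<phi> x = z \<and> push \<psi> h x \<noteq> 0} \<subseteq> \<psi> ` ?Z" by force
  qed (use fin in auto)
  finally show "push \<phi> (push \<psi> h) z = push (\<phi> \<circ> \<psi>) h z" ..
qed

lemma push_cong: "(\<And>x. h x \<noteq> 0 \<Longrightarrow> \<phi> x = \<psi> x) \<Longrightarrow> push \<phi> h = push \<psi> h"
  unfolding push_def by (intro ext sum.cong) auto

lemma push_eq_self:
  assumes "\<And>x. h x \<noteq> 0 \<Longrightarrow> \<phi> x = x" shows "push \<phi> h = h"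
proof
  fix y
  have "{x. \<phi> x = y \<and> h x \<noteq> 0} = (if h y = 0 then {} else {y})" using assms by force
  then show "push \<phi> h y = h y" by (simp add: push_def)
qed

lemma push_indicator:
  assumes "inj_on \<phi> U" shows "push \<phi> (indicator U) = indicator (\<phi> ` U)"
proof
  fix y
  have "{x. \<phi> x = y \<and> (indicator U x :: int) \<noteq> 0} = {x \<in> U. \<phi> x = y}"
    by (auto simp: indicator_def split: if_splits)
  moreover have "{x \<in> U. \<phi> x = y} = (if y \<in> \<phi> ` U then {inv_into U \<phi> y} else {})"
    using assms by (auto simp: inj_on_def f_inv_into_f inv_into_into)
  ultimately show "push \<phi> (indicator U) y = indicator (\<phi> ` U) y"
    by (auto simp: push_def inv_into_into split: if_splits)
qed

lemma push_support: "push \<phi> h y \<noteq> 0 \<Longrightarrow> \<exists>x. \<phi> x = y \<and> h x \<noteq> 0"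
  unfolding push_def by (metis (mono_tags, lifting) mem_Collect_eq sum.neutral)

lemma pushforward_eq_push:
  assumes "\<And>x. h x \<noteq> 0 \<Longrightarrow> x \<in> topspace T" shows "pushforward T \<phi> h = push \<phi> h"
  unfolding pushforward_def push_def using assms by (intro ext sum.cong) auto

text \<open>The cancellation behind the vanishing of a double boundary: the pair (i, j) with i < j
  is matched with (j - 1, i), whose sign is opposite and whose term is the same by the simplicial
  identity.\<close>

lemma alternating_double_sum:
  fixes F :: "nat \<Rightarrow> nat \<Rightarrow> 'a::comm_ring_1"
  assumes "\<And>i j. i < j \<Longrightarrow> j \<le> Suc n \<Longrightarrow> F i j = F (j - 1) i"
  shows "(\<Sum>i\<le>n. \<Sum>j\<le>Suc n. (- 1) ^ (i + j) * F i j) = 0"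
proof -
  let ?g = "\<lambda>(i, j). (- 1) ^ (i + j) * F i j"
  let ?U = "{(i, j). i < j \<and> j \<le> Suc n}" and ?L = "{(i, j). j \<le> i \<and> i \<le> n}"
  have fin: "finite ?U" "finite ?L"
    by (rule finite_subset[of _ "{..Suc n} \<times> {..Suc n}"]; auto)+
  have "(\<Sum>i\<le>n. \<Sum>j\<le>Suc n. (- 1) ^ (i + j) * F i j) = sum ?g ({..n} \<times> {..Suc n})"
    by (simp only: sum.cartesian_product)
  also have "{..n} \<times> {..Suc n} = ?U \<union> ?L" by auto
  also have "sum ?g (?U \<union> ?L) = sum ?g ?U + sum ?g ?L"
    using fin by (intro sum.union_disjoint) auto
  also have "sum ?g ?U = (\<Sum>(i, j)\<in>?L. - ((- 1) ^ (i + j) * F i j))"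
  proof (rule sum.reindex_bij_witness[where i = "\<lambda>(i, j). (j, Suc i)" and j = "\<lambda>(i, j). (j - 1, i)"])
    fix p assume "p \<in> ?U"
    then obtain i j where p: "p = (i, Suc j)" "i \<le> j" "j \<le> n"
      by (cases p; cases "snd p") auto
    then show "(case (case p of (i, j) \<Rightarrow> (j - 1, i)) of (i, j) \<Rightarrow> - ((- 1) ^ (i + j) * F i j)) =
        (case p of (i, j) \<Rightarrow> (- 1) ^ (i + j) * F i j)"
      using assms[of i "Suc j"] by (simp add: add.commute)
  qed auto
  also have "\<dots> = - sum ?g ?L" by (simp add: sum_negf split_def)
  finally show ?thesis by simp
qed

unbundle fps_syntax

section \<open>The group of integer-valued functions in terms of pointwise arithmetic\<close>

lemma group_int_functions: "group (int_functions :: ('b \<Rightarrow> int) monoid)"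
proof (rule groupI)
  show "\<exists>k\<in>carrier int_functions. k \<otimes>\<^bsub>int_functions\<^esub> h = \<one>\<^bsub>int_functions\<^esub>" for h :: "'b \<Rightarrow> int"
    by (rule bexI[of _ "- h"]) (simp_all add: int_functions_def)
qed (simp_all add: int_functions_def add.assoc)

lemma int_functions_simps [simp]:
  "carrier int_functions = UNIV" "h \<otimes>\<^bsub>int_functions\<^esub> k = h + k" "\<one>\<^bsub>int_functions\<^esub> = 0"
  by (simp_all add: int_functions_def fun_eq_iff)

lemma inv_int_functions [simp]: "inv\<^bsub>int_functions\<^esub> h = - h"
  by (rule group.inv_equality[OF group_int_functions]) simp_all

text \<open>The bridge from the algebraic definition of chain groups to \<open>zspan\<close>, with
  which the proof works from here on.\<close>

lemma carrier_generated_int_functions: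
  "carrier (subgroup_generated int_functions A) = zspan A"
proof -
  have "generate int_functions A = zspan A"
  proof (intro equalityI subsetI)
    show "h \<in> zspan A" if "h \<in> generate int_functions A" for h
      using that
    proof induction
      case one
      show ?case by (simp only: int_functions_simps zspan.zero)
    next
      case (inv h)
      then show ?case by (simp only: inv_int_functions zspan_uminus zspan_base)
    qed (simp_all only: int_functions_simps zspan_base zspan_add)
    show "h \<in> generate int_functions A" if "h \<in> zspan A" for h
      using that
    proof induction
      case zero
      show ?case using generate.one[of int_functions A] by (simp only: int_functions_simps)
    next
      case (add h g)
      then show ?case using generate.eng[OF add.IH generate.incl[OF add.hyps(2)]] by (simp only: int_functions_simps)
    next
      case (diff h g)
      then show ?case using generate.eng[OF diff.IH generate.inv[OF diff.hyps(2)]]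
        by (simp only: int_functions_simps inv_int_functions add_uminus_conv_diff)
    qed
  qed
  then show ?thesis by (simp add: carrier_subgroup_generated)
qed

section \<open>The ring of translations\<close>

text \<open>Adding 1 permutes the ring, so summing x + 1 over all x gives the sum of all x
  again.\<close>

lemma of_nat_card_eq_0: "of_nat CARD('r::{finite,ring_1}) = (0::'r)"
proof -
  have "(\<Sum>x\<in>(UNIV::'r set). x + 1) = (\<Sum>x\<in>UNIV. x)"
    by (rule sum.reindex_bij_witness[where i = "\<lambda>x. x - 1" and j = "\<lambda>x. x + 1"]) auto
  then show ?thesis by (simp add: sum.distrib)
qed

text \<open>A Laurent series is bounded below, so vanishing from degree N on leaves finitely many
  coefficients.\<close>

lemma fls_eq_sum_monomials:
  fixes p :: "'a::comm_ring_1 fls"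
  assumes "\<And>i. i \<ge> N \<Longrightarrow> p $$ i = 0"
  shows "p = (\<Sum>i\<in>{i. p $$ i \<noteq> 0}. fls_shift (- i) (fls_const (p $$ i)))" "finite {i. p $$ i \<noteq> 0}"
proof -
  have "i \<in> {fls_subdegree p..N}" if "p $$ i \<noteq> 0" for i
    using assms[of i] that fls_subdegree_leI[of p i] by force
  then have "{i. p $$ i \<noteq> 0} \<subseteq> {fls_subdegree p..N}" by blast
  then show fin: "finite {i. p $$ i \<noteq> 0}" by (rule finite_subset) simp
  show "p = (\<Sum>i\<in>{i. p $$ i \<noteq> 0}. fls_shift (- i) (fls_const (p $$ i)))"
  proof (rule fls_eqI)
    fix n
    have "(\<Sum>i\<in>{i. p $$ i \<noteq> 0}. fls_shift (- i) (fls_const (p $$ i))) $$ n =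
        (\<Sum>i\<in>{i. p $$ i \<noteq> 0}. if i = n then p $$ n else 0)"
      unfolding fls_nth_sum by (intro sum.cong) auto
    also have "\<dots> = p $$ n" using fin by simp
    finally show "p $$ n = (\<Sum>i\<in>{i. p $$ i \<noteq> 0}. fls_shift (- i) (fls_const (p $$ i))) $$ n" ..
  qed
qed

text \<open>The filtration of R((x)) by the groups x^M R[[x]]; these serve as the balls around
  0.\<close>

definition small :: "int \<Rightarrow> 'r::zero fls set" where
  "small M = {e. \<forall>i<M. e $$ i = 0}"

lemma small_zero [simp]: "0 \<in> small M" by (simp add: small_def)
lemma small_add: "x \<in> small M \<Longrightarrow> y \<in> small M \<Longrightarrow> x + y \<in> small M" for x :: "'r::comm_ring_1 fls"
  by (simp add: small_def)

lemma small_diff: "x \<in> small M \<Longrightarrow> y \<in> small M \<Longrightarrow> x - y \<in> small M" for x :: "'r::comm_ring_1 fls"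
  by (simp add: small_def)

lemma small_uminus: "x \<in> small M \<Longrightarrow> - x \<in> small M" for x :: "'r::comm_ring_1 fls"
  by (simp add: small_def)

lemma small_mono: "M \<le> M' \<Longrightarrow> x \<in> small M' \<Longrightarrow> x \<in> small M"
  by (simp add: small_def)

lemma fps_to_fls_small: "fps_to_fls p \<in> small 0"
  by (simp add: small_def)

lemma small_0E: "e \<in> small 0 \<Longrightarrow> fps_to_fls (fls_regpart e) = e"
  by (rule fls_eqI) (auto simp: small_def)

lemma small_exists: "\<exists>M. e \<in> small M"
  by (rule exI[of _ "fls_subdegree e"]) (simp add: small_def)

lemma small_mult_fps: "e \<in> small M \<Longrightarrow> fps_to_fls p * e \<in> small M" for p :: "'r::comm_ring_1 fps"
proof (cases "e = 0")
  case False
  assume "e \<in> small M"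
  then have "M \<le> fls_subdegree e" using False by (intro fls_subdegree_geI) (auto simp: small_def)
  then have "i < fls_subdegree (fps_to_fls p) + fls_subdegree e" if "i < M" for i
    using that fls_subdegree_fls_to_fps_gt0[of p] by linarith
  then show ?thesis by (simp add: small_def fls_times_nth_eq0)
qed simp

section \<open>The affine action and its translations\<close>

locale skipper_steinberg =
  fixes r a b :: "'r::{finite,comm_ring_1}"
  assumes r: "r dvd 1" and ab: "(a - b) dvd 1"
begin

abbreviation "ser \<equiv> ss_series r a b"

text \<open>The action of the lamps \<open>s\<close> is a translation, so its value at 0 is the
  series that is added.\<close>

definition lamp :: "(int \<Rightarrow>\<^sub>0 'r) \<Rightarrow> 'r fps" where
  "lamp s = ss_act r a b (s, 0) 0"

lemma ss_act_affine: "ss_act r a b (s, m) h = unit_power ser m * h + lamp s"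
  by (simp add: ss_act_def lamp_def Let_def)

lemma ser_unit: "ser dvd 1"
proof (rule fps_unit_iff)
  have "(1 - fps_const b * fps_X) dvd 1" by (rule fps_unit_iff) simp
  from arg_cong[OF unit_inv[OF this], of "\<lambda>p. fps_nth p 0"] show "fps_nth ser 0 dvd 1"
    by (simp add: ss_series_def r)
qed

lemma lamp_inj: "lamp s = lamp s' \<Longrightarrow> s = s'"
  using ss_act_faithful[OF r ab, of "(s, 0)" "(s', 0)"] by (simp add: ss_act_affine)

lemma lamp_zero [simp]: "lamp 0 = 0"
  by (simp add: lamp_def ss_act_def)

lemma lamp_add: "lamp (s + s') = lamp s + lamp s'"
proof -
  have "(s, 0) \<otimes>\<^bsub>lamplighter\<^esub> (s', 0) = (s + s', 0)"
    by (simp add: lamplighter_def map_key_id)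
  then have "ss_act r a b (s + s', 0) 0 = ss_act r a b (s, 0) (ss_act r a b (s', 0) 0)"
    using ss_act_mult[OF r ab, of "(s, 0)" "(s', 0)" 0] by simp
  then show ?thesis by (simp add: ss_act_affine)
qed

lemma lamp_uminus: "lamp (- s) = - lamp s"
  using lamp_add[of s "- s"] by (simp add: eq_neg_iff_add_eq_0 add.commute)

text \<open>Conjugation by a power of \<open>t\<close> moves the lamps, and on translations it is
  multiplication by the same power of f.\<close>

lemma lamp_times_ser: "\<exists>s'. unit_power ser m * lamp s = lamp s'"
proof -
  have "(0, m) \<otimes>\<^bsub>lamplighter\<^esub> (s, 0) = (Poly_Mapping.map_key (\<lambda>i. i - m) s, m)"
    by (simp add: lamplighter_def)
  then have "lamp (Poly_Mapping.map_key (\<lambda>i. i - m) s) = unit_power ser m * lamp s"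
    using ss_act_mult[OF r ab, of "(0, m)" "(s, 0)" 0] by (simp add: ss_act_affine)
  then show ?thesis by metis
qed

text \<open>This is the section of a translation at the letter 0. Evaluated at 0, a section
  contributes only its lamp part, whatever its exponent of \<open>t\<close>.\<close>

lemma lamp_step: "\<exists>c s'. lamp s = fps_const c + fps_X * lamp s'"
proof -
  obtain s' m' where sec: "ss_section r a b (s, 0) 0 = (s', m')" by fastforce
  have "lamp s = ss_act r a b (s, 0) (fps_const 0 + fps_X * 0)" by (simp add: lamp_def)
  also have "\<dots> = fps_const (ss_letter r a b (s, 0) 0) + fps_X * ss_act r a b (s', m') 0"
    unfolding ss_local_spec[OF r ab] sec ..
  finally show ?thesis by (auto simp: ss_act_affine)
qed

text \<open>The section of a power of \<open>t\<close> at the letter d. It describes the product of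
  a power of f with a monomial.\<close>

lemma ser_power_step: "\<exists>c s'. unit_power ser m * fps_const d = fps_const c + fps_X * lamp s'"
proof -
  obtain s' m' where sec: "ss_section r a b (0, m) d = (s', m')" by fastforce
  have "unit_power ser m * fps_const d = ss_act r a b (0, m) (fps_const d + fps_X * 0)"
    by (simp add: ss_act_affine)
  also have "\<dots> = fps_const (ss_letter r a b (0, m) d) + fps_X * ss_act r a b (s', m') 0"
    unfolding ss_local_spec[OF r ab] sec ..
  finally show ?thesis by (auto simp: ss_act_affine)
qed

text \<open>Subtracting the defining identity at h = 0 from that at h = 1 isolates the linear parts,
  so the two powers of f coincide; faithfulness then gives equal exponents.\<close>

lemma section_degree: "snd (ss_section r a b g d) = snd g"
proof -
  obtain s m s' m' where g: "g = (s, m)" "ss_section r a b g d = (s', m')" by fastforce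
  have eq: "unit_power ser m * (fps_const d + fps_X * h) + lamp s =
      fps_const (ss_letter r a b g d) + fps_X * (unit_power ser m' * h + lamp s')" for h
    using ss_local_spec[OF r ab, of g d h] unfolding g(2) by (simp add: g(1) ss_act_affine)
  have "fps_X * unit_power ser m = fps_X * unit_power ser m'"
    using arg_cong2[OF eq[of 1] eq[of 0], of "(-)"] by (simp add: algebra_simps)
  then have "fps_nth (fps_X * unit_power ser m) (Suc n) = fps_nth (fps_X * unit_power ser m') (Suc n)" for n
    by simp
  then have "unit_power ser m = unit_power ser m'" by (simp add: fps_eq_iff)
  then have "(0, m) = (0 :: int \<Rightarrow>\<^sub>0 'r, m')"
    by (intro ss_act_faithful[OF r ab]) (simp add: ss_act_affine)
  then show ?thesis using g by simp
qed

text \<open>The unit x^k f^m of R((x)), the linear part of an affine map of degree (k, m).\<close>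

definition scale :: "int \<times> int \<Rightarrow> 'r fls" where
  "scale v = fls_X_intpow (fst v) * fps_to_fls (unit_power ser (snd v))"

lemma scale_times: "scale v * e = fls_shift (- fst v) (fps_to_fls (unit_power ser (snd v)) * e)"
  by (simp add: scale_def fls_shifted_times_simps)

lemma scale_zero [simp]: "scale 0 = 1"
  by (simp add: scale_def)

lemma scale_add: "scale (v + w) = scale v * scale w"
  unfolding scale_def fst_add snd_add unit_power_add[OF ser_unit] fls_times_fps_to_fls
    fls_X_intpow_times_fls_X_intpow[symmetric] by (simp only: ac_simps)

lemma scale_inverse: "scale (- v) * scale v = 1"
  by (simp flip: scale_add)

lemma scale_cancel: "scale (- v) * (scale v * p) = p" "scale v * (scale (- v) * p) = p"
  using scale_inverse[of v] scale_inverse[of "- v"] by (simp_all flip: mult.assoc)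

lemma scale_times_eq_iff: "scale v * p = scale v * q \<longleftrightarrow> p = q"
  using scale_cancel(1) by metis

lemma scale_small: "e \<in> small M \<Longrightarrow> scale v * e \<in> small (M + fst v)"
proof -
  assume "e \<in> small M"
  then have "fps_to_fls (unit_power ser (snd v)) * e \<in> small M" by (rule small_mult_fps)
  then show ?thesis
    by (simp add: scale_times small_def)
qed

lemma scale_small_iff: "scale v * e \<in> small M \<longleftrightarrow> e \<in> small (M - fst v)"
  using scale_small[of e "M - fst v" v] scale_small[of "scale v * e" M "- v"]
  by (auto simp: scale_cancel)

lemma scale_times_small: "(*) (scale v) ` small M = small (M + fst v)"
proof
  show "small (M + fst v) \<subseteq> (*) (scale v) ` small M"
  proof
    fix e :: "'r fls" assume "e \<in> small (M + fst v)"
    then have "scale (- v) * e \<in> small M" by (simp add: scale_small_iff)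
    then show "e \<in> (*) (scale v) ` small M" by (metis image_eqI scale_cancel(2))
  qed
qed (auto intro: scale_small)

abbreviation tail :: "int \<Rightarrow> (int \<Rightarrow>\<^sub>0 'r) \<Rightarrow> 'r fls" where
  "tail N s \<equiv> fls_shift (- N) (fps_to_fls (lamp s))"

text \<open>The translation parts of all partial affine maps in the groupoid.\<close>

definition transl :: "'r fls set" where
  "transl = {e. \<exists>N s. \<forall>i\<ge>N. (e - tail N s) $$ i = 0}"

lemma tail_step: "\<exists>c s'. tail N s = fls_shift (- N) (fls_const c) + tail (N + 1) s'"
proof -
  obtain c s' where "lamp s = fps_const c + fps_X * lamp s'" using lamp_step by blast
  then have "tail N s = fls_shift (- N) (fls_const c) + fls_shift (- N) (fls_X * fps_to_fls (lamp s'))"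
    by (simp add: fls_times_fps_to_fls)
  moreover have "fls_shift (- N) (fls_X * fps_to_fls (lamp s')) = tail (N + 1) s'"
    by (simp add: fls_X_times_conv_shift add.commute[of N])
  ultimately show ?thesis by metis
qed

text \<open>The cut N moves up by one when the lowest coefficient of the tail is peeled off by
  \<open>tail_step\<close> and counted among the finitely many free coefficients. Two elements can
  thus be compared at a common cut.\<close>

lemma transl_raise:
  assumes "\<forall>i\<ge>N. (e - tail N s) $$ i = 0" "N \<le> N'"
  shows "\<exists>s'. \<forall>i\<ge>N'. (e - tail N' s') $$ i = 0"
  using assms(2)
proof (induction N' rule: int_ge_induct)
  case base
  show ?case using assms(1) by blast
next
  case (step N')
  then obtain s' where s': "\<forall>i\<ge>N'. (e - tail N' s') $$ i = 0" by blast
  obtain c t where "tail N' s' = fls_shift (- N') (fls_const c) + tail (N' + 1) t"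
    using tail_step by blast
  then have "(e - tail (N' + 1) t) $$ i = 0" if "i \<ge> N' + 1" for i
    using s' that by (auto dest!: spec[of _ i])
  then show ?case by blast
qed

lemma transl_witness:
  assumes "e \<in> transl" obtains N where "\<And>N'. N \<le> N' \<Longrightarrow> \<exists>s. \<forall>i\<ge>N'. (e - tail N' s) $$ i = 0"
  using assms transl_raise unfolding transl_def by blast

lemma transl_add: assumes "d \<in> transl" "e \<in> transl" shows "d + e \<in> transl"
proof -
  obtain N where N: "\<And>N'. N \<le> N' \<Longrightarrow> \<exists>s. \<forall>i\<ge>N'. (d - tail N' s) $$ i = 0"
    using assms(1) transl_witness by blast
  obtain K where K: "\<And>N'. K \<le> N' \<Longrightarrow> \<exists>s. \<forall>i\<ge>N'. (e - tail N' s) $$ i = 0"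
    using assms(2) transl_witness by blast
  obtain s where s: "\<forall>i\<ge>max N K. (d - tail (max N K) s) $$ i = 0" using N[of "max N K"] by auto
  obtain t where t: "\<forall>i\<ge>max N K. (e - tail (max N K) t) $$ i = 0" using K[of "max N K"] by auto
  have "\<forall>i\<ge>max N K. (d + e - tail (max N K) (s + t)) $$ i = 0"
  proof (intro allI impI)
    fix i assume "max N K \<le> i"
    then show "(d + e - tail (max N K) (s + t)) $$ i = 0"
      using s[rule_format, of i] t[rule_format, of i] by (simp add: lamp_add algebra_simps)
  qed
  then show ?thesis unfolding transl_def by blast
qed

lemma transl_uminus: assumes "e \<in> transl" shows "- e \<in> transl"
proof -
  obtain N s where s: "\<forall>i\<ge>N. (e - tail N s) $$ i = 0" using assms by (auto simp: transl_def)
  have "\<forall>i\<ge>N. (- e - tail N (- s)) $$ i = 0"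
  proof (intro allI impI)
    fix i assume "N \<le> i"
    then show "(- e - tail N (- s)) $$ i = 0" using s[rule_format, of i] by (simp add: lamp_uminus)
  qed
  then show ?thesis unfolding transl_def by blast
qed

lemma transl_diff: "d \<in> transl \<Longrightarrow> e \<in> transl \<Longrightarrow> d - e \<in> transl"
  using transl_add[of d "- e"] transl_uminus by simp

lemma transl_polynomial: "(\<And>i. i \<ge> N \<Longrightarrow> e $$ i = 0) \<Longrightarrow> e \<in> transl"
  unfolding transl_def by (intro CollectI exI[of _ N] exI[of _ 0]) simp

lemma transl_zero [simp]: "0 \<in> transl"
  by (rule transl_polynomial) simp

lemma transl_tail: "tail N s \<in> transl"
  unfolding transl_def by (auto intro!: exI[of _ N] exI[of _ s])

lemma transl_sum: "(\<And>i. i \<in> I \<Longrightarrow> d i \<in> transl) \<Longrightarrow> sum d I \<in> transl"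
  by (induction I rule: infinite_finite_induct) (auto intro: transl_add)

lemma transl_shift: assumes "e \<in> transl" shows "fls_shift n e \<in> transl"
proof -
  obtain N s where s: "\<forall>i\<ge>N. (e - tail N s) $$ i = 0" using assms by (auto simp: transl_def)
  have "\<forall>i\<ge>N - n. (fls_shift n e - tail (N - n) s) $$ i = 0"
  proof (intro allI impI)
    fix i assume "N - n \<le> i"
    then show "(fls_shift n e - tail (N - n) s) $$ i = 0"
      using s[rule_format, of "i + n"] by (simp add: algebra_simps)
  qed
  then show ?thesis unfolding transl_def by blast
qed

text \<open>The part below the cut is a finite sum of monomials, each handled by the section of a
  power of \<open>t\<close>; the tail is handled by conjugation.\<close>

lemma transl_times_ser: assumes "e \<in> transl" shows "fps_to_fls (unit_power ser m) * e \<in> transl"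
proof -
  let ?F = "fps_to_fls (unit_power ser m)"
  obtain N s where s: "\<forall>i\<ge>N. (e - tail N s) $$ i = 0" using assms by (auto simp: transl_def)
  define p where "p = e - tail N s"
  have mono: "?F * fls_shift (- i) (fls_const c) \<in> transl" for i c
  proof -
    obtain c' s' where "unit_power ser m * fps_const c = fps_const c' + fps_X * lamp s'"
      using ser_power_step by blast
    from arg_cong[OF this, of fps_to_fls] have "?F * fls_const c = fls_const c' + tail 1 s'"
      by (simp add: fls_times_fps_to_fls fls_X_times_conv_shift)
    then have "?F * fls_const c \<in> transl"
      using transl_add[OF transl_polynomial[of 1] transl_tail] by simp
    then have "fls_shift (- i) (?F * fls_const c) \<in> transl" by (rule transl_shift)
    then show ?thesis by (simp only: fls_shifted_times_simps)
  qed
  have "p = (\<Sum>i\<in>{i. p $$ i \<noteq> 0}. fls_shift (- i) (fls_const (p $$ i)))"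
    by (rule fls_eq_sum_monomials[of N]) (use s p_def in auto)
  then have "?F * p = (\<Sum>i\<in>{i. p $$ i \<noteq> 0}. ?F * fls_shift (- i) (fls_const (p $$ i)))"
    unfolding sum_distrib_left[symmetric] by (rule arg_cong)
  then have 1: "?F * p \<in> transl" by (rule ssubst) (intro transl_sum mono)
  obtain s' where "unit_power ser m * lamp s = lamp s'" using lamp_times_ser by blast
  from arg_cong[OF this, of fps_to_fls] have "?F * tail N s = tail N s'"
    by (simp only: fls_shifted_times_simps fls_times_fps_to_fls)
  then have 2: "?F * tail N s \<in> transl" using transl_tail by simp
  have "?F * e = ?F * p + ?F * tail N s" by (simp add: p_def algebra_simps)
  then show ?thesis using transl_add[OF 1 2] by simp
qed

lemma transl_scale: "e \<in> transl \<Longrightarrow> scale v * e \<in> transl"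
  using transl_shift[OF transl_times_ser, of e "- fst v" "snd v"]
  by (simp add: scale_times)

text \<open>The characteristic of R divides its cardinality.\<close>

lemma transl_torsion: "of_int n * e = of_int (n mod int CARD('r)) * (e :: 'r fls)"
proof -
  have "of_nat CARD('r) = (0 :: 'r fls)" by (simp add: fls_of_nat of_nat_card_eq_0)
  then have "of_int (n div int CARD('r) * int CARD('r)) = (0 :: 'r fls)"
    by (simp only: of_int_mult of_int_of_nat_eq mult_zero_right)
  then have "of_int (n div int CARD('r) * int CARD('r) + n mod int CARD('r)) =
      (of_int (n mod int CARD('r)) :: 'r fls)" by (simp only: of_int_add add_0_left)
  then show ?thesis by simp
qed

text \<open>Local finiteness of the group of translations makes the underlying equivalence relation AF.\<close>

lemma finite_transl_subgroup:
  assumes "finite \<Delta>" "\<Delta> \<subseteq> transl"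
  obtains F where "finite F" "\<Delta> \<subseteq> F" "F \<subseteq> transl" "0 \<in> F" "\<And>x y. x \<in> F \<Longrightarrow> y \<in> F \<Longrightarrow> x - y \<in> F"
proof -
  have "\<exists>F. finite F \<and> \<Delta> \<subseteq> F \<and> F \<subseteq> transl \<and> 0 \<in> F \<and> (\<forall>x\<in>F. \<forall>y\<in>F. x - y \<in> F)"
    using assms
  proof induction
    case empty
    show ?case by (rule exI[of _ "{0}"]) simp
  next
    case (insert d \<Delta>)
    then obtain F where F: "finite F" "\<Delta> \<subseteq> F" "F \<subseteq> transl" "0 \<in> F" "\<forall>x\<in>F. \<forall>y\<in>F. x - y \<in> F"
      by auto
    \<comment> \<open>The group F + Zd. It is finite because the integer n matters only modulo the
      cardinality of R.\<close>
    define F' where "F' = (\<lambda>(x, n). x + of_int n * d) ` (F \<times> UNIV)"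
    have "F' = (\<lambda>(x, n). x + of_int n * d) ` (F \<times> {0..<int CARD('r)})"
    proof
      show "F' \<subseteq> (\<lambda>(x, n). x + of_int n * d) ` (F \<times> {0..<int CARD('r)})"
      proof
        fix y assume "y \<in> F'"
        then obtain x n where "x \<in> F" "y = x + of_int n * d" by (auto simp: F'_def)
        then have "y = (\<lambda>(x, n). x + of_int n * d) (x, n mod int CARD('r))"
          using transl_torsion[of n d] by simp
        moreover have "(x, n mod int CARD('r)) \<in> F \<times> {0..<int CARD('r)}" using \<open>x \<in> F\<close> by simp
        ultimately show "y \<in> (\<lambda>(x, n). x + of_int n * d) ` (F \<times> {0..<int CARD('r)})" by (rule image_eqI)
      qed
    qed (auto simp: F'_def)
    then have "finite F'" using F(1) by simp
    moreover have "insert d \<Delta> \<subseteq> F'"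
    proof -
      have "d \<in> F'" unfolding F'_def by (rule image_eqI[of _ _ "(0, 1)"]) (use F(4) in auto)
      moreover have "x \<in> F'" if "x \<in> \<Delta>" for x
        unfolding F'_def by (rule image_eqI[of _ _ "(x, 0)"]) (use F(2) that in auto)
      ultimately show ?thesis by blast
    qed
    moreover have mult: "of_int n * d \<in> transl" for n
      by (induction n rule: int_induct[where k = 0])
        (use insert.prems in \<open>auto simp: algebra_simps intro: transl_add transl_diff\<close>)
    have "F' \<subseteq> transl" using F(3) mult by (auto simp: F'_def intro!: transl_add)
    moreover have "0 \<in> F'"
      unfolding F'_def by (rule image_eqI[of _ _ "(0, 0)"]) (use F(4) in auto)
    moreover have "\<forall>x\<in>F'. \<forall>y\<in>F'. x - y \<in> F'"
    proof (intro ballI)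
      fix x y assume "x \<in> F'" "y \<in> F'"
      then obtain x0 m y0 n where x: "x0 \<in> F" "x = x0 + of_int m * d" and y: "y0 \<in> F" "y = y0 + of_int n * d"
        by (auto simp: F'_def)
      show "x - y \<in> F'" unfolding F'_def
        by (rule image_eqI[of _ _ "(x0 - y0, m - n)"]) (use F(5) x y in \<open>auto simp: algebra_simps\<close>)
    qed
    ultimately show ?case by (intro exI[of _ F']) simp
  qed
  then show ?thesis using that by blast
qed

end

section \<open>Germs in coordinates\<close>

lemma conc_eq_iff:
  assumes "length p = length p'"
  shows "p \<frown> w = p' \<frown> w' \<longleftrightarrow> p = p' \<and> w = w'"
proof
  assume eq: "p \<frown> w = p' \<frown> w'"
  have "p = p'"
  proof (rule nth_equalityI[OF assms])
    show "p ! i = p' ! i" if "i < length p" for i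
      using fun_cong[OF eq, of i] that assms by (simp add: conc_def)
  qed
  moreover have "w n = w' n" for n
    using fun_cong[OF eq, of "n + length p"] assms by (simp add: conc_def)
  ultimately show "p = p' \<and> w = w'" by auto
qed simp

lemma map_conc_suffix: "map w [0..<n] \<frown> Omega_Words_Fun.suffix n w = w"
  by (simp add: Omega_Words_Fun.suffix_def conc_def fun_eq_iff)

lemma conc_split:
  assumes "p \<frown> w = q \<frown> w'" "length p \<le> length q"
  obtains v where "q = p @ v" "w = v \<frown> w'"
proof
  have "p \<frown> w = take (length p) q \<frown> (drop (length p) q \<frown> w')" using assms by simp
  then have eq: "p = take (length p) q" "w = drop (length p) q \<frown> w'"
    using assms conc_eq_iff[of p "take (length p) q" w "drop (length p) q \<frown> w'"] by simp_all
  show "q = p @ drop (length p) q" using eq(1) append_take_drop_id[of "length p" q] by simp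
  show "w = drop (length p) q \<frown> w'" by (rule eq(2))
qed

context self_similar_action
begin

lemma length_act_word [simp]: "length (act_word g v) = length v"
  by (induction v arbitrary: g) simp_all

lemma act_seq_Cons: "act_seq g ([x] \<frown> w) = [act g x] \<frown> act_seq (sec g x) w"
proof
  fix n
  show "act_seq g ([x] \<frown> w) n = ([act g x] \<frown> act_seq (sec g x) w) n"
  proof (cases n)
    case 0
    then show ?thesis by (simp add: act_seq_def conc_def)
  next
    case (Suc k)
    have "map ([x] \<frown> w) [0..<Suc k] = x # map w [0..<k]"
      by (simp add: map_upt_Suc conc_def del: upt_Suc)
    then show ?thesis using Suc by (simp add: act_seq_def conc_def)
  qed
qed

lemma act_seq_conc: "act_seq g (v \<frown> w) = act_word g v \<frown> act_seq (sec_word g v) w"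
proof (induction v arbitrary: g)
  case (Cons x v)
  have "act_seq g ((x # v) \<frown> w) = act_seq g ([x] \<frown> (v \<frown> w))" by simp
  also have "\<dots> = [act g x] \<frown> act_word (sec g x) v \<frown> act_seq (sec_word (sec g x) v) w"
    by (simp only: act_seq_Cons Cons)
  also have "\<dots> = act_word g (x # v) \<frown> act_seq (sec_word g (x # v)) w" by simp
  finally show ?case .
qed simp

lemma triple_act_conc: "triple_act (Some (p, g, q)) (q \<frown> w) = p \<frown> act_seq g w"
  by simp

end

context skipper_steinberg
begin

sublocale self_similar_action lamplighter UNIV "ss_letter r a b" "ss_section r a b"
  by (rule self_similar_action_ss[OF r ab])

lemma topspace_sequences [simp]: "topspace sequences = UNIV"
  by (simp add: sequences_def)

lemma carrier_lamplighter [simp]: "x \<in> carrier lamplighter"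
  by (simp add: lamplighter_def)

lemma triples_UNIV [simp]: "triples = UNIV"
proof -
  have "x \<in> triples" for x :: "('r list \<times> ((int \<Rightarrow>\<^sub>0 'r) \<times> int) \<times> 'r list) option"
    by (cases x) (auto simp: triples_def)
  then show ?thesis by blast
qed

lemma cylinder_iff: "y \<in> cylinder q \<longleftrightarrow> (\<exists>w. y = q \<frown> w)"
  by (auto simp: cylinder_def)

lemma act_seq_fps: "act_seq g w = fps_nth (ss_act r a b g (Abs_fps w))"
proof -
  have "fps_nth (Abs_fps w) = w" by (simp add: fun_eq_iff)
  then show ?thesis using act_seq_ss[OF r ab, of g "Abs_fps w"] by simp
qed

lemma act_seq_one [simp]: "act_seq \<one>\<^bsub>lamplighter\<^esub> w = w"
  by (simp add: act_seq_fps ss_act_one[OF r ab] fun_eq_iff)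

lemma act_seq_mult: "act_seq (g \<otimes>\<^bsub>lamplighter\<^esub> h) w = act_seq g (act_seq h w)"
proof -
  have "Abs_fps (fps_nth p) = p" for p :: "'r fps" by (simp add: fps_eq_iff)
  then show ?thesis by (simp add: act_seq_fps ss_act_mult[OF r ab])
qed

lemma snd_sec_word [simp]: "snd (sec_word g v) = snd g"
  by (induction v arbitrary: g) (simp_all add: section_degree)

lemma snd_mult_lamplighter [simp]: "snd (g \<otimes>\<^bsub>lamplighter\<^esub> h) = snd g + snd h"
  for g h :: "(int \<Rightarrow>\<^sub>0 'r) \<times> int"
  by (simp add: lamplighter_def split_def)

lemma snd_one_lamplighter [simp]: "snd \<one>\<^bsub>lamplighter :: ((int \<Rightarrow>\<^sub>0 'r) \<times> int) monoid\<^esub> = 0"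
  by (simp add: lamplighter_def)

text \<open>With equal exponents of \<open>t\<close> the linear parts agree, so one common value
  forces equal translations, and translations determine their lamps. This rigidity replaces the
  idempotent in the definition of germs.\<close>

lemma act_seq_inj: "act_seq g w = act_seq h w \<Longrightarrow> snd g = snd h \<Longrightarrow> g = h"
proof -
  assume "act_seq g w = act_seq h w" "snd g = snd h"
  then obtain s s' m where "g = (s, m)" "h = (s', m)"
    and "ss_act r a b (s, m) (Abs_fps w) = ss_act r a b (s', m) (Abs_fps w)"
    by (cases g; cases h) (auto simp: act_seq_fps fps_nth_inject)
  then show "g = h" using lamp_inj by (auto simp: ss_act_affine)
qed

text \<open>A cocycle with values in Z^2: the change in prefix length and the exponent of
  \<open>t\<close>. The affine form of the triple has linear part
  \<open>scale (deg \<alpha>)\<close>.\<close>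

fun deg :: "('r list \<times> ((int \<Rightarrow>\<^sub>0 'r) \<times> int) \<times> 'r list) option \<Rightarrow> int \<times> int" where
  "deg (Some (p, g, q)) = (int (length p) - int (length q), snd g)"
| "deg None = 0"

text \<open>The comparison of prefix lengths selects the branch of \<open>triple_mult\<close>; that
  one prefix extends the other follows since both begin the same sequence.\<close>

lemma triple_mult_act:
  assumes "w \<in> triple_dom \<beta>" "triple_act \<beta> w \<in> triple_dom \<alpha>"
  shows "w \<in> triple_dom (triple_mult \<alpha> \<beta>)" (is ?dom)
    and "triple_act (triple_mult \<alpha> \<beta>) w = triple_act \<alpha> (triple_act \<beta> w)" (is ?act)
    and "deg (triple_mult \<alpha> \<beta>) = deg \<alpha> + deg \<beta>" (is ?deg)
proof -
  obtain p g q where \<alpha>: "\<alpha> = Some (p, g, q)" using assms(2) by (cases \<alpha>) auto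
  obtain p' h q' where \<beta>: "\<beta> = Some (p', h, q')" using assms(1) by (cases \<beta>) auto
  obtain w0 where w: "w = q' \<frown> w0" using assms(1) by (auto simp: \<beta> cylinder_iff)
  have bw: "triple_act \<beta> w = p' \<frown> act_seq h w0" unfolding \<beta> w by (rule triple_act_conc)
  obtain w1 where w1: "p' \<frown> act_seq h w0 = q \<frown> w1"
    using assms(2) by (auto simp: \<alpha> bw cylinder_iff)
  have "?dom \<and> ?act \<and> ?deg"
  proof (cases "length q \<le> length p'")
    case True
    obtain v where v: "p' = q @ v" "w1 = v \<frown> act_seq h w0"
      using conc_split[OF w1[symmetric] True] by blast
    have m: "triple_mult \<alpha> \<beta> = Some (p @ act_word g v, sec_word g v \<otimes>\<^bsub>lamplighter\<^esub> h, q')"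
      by (simp add: \<alpha> \<beta> v(1) Let_def)
    have "triple_act (triple_mult \<alpha> \<beta>) w = (p @ act_word g v) \<frown> act_seq (sec_word g v) (act_seq h w0)"
      unfolding m w triple_act_conc act_seq_mult ..
    also have "\<dots> = triple_act \<alpha> (triple_act \<beta> w)"
      unfolding bw w1 \<alpha> triple_act_conc v(2) act_seq_conc by simp
    finally show ?thesis unfolding m \<alpha> \<beta> by (auto simp: w cylinder_iff v(1))
  next
    case False
    then have "length p' \<le> length q" by simp
    then obtain v where v: "q = p' @ v" "act_seq h w0 = v \<frown> w1"
      using conc_split[OF w1] by blast
    \<comment> \<open>This rules out the branch of \<open>triple_mult\<close> that is tested
      first.\<close>
    have vne: "v \<noteq> []" using False v(1) by auto
    define v' where "v' = act_word (inv\<^bsub>lamplighter\<^esub> h) v"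
    define w2 where "w2 = act_seq (sec_word (inv\<^bsub>lamplighter\<^esub> h) v) w1"
    \<comment> \<open>The prefix of \<open>w0\<close> that \<open>h\<close> carries to
      \<open>v\<close> is recovered by applying the inverse of \<open>h\<close>.\<close>
    have "w0 = act_seq (inv\<^bsub>lamplighter\<^esub> h) (act_seq h w0)"
      by (simp flip: act_seq_mult)
    then have w0: "w0 = v' \<frown> w2" by (simp only: v(2) act_seq_conc v'_def w2_def)
    have "act_word h v' \<frown> act_seq (sec_word h v') w2 = v \<frown> w1"
      using v(2) unfolding w0 act_seq_conc .
    then have hv: "act_word h v' = v" "act_seq (sec_word h v') w2 = w1"
      by (simp_all add: conc_eq_iff v'_def)
    have m: "triple_mult \<alpha> \<beta> = Some (p, g \<otimes>\<^bsub>lamplighter\<^esub> sec_word h v', q' @ v')"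
      using vne by (simp add: \<alpha> \<beta> v(1) v'_def Let_def)
    have w': "w = (q' @ v') \<frown> w2" by (simp add: w w0)
    have "triple_act (triple_mult \<alpha> \<beta>) w = p \<frown> act_seq g w1"
      unfolding m w' triple_act_conc act_seq_mult hv(2) ..
    also have "\<dots> = triple_act \<alpha> (triple_act \<beta> w)"
      unfolding bw w1 \<alpha> triple_act_conc ..
    finally have ?act .
    moreover have ?dom unfolding m w' by (auto simp: cylinder_iff)
    moreover have ?deg unfolding m by (simp add: \<alpha> \<beta> v(1) v'_def)
    ultimately show ?thesis by blast
  qed
  then show ?dom ?act ?deg by auto
qed

text \<open>Restricting both triples to a sufficiently long prefix of \<open>w\<close> gives triples
  with the same source; equal degree and equal value at \<open>w\<close> then leave no freedom, by
  \<open>act_seq_inj\<close>.\<close>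

lemma germ_rel_iff:
  "((\<alpha>, w), (\<beta>, w')) \<in> germ_rel \<longleftrightarrow> w \<in> triple_dom \<alpha> \<and> w' \<in> triple_dom \<beta> \<and> w = w' \<and>
     triple_act \<alpha> w = triple_act \<beta> w \<and> deg \<alpha> = deg \<beta>" (is "?l \<longleftrightarrow> ?r")
proof
  assume ?l
  then obtain u where w: "w \<in> triple_dom \<alpha>" "w' \<in> triple_dom \<beta>" "w = w'" and u: "w \<in> cylinder u"
    and eq: "triple_mult \<alpha> (Some (u, \<one>\<^bsub>lamplighter\<^esub>, u)) = triple_mult \<beta> (Some (u, \<one>\<^bsub>lamplighter\<^esub>, u))"
    unfolding germ_rel_def by blast
  let ?e = "Some (u, \<one>\<^bsub>lamplighter\<^esub>, u)"
  obtain w0 where w0: "w = u \<frown> w0" using u by (auto simp: cylinder_iff)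
  have e: "w \<in> triple_dom ?e" "triple_act ?e w = w" "deg ?e = 0"
    using u unfolding w0 triple_act_conc by (simp_all add: zero_prod_def)
  show ?r
    using triple_mult_act[of w ?e \<alpha>] triple_mult_act[of w ?e \<beta>] e w eq by simp
next
  assume r: ?r
  obtain p g q where \<alpha>: "\<alpha> = Some (p, g, q)" using r by (cases \<alpha>) auto
  obtain p' h q' where \<beta>: "\<beta> = Some (p', h, q')" using r by (cases \<beta>) auto
  \<comment> \<open>A prefix of \<open>w\<close> that extends the source prefixes of both
    triples.\<close>
  define u where "u = map w [0..<max (length q) (length q')]"
  define w0 where "w0 = Omega_Words_Fun.suffix (max (length q) (length q')) w"
  have w: "w = u \<frown> w0" by (simp add: u_def w0_def map_conc_suffix)
  obtain w1 where "w = q \<frown> w1" using r by (auto simp: \<alpha> cylinder_iff)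
  then have "q \<frown> w1 = u \<frown> w0" using w by simp
  then obtain v where v: "u = q @ v" "w1 = v \<frown> w0" by (rule conc_split) (auto simp: u_def)
  obtain w1' where "w = q' \<frown> w1'" using r by (auto simp: \<beta> cylinder_iff)
  then have "q' \<frown> w1' = u \<frown> w0" using w by simp
  then obtain v' where v': "u = q' @ v'" "w1' = v' \<frown> w0" by (rule conc_split) (auto simp: u_def)
  \<comment> \<open>Equal degrees make the two output prefixes equally long, so equality of the
    values splits into prefix and remainder.\<close>
  have len: "length (p @ act_word g v) = length (p' @ act_word h v')"
    using r arg_cong[OF v(1), of length] arg_cong[OF v'(1), of length] by (simp add: \<alpha> \<beta>)
  have 1: "triple_act \<alpha> w = (p @ act_word g v) \<frown> act_seq (sec_word g v) w0"
    unfolding \<alpha> \<open>w = q \<frown> w1\<close> triple_act_conc unfolding v(2) act_seq_conc by simp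
  have 2: "triple_act \<beta> w = (p' @ act_word h v') \<frown> act_seq (sec_word h v') w0"
    unfolding \<beta> \<open>w = q' \<frown> w1'\<close> triple_act_conc unfolding v'(2) act_seq_conc by simp
  have "triple_act \<alpha> w = triple_act \<beta> w" using r by blast
  then have eq: "p @ act_word g v = p' @ act_word h v'"
    "act_seq (sec_word g v) w0 = act_seq (sec_word h v') w0"
    unfolding 1 2 conc_eq_iff[OF len] by blast+
  have "sec_word g v = sec_word h v'"
    using r by (intro act_seq_inj[OF eq(2)]) (simp add: \<alpha> \<beta>)
  moreover have "triple_mult \<alpha> (Some (u, \<one>\<^bsub>lamplighter\<^esub>, u)) = Some (p @ act_word g v, sec_word g v, u)"
    by (simp add: \<alpha> v(1) Let_def)
  moreover have "triple_mult \<beta> (Some (u, \<one>\<^bsub>lamplighter\<^esub>, u)) = Some (p' @ act_word h v', sec_word h v', u)"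
    by (simp add: \<beta> v'(1) Let_def)
  ultimately have "triple_mult \<alpha> (Some (u, \<one>\<^bsub>lamplighter\<^esub>, u)) = triple_mult \<beta> (Some (u, \<one>\<^bsub>lamplighter\<^esub>, u))"
    using eq(1) by simp
  moreover have "w \<in> cylinder u" using w by (auto simp: cylinder_iff)
  ultimately show ?l using r unfolding germ_rel_def by auto
qed

lemma germ_eq_iff:
  assumes "w \<in> triple_dom \<alpha>" "w' \<in> triple_dom \<beta>"
  shows "germ \<alpha> w = germ \<beta> w' \<longleftrightarrow> w = w' \<and> triple_act \<alpha> w = triple_act \<beta> w' \<and> deg \<alpha> = deg \<beta>"
proof
  assume "germ \<alpha> w = germ \<beta> w'"
  moreover have "(\<alpha>, w) \<in> germ \<alpha> w" using assms(1) by (simp add: germ_def germ_rel_iff)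
  ultimately have "((\<beta>, w'), (\<alpha>, w)) \<in> germ_rel" by (simp add: germ_def)
  then show "w = w' \<and> triple_act \<alpha> w = triple_act \<beta> w' \<and> deg \<alpha> = deg \<beta>"
    by (auto simp: germ_rel_iff)
next
  assume "w = w' \<and> triple_act \<alpha> w = triple_act \<beta> w' \<and> deg \<alpha> = deg \<beta>"
  then have "((\<alpha>, w), x) \<in> germ_rel \<longleftrightarrow> ((\<beta>, w'), x) \<in> germ_rel" for x
    using assms by (cases x) (auto simp: germ_rel_iff)
  then show "germ \<alpha> w = germ \<beta> w'" by (auto simp: germ_def)
qed

abbreviation "idt \<equiv> Some ([], \<one>\<^bsub>lamplighter\<^esub>, [])"

lemma idt_simps: "w \<in> triple_dom idt" "triple_act idt w = w" "deg idt = 0"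
  by (simp_all add: cylinder_iff zero_prod_def)

lemma unit_germ_eq_iff: "unit_germ w = unit_germ w' \<longleftrightarrow> w = w'"
  using germ_eq_iff[of w idt w' idt] idt_simps by (auto simp: unit_germ_def)

lemma src_germ:
  assumes "w \<in> triple_dom \<alpha>" shows "src action_groupoid (germ \<alpha> w) = unit_germ w"
  unfolding action_groupoid_def topological_groupoid.simps
proof (rule the_equality)
  show "\<exists>\<beta>\<in>triples. \<exists>w'\<in>triple_dom \<beta>. germ \<alpha> w = germ \<beta> w' \<and> unit_germ w = unit_germ w'"
    using assms by auto
qed (use assms germ_eq_iff in auto)

lemma tgt_germ:
  assumes "w \<in> triple_dom \<alpha>" shows "tgt action_groupoid (germ \<alpha> w) = unit_germ (triple_act \<alpha> w)"
  unfolding action_groupoid_def topological_groupoid.simps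
proof (rule the_equality)
  show "\<exists>\<beta>\<in>triples. \<exists>w'\<in>triple_dom \<beta>. germ \<alpha> w = germ \<beta> w' \<and>
      unit_germ (triple_act \<alpha> w) = unit_germ (triple_act \<beta> w')"
    using assms by auto
next
  fix u assume "\<exists>\<beta>\<in>triples. \<exists>w'\<in>triple_dom \<beta>. germ \<alpha> w = germ \<beta> w' \<and> u = unit_germ (triple_act \<beta> w')"
  then obtain \<beta> w' where "w' \<in> triple_dom \<beta>" "germ \<alpha> w = germ \<beta> w'" "u = unit_germ (triple_act \<beta> w')"
    by blast
  then show "u = unit_germ (triple_act \<alpha> w)" using germ_eq_iff[OF assms] by metis
qed

text \<open>The choice of representatives is immaterial because ends and degree of a product depend
  only on those of the factors.\<close>

lemma comp_germ:
  assumes "w \<in> triple_dom \<beta>" "triple_act \<beta> w \<in> triple_dom \<alpha>"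
  shows "comp action_groupoid (germ \<alpha> (triple_act \<beta> w)) (germ \<beta> w) = germ (triple_mult \<alpha> \<beta>) w"
  unfolding action_groupoid_def topological_groupoid.simps
proof (rule the_equality)
  show "\<exists>\<alpha>'\<in>triples. \<exists>\<beta>'\<in>triples. \<exists>w'\<in>triple_dom \<beta>'. triple_act \<beta>' w' \<in> triple_dom \<alpha>' \<and>
      germ \<alpha> (triple_act \<beta> w) = germ \<alpha>' (triple_act \<beta>' w') \<and> germ \<beta> w = germ \<beta>' w' \<and>
      germ (triple_mult \<alpha> \<beta>) w = germ (triple_mult \<alpha>' \<beta>') w'"
    using assms unfolding triples_UNIV by blast
next
  fix \<epsilon> assume "\<exists>\<alpha>'\<in>triples. \<exists>\<beta>'\<in>triples. \<exists>w'\<in>triple_dom \<beta>'. triple_act \<beta>' w' \<in> triple_dom \<alpha>' \<and>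
      germ \<alpha> (triple_act \<beta> w) = germ \<alpha>' (triple_act \<beta>' w') \<and> germ \<beta> w = germ \<beta>' w' \<and>
      \<epsilon> = germ (triple_mult \<alpha>' \<beta>') w'"
  then obtain \<alpha>' \<beta>' w' where *: "w' \<in> triple_dom \<beta>'" "triple_act \<beta>' w' \<in> triple_dom \<alpha>'"
    "germ \<alpha> (triple_act \<beta> w) = germ \<alpha>' (triple_act \<beta>' w')" "germ \<beta> w = germ \<beta>' w'"
    "\<epsilon> = germ (triple_mult \<alpha>' \<beta>') w'" by blast
  have 1: "w = w'" "triple_act \<beta> w = triple_act \<beta>' w'" "deg \<beta> = deg \<beta>'"
    using germ_eq_iff[OF assms(1) *(1)] *(4) by auto
  have 2: "triple_act \<alpha> (triple_act \<beta> w) = triple_act \<alpha>' (triple_act \<beta>' w')" "deg \<alpha> = deg \<alpha>'"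
    using germ_eq_iff[OF assms(2) *(2)] *(3) by auto
  have "germ (triple_mult \<alpha> \<beta>) w = germ (triple_mult \<alpha>' \<beta>') w'"
    using germ_eq_iff[OF triple_mult_act(1)[OF assms] triple_mult_act(1)[OF *(1,2)]]
      triple_mult_act(2,3)[OF assms] triple_mult_act(2,3)[OF *(1,2)] 1 2 by simp
  then show "\<epsilon> = germ (triple_mult \<alpha> \<beta>) w" using *(5) by simp
qed

section \<open>Triples as affine maps of Laurent series\<close>

abbreviation word_fls :: "'r word \<Rightarrow> 'r fls" where
  "word_fls w \<equiv> fps_to_fls (Abs_fps w)"

definition list_fls :: "'r list \<Rightarrow> 'r fls" where
  "list_fls q = fps_to_fls (Abs_fps (\<lambda>n. if n < length q then q ! n else 0))"

lemma word_fls_inject: "word_fls w = word_fls w' \<longleftrightarrow> w = w'"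
  by (simp add: Abs_fps_inject)

lemma list_fls_above: "int (length q) \<le> i \<Longrightarrow> list_fls q $$ i = 0"
  by (auto simp: list_fls_def)

lemma word_fls_conc: "word_fls (q \<frown> w) = list_fls q + fls_shift (- int (length q)) (word_fls w)"
  by (rule fls_eqI) (auto simp: list_fls_def conc_def nat_diff_distrib)

lemma word_fls_act_seq:
  "word_fls (act_seq (s, m) w) = fps_to_fls (unit_power ser m) * word_fls w + fps_to_fls (lamp s)"
proof -
  have "Abs_fps (act_seq (s, m) w) = unit_power ser m * Abs_fps w + lamp s"
    by (simp add: act_seq_fps ss_act_affine fps_eq_iff)
  then show ?thesis by (simp add: fls_times_fps_to_fls)
qed

text \<open>The constant term that results when the remainder of w after the prefix q is eliminated:
  with w = q + x^|q| w0, the image is p + x^|p| (f^m w0 + \<open>lamp s\<close>).\<close>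

fun translation :: "('r list \<times> ((int \<Rightarrow>\<^sub>0 'r) \<times> int) \<times> 'r list) option \<Rightarrow> 'r fls" where
  "translation (Some (p, g, q)) = list_fls p -
     scale (int (length p) - int (length q), snd g) * list_fls q + tail (int (length p)) (fst g)"
| "translation None = 0"

lemma translation_transl: "translation \<alpha> \<in> transl"
proof (cases \<alpha>)
  case (Some t)
  obtain p g q where t: "t = (p, g, q)" by (cases t)
  have "list_fls p \<in> transl" for p
    using list_fls_above by (rule transl_polynomial)
  then show ?thesis unfolding Some t translation.simps
    by (intro transl_add transl_diff transl_scale transl_tail)
qed simp

text \<open>The partial homeomorphisms are affine, which makes them determined by their germs.\<close>

lemma word_fls_triple_act:
  assumes "w \<in> triple_dom \<alpha>"
  shows "word_fls (triple_act \<alpha> w) = scale (deg \<alpha>) * word_fls w + translation \<alpha>"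
proof -
  obtain p s m q where \<alpha>: "\<alpha> = Some (p, (s, m), q)" using assms by (cases \<alpha>) auto
  obtain w0 where w: "w = q \<frown> w0" using assms by (auto simp: \<alpha> cylinder_iff)
  have 1: "word_fls (triple_act \<alpha> w) = list_fls p +
      fls_shift (- int (length p)) (fps_to_fls (unit_power ser m) * word_fls w0 + fps_to_fls (lamp s))"
    unfolding \<alpha> w triple_act_conc word_fls_conc word_fls_act_seq ..
  have "scale (deg \<alpha>) * word_fls w = scale (deg \<alpha>) * list_fls q +
      fls_shift (- int (length p)) (fps_to_fls (unit_power ser m) * word_fls w0)"
    unfolding w word_fls_conc distrib_left
    by (simp add: scale_times \<alpha> fls_shifted_times_simps)
  then show ?thesis unfolding 1 by (simp add: \<alpha>)
qed

text \<open>The converse of the affine description: every affine relation between two sequences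
  whose constant term is an admissible translation comes from a triple.\<close>

lemma triple_exists:
  assumes "word_fls y' - scale v * word_fls y \<in> transl"
  shows "\<exists>\<alpha>. y \<in> triple_dom \<alpha> \<and> triple_act \<alpha> y = y' \<and> deg \<alpha> = v"
proof -
  obtain k m where v: "v = (k, m)" by (cases v)
  obtain N where N: "\<And>N'. N \<le> N' \<Longrightarrow>
      \<exists>s. \<forall>i\<ge>N'. (word_fls y' - scale v * word_fls y - tail N' s) $$ i = 0"
    using assms transl_witness by blast
  \<comment> \<open>The output prefix must reach the cut of the translation, and \<open>n\<close> =
    \<open>n'\<close> - k must not be negative.\<close>
  define n' where "n' = nat (max N (max 0 k))"
  define n where "n = nat (int n' - k)"
  have n: "int n = int n' - k" and "N \<le> int n'" by (auto simp: n_def n'_def)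
  then obtain s where s: "\<And>i. i \<ge> int n' \<Longrightarrow> (word_fls y' - scale v * word_fls y - tail (int n') s) $$ i = 0"
    using N by blast
  define p where "p = map y' [0..<n']"
  define q where "q = map y [0..<n]"
  define w where "w = Omega_Words_Fun.suffix n y"
  define w' where "w' = Omega_Words_Fun.suffix n' y'"
  have y: "y = q \<frown> w" and y': "y' = p \<frown> w'"
    by (simp_all add: p_def q_def w_def w'_def map_conc_suffix)
  have len: "length p = n'" "length q = n" by (simp_all add: p_def q_def)
  let ?F = "fps_to_fls (unit_power ser m)"
  \<comment> \<open>Reading \<open>q\<close> already turns the power of \<open>t\<close> into a
    section with lamps \<open>t\<close>; the lamps \<open>s\<close> of the tail are added to these
    below.\<close>
  obtain t where t: "sec_word (0, m) q = (t, m)"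
    by (metis prod.collapse snd_conv snd_sec_word)
  have "word_fls (act_seq (0, m) y) = list_fls (act_word (0, m) q) +
      fls_shift (- int n) (?F * word_fls w + fps_to_fls (lamp t))"
    unfolding y act_seq_conc word_fls_conc t word_fls_act_seq by (simp add: len)
  then have "?F * word_fls y = list_fls (act_word (0, m) q) +
      fls_shift (- int n) (?F * word_fls w + fps_to_fls (lamp t))"
    unfolding word_fls_act_seq by simp
  then have sy: "scale v * word_fls y = fls_shift (- k) (list_fls (act_word (0, m) q)) +
      fls_shift (- int n') (?F * word_fls w + fps_to_fls (lamp t))"
    unfolding scale_times v by (simp add: n)
  define \<alpha> where "\<alpha> = Some (p, (t + s, m), q)"
  have act: "word_fls (triple_act \<alpha> y) = list_fls p +
      fls_shift (- int n') (?F * word_fls w + fps_to_fls (lamp t + lamp s))"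
    unfolding \<alpha>_def y triple_act_conc word_fls_conc word_fls_act_seq len lamp_add ..
  have wy': "word_fls y' = list_fls p + fls_shift (- int n') (word_fls w')"
    unfolding y' word_fls_conc len ..
  \<comment> \<open>Below degree \<open>n'\<close> the letters are dictated by \<open>p\<close>;
    from there on the identity is the choice of \<open>s\<close>.\<close>
  have "word_fls (triple_act \<alpha> y) $$ i = word_fls y' $$ i" for i
  proof (cases "i < int n'")
    case True
    have "?F * word_fls w \<in> small 0" by (intro small_mult_fps fps_to_fls_small)
    then show ?thesis using True unfolding act wy' by (simp add: small_def)
  next
    case False
    then have "list_fls p $$ i = 0" "list_fls (act_word (0, m) q) $$ (i - k) = 0"
      using n by (auto intro!: list_fls_above simp: len)
    then show ?thesis using s[of i] False unfolding act sy by (simp add: algebra_simps)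
  qed
  then have "word_fls (triple_act \<alpha> y) = word_fls y'" by (rule fls_eqI)
  then have "triple_act \<alpha> y = y'" by (simp only: word_fls_inject)
  moreover have "y \<in> triple_dom \<alpha>" using y by (auto simp: \<alpha>_def cylinder_iff)
  moreover have "deg \<alpha> = v" by (simp add: \<alpha>_def v len n)
  ultimately show ?thesis by blast
qed

end

section \<open>Complexes of levelled simplices\<close>

definition del :: "nat \<Rightarrow> 'a list \<Rightarrow> 'a list" where
  "del i s = take i s @ drop (Suc i) s"

lemma length_del: "i < length s \<Longrightarrow> length (del i s) = length s - 1"
  by (simp add: del_def)

lemma set_del: "set (del i s) \<subseteq> set s"
  using set_take_subset[of i s] set_drop_subset[of "Suc i" s] by (auto simp: del_def)

lemma map_del: "map g (del i s) = del i (map g s)"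
  by (simp add: del_def take_map drop_map)

lemma nth_del: "i < length s \<Longrightarrow> j < length s - 1 \<Longrightarrow> del i s ! j = (if j < i then s ! j else s ! Suc j)"
  by (auto simp: del_def nth_append)

lemma del_del:
  assumes "i < j" "j < length s"
  shows "del i (del j s) = del (j - 1) (del i s)"
proof (rule nth_equalityI)
  show "length (del i (del j s)) = length (del (j - 1) (del i s))"
    using assms by (simp add: length_del)
  fix k assume "k < length (del i (del j s))"
  then show "del i (del j s) ! k = del (j - 1) (del i s) ! k"
    using assms by (auto simp: length_del nth_del)
qed

text \<open>A vertex \<open>((k, m), w)\<close> stands for the sequence whose power series is \<open>w\<close> divided by
  \<open>x\<^sup>k f\<^sup>m\<close>.\<close>

type_synonym 'r simplex = "((int \<times> int) \<times> 'r fls) list"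

text \<open>A common displacement leaves all differences of vertices, hence all arrows' translation
  parts, unchanged.\<close>

definition translate :: "'r::comm_ring_1 fls \<Rightarrow> 'r simplex \<Rightarrow> 'r simplex" where
  "translate \<epsilon> s = map (\<lambda>(v, w). (v, w + \<epsilon>)) s"

definition nbhd :: "'r::comm_ring_1 simplex \<Rightarrow> int \<Rightarrow> 'r simplex set" where
  "nbhd s M = (\<lambda>\<epsilon>. translate \<epsilon> s) ` small M"

text \<open>If all x-levels are at most M, displacements in \<open>small M\<close> keep every vertex
  in the domain prescribed by its level.\<close>

definition fine :: "'r simplex \<Rightarrow> int \<Rightarrow> bool" where
  "fine s M \<longleftrightarrow> (\<forall>p\<in>set s. fst (fst p) \<le> M)"

lemma length_translate [simp]: "length (translate \<epsilon> s) = length s"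
  by (simp add: translate_def)

lemma translate_Nil_iff [simp]: "translate \<epsilon> s = [] \<longleftrightarrow> s = []"
  by (simp add: translate_def)

lemma translate_zero [simp]: "translate 0 s = s"
  by (simp add: translate_def split_def)

lemma translate_translate: "translate \<epsilon> (translate \<delta> s) = translate (\<delta> + \<epsilon>) s"
  by (simp add: translate_def split_def o_def add.assoc)

lemma nth_translate: "i < length s \<Longrightarrow> translate \<epsilon> s ! i = (fst (s ! i), snd (s ! i) + \<epsilon>)"
  by (simp add: translate_def split_def)

lemma hd_translate: "s \<noteq> [] \<Longrightarrow> hd (translate \<epsilon> s) = (fst (hd s), snd (hd s) + \<epsilon>)"
  by (simp add: translate_def split_def hd_map)

lemma translate_inject: "s \<noteq> [] \<Longrightarrow> translate \<epsilon> s = translate \<delta> s \<longleftrightarrow> \<epsilon> = \<delta>"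
  using hd_translate[of s] by (metis add_left_cancel snd_conv)

lemma translate_del: "del i (translate \<epsilon> s) = translate \<epsilon> (del i s)"
  by (simp add: translate_def map_del)

lemma fine_mono: "fine s M \<Longrightarrow> M \<le> M' \<Longrightarrow> fine s M'"
  by (auto simp: fine_def)

lemma fine_translate [simp]: "fine (translate \<epsilon> s) M = fine s M"
  by (auto simp: fine_def translate_def split_def)

lemma fine_exists: "\<exists>M. fine s M"
proof -
  have "finite ((\<lambda>p. fst (fst p)) ` set s)" by simp
  then obtain M where "\<forall>x\<in>(\<lambda>p. fst (fst p)) ` set s. x \<le> M"
    by (meson bdd_above_def bdd_above_finite)
  then show ?thesis by (auto simp: fine_def)
qed

lemma self_in_nbhd: "s \<in> nbhd s M"
  unfolding nbhd_def by (rule image_eqI[of _ _ 0]) simp_all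

lemma nbhd_translate: "\<epsilon> \<in> small M \<Longrightarrow> nbhd (translate \<epsilon> s) M = nbhd s M"
proof -
  have sub: "nbhd (translate \<epsilon> s) M \<subseteq> nbhd s M" if "\<epsilon> \<in> small M" for \<epsilon> s
    using that by (auto simp: nbhd_def translate_translate intro!: imageI small_add)
  assume "\<epsilon> \<in> small M"
  then show ?thesis
    using sub[of \<epsilon> s] sub[of "- \<epsilon>" "translate \<epsilon> s"] small_uminus[of \<epsilon> M]
    by (auto simp: translate_translate)
qed

text \<open>The ultrametric property: every point of a ball is a centre.\<close>

lemma nbhd_eq_or_disjoint: "nbhd s M = nbhd t M \<or> nbhd s M \<inter> nbhd t M = {}"
proof (rule disjCI)
  assume "nbhd s M \<inter> nbhd t M \<noteq> {}"
  then obtain u where "u \<in> nbhd s M" "u \<in> nbhd t M" by blast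
  then obtain \<epsilon> \<delta> where "u = translate \<epsilon> s" "u = translate \<delta> t" "\<epsilon> \<in> small M" "\<delta> \<in> small M"
    unfolding nbhd_def by blast
  then show "nbhd s M = nbhd t M" using nbhd_translate by metis
qed

lemma nbhd_mono: "M \<le> M' \<Longrightarrow> nbhd s M' \<subseteq> nbhd s M"
  unfolding nbhd_def using small_mono by blast

text \<open>The displacements in a ball of radius M are sorted by their coefficient at M. The number
  of summands is the q of the whole computation.\<close>

lemma nbhd_split:
  fixes s :: "'r::{finite,comm_ring_1} simplex"
  assumes "s \<noteq> []"
  shows "indicator (nbhd s M) =
    (\<Sum>c\<in>UNIV. indicator (nbhd (translate (fls_shift (- M) (fls_const c)) s) (M + 1)) :: 'r simplex \<Rightarrow> int)"
proof
  fix t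
  let ?m = "\<lambda>c. fls_shift (- M) (fls_const c)"
  have mem: "t \<in> nbhd (translate (?m c) s) (M + 1) \<longleftrightarrow>
      (\<exists>\<epsilon>. \<epsilon> \<in> small M \<and> t = translate \<epsilon> s \<and> \<epsilon> $$ M = c)" (is "?l \<longleftrightarrow> ?r") for c
  proof
    assume ?l
    then obtain \<delta> where d: "\<delta> \<in> small (M + 1)" "t = translate (?m c + \<delta>) s"
      by (auto simp: nbhd_def translate_translate)
    then show ?r by (intro exI[of _ "?m c + \<delta>"]) (auto simp: small_def)
  next
    assume ?r
    then obtain \<epsilon> where e: "\<epsilon> \<in> small M" "t = translate \<epsilon> s" "\<epsilon> $$ M = c" by blast
    have "\<epsilon> - ?m c \<in> small (M + 1)"
      unfolding small_def
    proof (intro CollectI allI impI)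
      fix i assume "i < M + 1"
      then show "(\<epsilon> - ?m c) $$ i = 0" using e by (cases "i = M") (auto simp: small_def)
    qed
    moreover have "t = translate (\<epsilon> - ?m c) (translate (?m c) s)"
      by (simp add: e translate_translate)
    ultimately show ?l by (auto simp: nbhd_def)
  qed
  show "(indicator (nbhd s M) t :: int) = (\<Sum>c\<in>UNIV. indicator (nbhd (translate (?m c) s) (M + 1))) t"
  proof (cases "t \<in> nbhd s M")
    case True
    then obtain \<epsilon> where e: "\<epsilon> \<in> small M" "t = translate \<epsilon> s" by (auto simp: nbhd_def)
    have "t \<in> nbhd (translate (?m c) s) (M + 1) \<longleftrightarrow> c = \<epsilon> $$ M" for c
      unfolding mem using e translate_inject[OF assms] by metis
    then have "(\<Sum>c\<in>UNIV. indicator (nbhd (translate (?m c) s) (M + 1)) t) = (\<Sum>c\<in>UNIV. if c = \<epsilon> $$ M then 1 else 0 :: int)"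
      by (intro sum.cong) (auto simp: indicator_def)
    then show ?thesis using True by simp
  next
    case False
    then have "t \<notin> nbhd (translate (?m c) s) (M + 1)" for c
      unfolding mem by (auto simp: nbhd_def)
    then show ?thesis using False by simp
  qed
qed

context skipper_steinberg
begin

text \<open>Level and series are multiplied by the same x^k f^m, so the sequence that a vertex
  stands for does not change.\<close>

definition shift :: "int \<times> int \<Rightarrow> 'r simplex \<Rightarrow> 'r simplex" where
  "shift u s = map (\<lambda>(v, w). (v + u, scale u * w)) s"

definition simplex :: "'r simplex \<Rightarrow> bool" where
  "simplex s \<longleftrightarrow> s \<noteq> [] \<and> (\<forall>p\<in>set s. snd p \<in> small (fst (fst p))) \<and>
     (\<forall>p\<in>set s. \<forall>q\<in>set s. snd p - snd q \<in> transl)"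

lemma shift_shift: "shift u (shift v s) = shift (u + v) s"
  by (simp add: shift_def split_def o_def scale_add ac_simps)

lemma shift_zero [simp]: "shift 0 s = s"
  by (simp add: shift_def split_def)

lemma shift_eq_iff: "shift u s = t \<longleftrightarrow> s = shift (- u) t"
proof -
  have "shift (- u) (shift u s) = s" "shift u (shift (- u) t) = t" by (simp_all add: shift_shift)
  then show ?thesis by metis
qed

lemma length_shift [simp]: "length (shift u s) = length s"
  by (simp add: shift_def)

lemma shift_Nil_iff [simp]: "shift u s = [] \<longleftrightarrow> s = []"
  by (simp add: shift_def)

lemma shift_Nil [simp]: "shift u [] = []"
  by (simp add: shift_def)

lemma hd_shift: "s \<noteq> [] \<Longrightarrow> hd (shift u s) = (fst (hd s) + u, scale u * snd (hd s))"
  by (simp add: shift_def split_def hd_map)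

lemma nth_shift: "i < length s \<Longrightarrow> shift u s ! i = (fst (s ! i) + u, scale u * snd (s ! i))"
  by (simp add: shift_def split_def)

lemma shift_translate: "shift u (translate \<epsilon> s) = translate (scale u * \<epsilon>) (shift u s)"
  by (simp add: shift_def translate_def split_def distrib_left)

lemma shift_del: "del i (shift u s) = shift u (del i s)"
  by (simp add: shift_def map_del)

lemma fine_shift: "fine s M \<Longrightarrow> fine (shift u s) (M + fst u)"
  by (auto simp: fine_def shift_def split_def)

lemma simplex_shift: "simplex s \<Longrightarrow> simplex (shift u s)"
  by (auto simp: simplex_def shift_def split_def scale_small transl_scale right_diff_distrib[symmetric])

lemma simplex_del: "simplex s \<Longrightarrow> i < length s \<Longrightarrow> 2 \<le> length s \<Longrightarrow> simplex (del i s)"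
  using set_del[of i s] length_del[of i s] by (fastforce simp: simplex_def)

lemma fine_del: "fine s M \<Longrightarrow> fine (del i s) M"
  using set_del[of i s] by (auto simp: fine_def)

lemma simplex_translate: "simplex s \<Longrightarrow> fine s M \<Longrightarrow> \<epsilon> \<in> small M \<Longrightarrow> simplex (translate \<epsilon> s)"
  by (auto simp: simplex_def translate_def split_def fine_def intro!: small_add intro: small_mono)

text \<open>One notion covers deletion of a vertex, shifts, normalisation and coning: on the ball
  the map intertwines displacements up to a scalar. It is then injective there, and its image is a
  ball with radius changed by the x-exponent of the scalar.\<close>

definition equivariant :: "('r simplex \<Rightarrow> 'r simplex) \<Rightarrow> 'r simplex \<Rightarrow> int \<Rightarrow> int \<times> int \<Rightarrow> bool" where
  "equivariant \<phi> s M u \<longleftrightarrow> s \<noteq> [] \<and> \<phi> s \<noteq> [] \<and>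
     (\<forall>\<epsilon>\<in>small M. \<phi> (translate \<epsilon> s) = translate (scale u * \<epsilon>) (\<phi> s))"

lemma equivariant_inj: "equivariant \<phi> s M u \<Longrightarrow> inj_on \<phi> (nbhd s M)"
  by (auto simp: equivariant_def nbhd_def inj_on_def translate_inject scale_times_eq_iff)

lemma equivariant_image: "equivariant \<phi> s M u \<Longrightarrow> \<phi> ` nbhd s M = nbhd (\<phi> s) (M + fst u)"
proof -
  assume "equivariant \<phi> s M u"
  then have "\<phi> ` nbhd s M = (\<lambda>\<epsilon>. translate \<epsilon> (\<phi> s)) ` (*) (scale u) ` small M"
    by (simp add: nbhd_def image_image equivariant_def)
  then show ?thesis unfolding scale_times_small nbhd_def .
qed

lemma equivariant_push:
  "equivariant \<phi> s M u \<Longrightarrow> push \<phi> (indicator (nbhd s M)) = indicator (nbhd (\<phi> s) (M + fst u))"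
  by (simp add: push_indicator equivariant_inj equivariant_image)

lemma equivariant_comp:
  assumes "equivariant \<psi> s M u" "equivariant \<phi> (\<psi> s) (M + fst u) v"
  shows "equivariant (\<phi> \<circ> \<psi>) s M (v + u)"
  using assms by (auto simp: equivariant_def scale_add mult.assoc scale_small)

lemma equivariant_shift: "s \<noteq> [] \<Longrightarrow> equivariant (shift u) s M u"
  by (simp add: equivariant_def shift_translate)

lemma equivariant_del: "2 \<le> length s \<Longrightarrow> i < length s \<Longrightarrow> equivariant (del i) s M 0"
  using length_del[of i s] by (fastforce simp: equivariant_def translate_del)

text \<open>A level map is the projection to the group of shifts that is divided out.\<close>

definition level_map :: "(int \<times> int \<Rightarrow> int \<times> int) \<Rightarrow> bool" where
  "level_map \<kappa> \<longleftrightarrow> (\<forall>u v. \<kappa> (u + v) = \<kappa> u + \<kappa> v) \<and> (\<forall>v. \<kappa> (\<kappa> v) = \<kappa> v)"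

lemma level_map_simps:
  assumes "level_map \<kappa>"
  shows "\<kappa> (u + v) = \<kappa> u + \<kappa> v" "\<kappa> 0 = 0" "\<kappa> (- v) = - \<kappa> v"
    "\<kappa> (u - v) = \<kappa> u - \<kappa> v" "\<kappa> (\<kappa> v) = \<kappa> v"
proof -
  show 1: "\<kappa> (u + v) = \<kappa> u + \<kappa> v" for u v using assms unfolding level_map_def by blast
  show 2: "\<kappa> 0 = 0" using 1[of 0 0] by simp
  show 3: "\<kappa> (- v) = - \<kappa> v" for v using 1[of v "- v"] 2 by (simp add: eq_neg_iff_add_eq_0 add.commute)
  show "\<kappa> (u - v) = \<kappa> u - \<kappa> v" using 1[of u "- v"] 3[of v] by simp
  show "\<kappa> (\<kappa> v) = \<kappa> v" using assms unfolding level_map_def by blast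
qed

text \<open>Picks, in the orbit under the shifts in the range of \<open>\<kappa>\<close>, the
  simplex whose first vertex has \<open>\<kappa>\<close>-level zero.\<close>

definition normalise :: "(int \<times> int \<Rightarrow> int \<times> int) \<Rightarrow> 'r simplex \<Rightarrow> 'r simplex" where
  "normalise \<kappa> s = shift (- \<kappa> (fst (hd s))) s"

lemma length_normalise [simp]: "length (normalise \<kappa> s) = length s"
  by (simp add: normalise_def)

lemma normalise_shift: "level_map \<kappa> \<Longrightarrow> \<kappa> u = u \<Longrightarrow> normalise \<kappa> (shift u s) = normalise \<kappa> s"
  by (cases "s = []") (simp_all add: normalise_def hd_shift shift_shift level_map_simps)

lemma normalise_shift_kernel: "level_map \<kappa> \<Longrightarrow> \<kappa> u = 0 \<Longrightarrow> normalise \<kappa> (shift u s) = shift u (normalise \<kappa> s)"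
  by (cases "s = []") (simp_all add: normalise_def hd_shift shift_shift level_map_simps add.commute)

lemma normalise_normalise: "level_map \<kappa>' \<Longrightarrow> (\<And>v. \<kappa>' (\<kappa> v) = \<kappa> v) \<Longrightarrow> normalise \<kappa>' (normalise \<kappa> s) = normalise \<kappa>' s"
  by (subst (2) normalise_def) (simp add: normalise_shift level_map_simps)

lemma normalise_del_normalise:
  assumes "level_map \<kappa>'" "\<And>v. \<kappa>' (\<kappa> v) = \<kappa> v"
  shows "normalise \<kappa>' (del i (normalise \<kappa> s)) = normalise \<kappa>' (del i s)"
  unfolding normalise_def[of \<kappa>] shift_del using assms by (intro normalise_shift) (simp_all add: level_map_simps)

lemma normalise_level: "level_map \<kappa> \<Longrightarrow> s \<noteq> [] \<Longrightarrow> \<kappa> (fst (hd (normalise \<kappa> s))) = 0"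
  by (simp add: normalise_def hd_shift level_map_simps)

lemma normalise_eq_self: "\<kappa> (fst (hd s)) = 0 \<Longrightarrow> normalise \<kappa> s = s"
  by (simp add: normalise_def)

lemma equivariant_normalise:
  "s \<noteq> [] \<Longrightarrow> equivariant (normalise \<kappa>) s M (- \<kappa> (fst (hd s)))"
  by (simp add: equivariant_def normalise_def hd_translate shift_translate)

text \<open>The condition on the first vertex selects one simplex per orbit of shifts, which stands
  in for passing to a quotient set.\<close>

definition cells :: "(int \<times> int \<Rightarrow> int \<times> int) \<Rightarrow> nat \<Rightarrow> ('r simplex \<times> int) set" where
  "cells \<kappa> n = {(s, M). simplex s \<and> length s = Suc n \<and> fine s M \<and> \<kappa> (fst (hd s)) = 0}"

abbreviation nbhd_indicator :: "'r simplex \<times> int \<Rightarrow> 'r simplex \<Rightarrow> int" where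
  "nbhd_indicator \<equiv> \<lambda>(s, M). indicator (nbhd s M)"

definition lchains :: "(int \<times> int \<Rightarrow> int \<times> int) \<Rightarrow> nat \<Rightarrow> ('r simplex \<Rightarrow> int) set" where
  "lchains \<kappa> n = zspan (nbhd_indicator ` cells \<kappa> n)"

lemma lchains_finite_fibres:
  assumes "h \<in> zspan (nbhd_indicator ` Q)" "\<And>s M. (s, M) \<in> Q \<Longrightarrow> \<exists>u. equivariant \<phi> s M u"
  shows "finite_fibres \<phi> h"
  by (rule finite_fibres_zspan[OF assms(1)])
    (use assms(2) in \<open>force intro: finite_fibres_indicator equivariant_inj\<close>)

lemma push_zspan:
  assumes h: "h \<in> zspan (nbhd_indicator ` Q)"
    and Q: "\<And>s M. (s, M) \<in> Q \<Longrightarrow> \<exists>u. equivariant \<phi> s M u \<and> (\<phi> s, M + fst u) \<in> Q'"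
  shows "push \<phi> h \<in> zspan (nbhd_indicator ` Q')"
proof -
  have "finite_fibres \<phi> h \<and> push \<phi> h \<in> zspan (nbhd_indicator ` Q')"
  proof (rule zspan_closed[where P = "\<lambda>h. finite_fibres \<phi> h \<and> push \<phi> h \<in> zspan (nbhd_indicator ` Q')", OF h])
    fix g assume "g \<in> nbhd_indicator ` Q"
    then obtain s M where g: "g = indicator (nbhd s M)" "(s, M) \<in> Q" by auto
    obtain u where u: "equivariant \<phi> s M u" "(\<phi> s, M + fst u) \<in> Q'" using Q g(2) by blast
    have "push \<phi> g \<in> zspan (nbhd_indicator ` Q')"
      unfolding g(1) equivariant_push[OF u(1)] using u(2) by (force intro: zspan_base)
    then show "finite_fibres \<phi> g \<and> push \<phi> g \<in> zspan (nbhd_indicator ` Q')"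
      using u(1) by (simp add: g(1) finite_fibres_indicator equivariant_inj)
  qed (auto intro: finite_fibres_add finite_fibres_diff zspan.zero simp: push_add push_diff zspan_add zspan_diff)
  then show ?thesis ..
qed

text \<open>On normalised simplices only the face that drops the first vertex is really moved by
  \<open>normalise\<close>.\<close>

definition bd :: "(int \<times> int \<Rightarrow> int \<times> int) \<Rightarrow> nat \<Rightarrow> ('r simplex \<Rightarrow> int) \<Rightarrow> 'r simplex \<Rightarrow> int" where
  "bd \<kappa> n h = (if n = 0 then 0 else \<Sum>i\<le>n. (- 1) ^ i * push (normalise \<kappa> \<circ> del i) h)"

text \<open>Levels are constant on a ball, so \<open>normalise\<close> is one fixed shift
  there.\<close>

lemma equivariant_face:
  assumes "2 \<le> length s" "i < length s"
  shows "\<exists>u. equivariant (normalise \<kappa> \<circ> del i) s M u \<and> fine (normalise \<kappa> (del i s)) (M + fst u) = fine (del i s) M"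
proof (intro exI conjI)
  have "del i s \<noteq> []" using assms length_del[of i s] by auto
  then show "equivariant (normalise \<kappa> \<circ> del i) s M (- \<kappa> (fst (hd (del i s))) + 0)"
    using assms by (intro equivariant_comp equivariant_del equivariant_normalise)
  show "fine (normalise \<kappa> (del i s)) (M + fst (- \<kappa> (fst (hd (del i s))) + 0)) = fine (del i s) M"
    unfolding normalise_def using fine_shift[of "del i s" M "- \<kappa> (fst (hd (del i s)))"]
      fine_shift[of "shift (- \<kappa> (fst (hd (del i s)))) (del i s)" "M - fst (\<kappa> (fst (hd (del i s))))"
        "\<kappa> (fst (hd (del i s)))"]
    by (auto simp: shift_shift)
qed

text \<open>Source and target carry separate level maps because comparing two complexes requires
  faces of chains of one to be normalised for the other.\<close>

lemma face_in_cells: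
  assumes "level_map \<kappa>" "(s, M) \<in> cells \<kappa>' (Suc n)" "i \<le> Suc n"
  shows "\<exists>u. equivariant (normalise \<kappa> \<circ> del i) s M u \<and> ((normalise \<kappa> \<circ> del i) s, M + fst u) \<in> cells \<kappa> n"
proof -
  have s: "simplex s" "length s = Suc (Suc n)" "fine s M" using assms by (auto simp: cells_def)
  obtain u where u: "equivariant (normalise \<kappa> \<circ> del i) s M u" "fine (normalise \<kappa> (del i s)) (M + fst u)"
    using equivariant_face[of s i \<kappa> M] s assms(3) by (auto simp: fine_del)
  have "simplex (del i s)" "length (del i s) = Suc n"
    using s assms(3) by (auto intro!: simplex_del simp: length_del)
  moreover from this have "del i s \<noteq> []" by auto
  ultimately have "(normalise \<kappa> (del i s), M + fst u) \<in> cells \<kappa> n"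
    using u(2) normalise_level[OF assms(1), of "del i s"]
    by (auto simp: cells_def normalise_def intro: simplex_shift)
  then show ?thesis using u(1) by (intro exI[of _ u]) simp
qed

lemma face_finite_fibres:
  assumes "level_map \<kappa>" "h \<in> lchains \<kappa>' (Suc n)" "i \<le> Suc n"
  shows "finite_fibres (normalise \<kappa> \<circ> del i) h"
  using assms(2) unfolding lchains_def
  by (rule lchains_finite_fibres) (use face_in_cells assms in blast)

lemma face_in_lchains:
  assumes "level_map \<kappa>" "h \<in> lchains \<kappa>' (Suc n)" "i \<le> Suc n"
  shows "push (normalise \<kappa> \<circ> del i) h \<in> lchains \<kappa> n"
  using assms(2) unfolding lchains_def
  by (rule push_zspan) (use face_in_cells assms in blast)

lemma bd_in_lchains:
  assumes "level_map \<kappa>" "h \<in> lchains \<kappa> (Suc n)" shows "bd \<kappa> (Suc n) h \<in> lchains \<kappa> n"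
proof -
  have "(- 1) ^ i * push (normalise \<kappa> \<circ> del i) h \<in> lchains \<kappa> n" if "i \<le> Suc n" for i
    using face_in_lchains[OF assms that] unfolding lchains_def by (rule zspan_sign)
  then show ?thesis unfolding bd_def lchains_def by (auto simp del: sum.atMost_Suc intro!: zspan_sum)
qed

lemma lchains_zero [simp]: "0 \<in> lchains \<kappa> n"
  and lchains_add: "h \<in> lchains \<kappa> n \<Longrightarrow> k \<in> lchains \<kappa> n \<Longrightarrow> h + k \<in> lchains \<kappa> n"
  and lchains_diff: "h \<in> lchains \<kappa> n \<Longrightarrow> k \<in> lchains \<kappa> n \<Longrightarrow> h - k \<in> lchains \<kappa> n"
  and lchains_of_int: "h \<in> lchains \<kappa> n \<Longrightarrow> of_int j * h \<in> lchains \<kappa> n"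
  by (simp_all add: lchains_def zspan.zero zspan_add zspan_diff zspan_of_int)

lemma bd_zero [simp]: "bd \<kappa> n 0 = 0"
  by (simp add: bd_def)

lemma bd_add:
  assumes "level_map \<kappa>" "h \<in> lchains \<kappa>' n" "k \<in> lchains \<kappa>' n"
  shows "bd \<kappa> n (h + k) = bd \<kappa> n h + bd \<kappa> n k"
proof (cases n)
  case (Suc m)
  have "(- 1) ^ i * push (normalise \<kappa> \<circ> del i) (h + k) =
      (- 1) ^ i * push (normalise \<kappa> \<circ> del i) h + (- 1) ^ i * push (normalise \<kappa> \<circ> del i) k" if "i \<le> n" for i
    using face_finite_fibres[OF assms(1), of _ \<kappa>' m i] that assms(2,3) Suc by (simp add: push_add distrib_left)
  then show ?thesis using Suc by (simp add: bd_def flip: sum.distrib del: sum.atMost_Suc)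
qed (simp add: bd_def)

lemma bd_of_int: "bd \<kappa> n (of_int j * h) = of_int j * bd \<kappa> n h"
  unfolding bd_def push_of_int sum_distrib_left by (simp add: sum_distrib_left ac_simps)

lemma bd_diff:
  assumes "level_map \<kappa>" "h \<in> lchains \<kappa>' n" "k \<in> lchains \<kappa>' n"
  shows "bd \<kappa> n (h - k) = bd \<kappa> n h - bd \<kappa> n k"
  using bd_add[OF assms(1), of "h - k" \<kappa>' n k] assms lchains_diff by simp

lemma face_face:
  assumes "level_map \<kappa>" "h \<in> lchains \<kappa>' (Suc (Suc n))" "i \<le> Suc n" "j \<le> Suc (Suc n)"
  shows "finite_fibres ((normalise \<kappa> \<circ> del i) \<circ> (normalise \<kappa> \<circ> del j)) h"
    and "push (normalise \<kappa> \<circ> del i) (push (normalise \<kappa> \<circ> del j) h) = push (normalise \<kappa> \<circ> del i \<circ> del j) h"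
proof -
  show fin: "finite_fibres ((normalise \<kappa> \<circ> del i) \<circ> (normalise \<kappa> \<circ> del j)) h"
    using assms(2) unfolding lchains_def
  proof (rule lchains_finite_fibres)
    fix s M assume "(s, M) \<in> cells \<kappa>' (Suc (Suc n))"
    then obtain u where u: "equivariant (normalise \<kappa> \<circ> del j) s M u"
        "((normalise \<kappa> \<circ> del j) s, M + fst u) \<in> cells \<kappa> (Suc n)"
      using face_in_cells assms by blast
    then obtain v where "equivariant (normalise \<kappa> \<circ> del i) ((normalise \<kappa> \<circ> del j) s) (M + fst u) v"
      using face_in_cells assms by blast
    from equivariant_comp[OF u(1) this]
    show "\<exists>u. equivariant ((normalise \<kappa> \<circ> del i) \<circ> (normalise \<kappa> \<circ> del j)) s M u" ..
  qed
  show "push (normalise \<kappa> \<circ> del i) (push (normalise \<kappa> \<circ> del j) h) = push (normalise \<kappa> \<circ> del i \<circ> del j) h"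
    unfolding push_push[OF fin] using assms(1)
    by (intro push_cong) (simp add: normalise_del_normalise level_map_simps)
qed

lemma lchains_support:
  assumes "h \<in> zspan (nbhd_indicator ` Q)" "h t \<noteq> 0"
  obtains s M where "(s, M) \<in> Q" "t \<in> nbhd s M"
proof -
  have "h t \<noteq> 0 \<longrightarrow> (\<exists>s M. (s, M) \<in> Q \<and> t \<in> nbhd s M)"
    by (rule zspan_closed[where P = "\<lambda>h. h t \<noteq> 0 \<longrightarrow> (\<exists>s M. (s, M) \<in> Q \<and> t \<in> nbhd s M)", OF assms(1)])
      (auto simp: indicator_def split: if_splits, blast+)
  then show ?thesis using assms(2) that by blast
qed

lemma lchains_length: "h \<in> lchains \<kappa> n \<Longrightarrow> h t \<noteq> 0 \<Longrightarrow> length t = Suc n"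
  unfolding lchains_def by (erule lchains_support) (auto simp: cells_def nbhd_def)

lemma lchains_level: "h \<in> lchains \<kappa> n \<Longrightarrow> h t \<noteq> 0 \<Longrightarrow> \<kappa> (fst (hd t)) = 0"
  unfolding lchains_def by (erule lchains_support) (auto simp: cells_def nbhd_def hd_translate simplex_def)

text \<open>The inner normalisation is absorbed by the outer one, which leaves the simplicial
  identity \<open>del_del\<close>.\<close>

lemma bd_bd:
  assumes "level_map \<kappa>" "h \<in> lchains \<kappa> (Suc (Suc n))"
  shows "bd \<kappa> (Suc n) (bd \<kappa> (Suc (Suc n)) h) = 0"
proof -
  have "bd \<kappa> (Suc n) (bd \<kappa> (Suc (Suc n)) h) =
      (\<Sum>i\<le>Suc n. (- 1) ^ i * push (normalise \<kappa> \<circ> del i) (\<Sum>j\<le>Suc (Suc n). (- 1) ^ j * push (normalise \<kappa> \<circ> del j) h))"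
    by (simp add: bd_def del: sum.atMost_Suc)
  also have "\<dots> = (\<Sum>i\<le>Suc n. \<Sum>j\<le>Suc (Suc n). (- 1) ^ (i + j) * push (normalise \<kappa> \<circ> del i \<circ> del j) h)"
  proof (intro sum.cong refl)
    fix i assume "i \<in> {..Suc n}"
    then have i: "i \<le> Suc n" by simp
    have "push (normalise \<kappa> \<circ> del i) (\<Sum>j\<le>Suc (Suc n). (- 1) ^ j * push (normalise \<kappa> \<circ> del j) h) =
        (\<Sum>j\<le>Suc (Suc n). (- 1) ^ j * push (normalise \<kappa> \<circ> del i) (push (normalise \<kappa> \<circ> del j) h))"
      using face_finite_fibres[OF assms(1) face_in_lchains[OF assms] i]
      by (subst push_sum) (auto simp: push_sign intro: finite_fibres_sign)
    also have "\<dots> = (\<Sum>j\<le>Suc (Suc n). (- 1) ^ j * push (normalise \<kappa> \<circ> del i \<circ> del j) h)"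
      using face_face(2)[OF assms i] by (intro sum.cong refl) simp
    finally show "(- 1) ^ i * push (normalise \<kappa> \<circ> del i) (\<Sum>j\<le>Suc (Suc n). (- 1) ^ j * push (normalise \<kappa> \<circ> del j) h) =
        (\<Sum>j\<le>Suc (Suc n). (- 1) ^ (i + j) * push (normalise \<kappa> \<circ> del i \<circ> del j) h)"
      by (simp only: sum_distrib_left power_add mult.assoc)
  qed
  also have "\<dots> = 0"
  proof (rule alternating_double_sum)
    fix i j :: nat assume "i < j" "j \<le> Suc (Suc n)"
    then show "push (normalise \<kappa> \<circ> del i \<circ> del j) h = push (normalise \<kappa> \<circ> del (j - 1) \<circ> del i) h"
      using lchains_length[OF assms(2)] by (intro push_cong) (simp add: del_del)
  qed
  finally show ?thesis .
qed

end

text \<open>Repeated splitting brings all balls of a chain to one radius.\<close>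

lemma nbhd_refine:
  fixes s :: "'r::{finite,comm_ring_1} simplex"
  assumes "s \<noteq> []" "M0 \<le> M"
  shows "(indicator (nbhd s M0) :: 'r simplex \<Rightarrow> int) \<in>
    zspan ((\<lambda>\<epsilon>. indicator (nbhd (translate \<epsilon> s) M)) ` small M0)"
  using assms(2)
proof (induction M rule: int_ge_induct)
  case base
  show ?case by (rule zspan_base, rule image_eqI[of _ _ 0]) simp_all
next
  case (step M)
  let ?A = "\<lambda>M. (\<lambda>\<epsilon>. indicator (nbhd (translate \<epsilon> s) M) :: 'r simplex \<Rightarrow> int) ` small M0"
  have "?A M \<subseteq> zspan (?A (M + 1))"
  proof
    fix g assume "g \<in> ?A M"
    then obtain \<epsilon> where e: "\<epsilon> \<in> small M0" and g: "g = indicator (nbhd (translate \<epsilon> s) M)" by blast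
    have "translate \<epsilon> s \<noteq> []" using assms(1) by simp
    note split = nbhd_split[OF this, of M]
    show "g \<in> zspan (?A (M + 1))"
      unfolding g split translate_translate
    proof (rule zspan_sum, rule zspan_base, rule imageI)
      fix c :: 'r
      have "fls_shift (- M) (fls_const c) \<in> small M0" using step.hyps by (auto simp: small_def)
      then show "\<epsilon> + fls_shift (- M) (fls_const c) \<in> small M0" using e by (intro small_add)
    qed
  qed
  then show ?case using zspan_subset step.IH by blast
qed

context skipper_steinberg
begin

section \<open>Shifts and normalisation as chain maps\<close>

lemma inj_shift: "inj (shift u)"
  by (metis injI shift_eq_iff)

lemma push_shift: "push (shift u) h t = h (shift (- u) t)"
  by (subst push_eq_sum[where Y = "{shift (- u) t}"]) (auto simp: shift_eq_iff)

lemma finite_fibres_shift [simp]: "finite_fibres (shift u) h"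
  unfolding finite_fibres_def
proof
  fix t
  show "finite {x. shift u x = t \<and> h x \<noteq> 0}"
    by (rule finite_subset[of _ "{shift (- u) t}"]) (auto simp: shift_eq_iff)
qed

lemma push_shift_shift: "push (shift u) (push (shift v) h) = push (shift (u + v)) h"
  by (simp add: fun_eq_iff push_shift shift_shift add.commute)

lemma push_shift_zero [simp]: "push (shift 0) h = h"
  by (simp add: fun_eq_iff push_shift)

lemma lchains_mono:
  assumes "\<And>v. \<kappa>' v = 0 \<Longrightarrow> \<kappa> v = 0" shows "lchains \<kappa>' n \<subseteq> lchains \<kappa> n"
  unfolding lchains_def
  by (rule zspan_subset) (use assms in \<open>fastforce simp: cells_def intro: zspan_base\<close>)

lemma normalise_finite_fibres: "h \<in> lchains \<kappa> n \<Longrightarrow> finite_fibres (normalise \<kappa>') h"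
  unfolding lchains_def
  by (erule lchains_finite_fibres, rule exI, rule equivariant_normalise) (auto simp: cells_def)

lemma normalise_in_lchains:
  assumes "level_map \<kappa>'" "h \<in> lchains \<kappa> n" shows "push (normalise \<kappa>') h \<in> lchains \<kappa>' n"
  using assms(2) unfolding lchains_def
proof (rule push_zspan)
  fix s M assume "(s, M) \<in> cells \<kappa> n"
  then have s: "simplex s" "s \<noteq> []" "length s = Suc n" "fine s M" by (auto simp: cells_def)
  let ?u = "- \<kappa>' (fst (hd s))"
  have "(normalise \<kappa>' s, M + fst ?u) \<in> cells \<kappa>' n"
    using s normalise_level[OF assms(1) s(2)] simplex_shift[OF s(1), of ?u] fine_shift[OF s(4), of ?u]
    by (simp add: cells_def normalise_def)
  then show "\<exists>u. equivariant (normalise \<kappa>') s M u \<and> (normalise \<kappa>' s, M + fst u) \<in> cells \<kappa>' n"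
    using equivariant_normalise[OF s(2)] by blast
qed

lemma push_normalise_eq_self: "h \<in> lchains \<kappa> n \<Longrightarrow> push (normalise \<kappa>) h = h"
  by (intro push_eq_self normalise_eq_self lchains_level)

lemma shift_in_lchains:
  assumes "level_map \<kappa>" "\<kappa> u = 0" "h \<in> lchains \<kappa> n" shows "push (shift u) h \<in> lchains \<kappa> n"
  using assms(3) unfolding lchains_def
proof (rule push_zspan)
  fix s M assume "(s, M) \<in> cells \<kappa> n"
  then have s: "simplex s" "s \<noteq> []" "length s = Suc n" "fine s M" "\<kappa> (fst (hd s)) = 0"
    by (auto simp: cells_def)
  have "(shift u s, M + fst u) \<in> cells \<kappa> n"
    using s assms(1,2) simplex_shift[OF s(1), of u] fine_shift[OF s(4), of u]
    by (simp add: cells_def hd_shift level_map_simps)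
  then show "\<exists>v. equivariant (shift u) s M v \<and> (shift u s, M + fst v) \<in> cells \<kappa> n"
    using equivariant_shift[OF s(2)] by blast
qed

text \<open>The projection is a chain map, since normalising before a face has no effect on the
  normalised face.\<close>

lemma push_normalise_bd:
  assumes "level_map \<kappa>" "level_map \<kappa>'" "\<And>v. \<kappa>' (\<kappa> v) = \<kappa> v" "h \<in> lchains \<kappa> n"
  shows "push (normalise \<kappa>') (bd \<kappa> n h) = bd \<kappa>' n (push (normalise \<kappa>') h)"
proof (cases n)
  case (Suc m)
  have *: "push (normalise \<kappa>') ((- 1) ^ i * push (normalise \<kappa> \<circ> del i) h) =
      (- 1) ^ i * push (normalise \<kappa>' \<circ> del i) (push (normalise \<kappa>') h)" if i: "i \<le> Suc m" for i
  proof -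
    have fin: "finite_fibres (normalise \<kappa>' \<circ> del i) h"
      using face_finite_fibres[OF assms(2) _ i] assms(4) Suc by blast
    have eq1: "normalise \<kappa>' \<circ> (normalise \<kappa> \<circ> del i) = normalise \<kappa>' \<circ> del i"
      using assms by (simp add: fun_eq_iff normalise_normalise)
    have eq2: "(normalise \<kappa>' \<circ> del i) \<circ> normalise \<kappa>' = normalise \<kappa>' \<circ> del i"
      using assms(2) by (simp add: fun_eq_iff normalise_del_normalise level_map_simps)
    show ?thesis
      unfolding push_sign using push_push[of "normalise \<kappa>'" "normalise \<kappa> \<circ> del i" h]
        push_push[of "normalise \<kappa>' \<circ> del i" "normalise \<kappa>'" h] fin by (simp only: eq1 eq2)
  qed
  have "finite_fibres (normalise \<kappa>') ((- 1) ^ i * push (normalise \<kappa> \<circ> del i) h)" if "i \<le> Suc m" for i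
    using face_in_lchains[OF assms(1) _ that] assms(4) Suc
    by (intro finite_fibres_sign normalise_finite_fibres[of _ \<kappa> m]) simp
  then have "push (normalise \<kappa>') (\<Sum>i\<le>Suc m. (- 1) ^ i * push (normalise \<kappa> \<circ> del i) h) =
      (\<Sum>i\<le>Suc m. push (normalise \<kappa>') ((- 1) ^ i * push (normalise \<kappa> \<circ> del i) h))"
    by (intro push_sum) simp
  also have "\<dots> = (\<Sum>i\<le>Suc m. (- 1) ^ i * push (normalise \<kappa>' \<circ> del i) (push (normalise \<kappa>') h))"
    using * by (intro sum.cong) simp_all
  finally show ?thesis using Suc by (simp add: bd_def del: sum.atMost_Suc)
qed (simp add: bd_def)

lemma push_shift_bd:
  assumes "level_map \<kappa>" "\<kappa> u = 0" "h \<in> lchains \<kappa> n"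
  shows "push (shift u) (bd \<kappa> n h) = bd \<kappa> n (push (shift u) h)"
proof (cases n)
  case (Suc m)
  have *: "push (shift u) ((- 1) ^ i * push (normalise \<kappa> \<circ> del i) h) =
      (- 1) ^ i * push (normalise \<kappa> \<circ> del i) (push (shift u) h)" if i: "i \<le> Suc m" for i
  proof -
    have "finite_fibres (normalise \<kappa> \<circ> del i) h"
      using face_finite_fibres[OF assms(1) _ i] assms(3) Suc by blast
    note fin = finite_fibres_inj_on[OF this inj_shift[of u] UNIV_I]
    have eq: "(normalise \<kappa> \<circ> del i) \<circ> shift u = shift u \<circ> (normalise \<kappa> \<circ> del i)"
      using assms by (simp add: fun_eq_iff shift_del normalise_shift_kernel)
    show ?thesis
      unfolding push_sign using push_push[of "shift u" "normalise \<kappa> \<circ> del i" h]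
        push_push[of "normalise \<kappa> \<circ> del i" "shift u" h] fin by (simp only: eq)
  qed
  show ?thesis using Suc * by (simp add: bd_def push_sum del: sum.atMost_Suc)
qed (simp add: bd_def)

lemma push_normalise_shift:
  assumes "level_map \<kappa>" "\<kappa> u = u" "h \<in> lchains \<kappa>' n"
  shows "push (normalise \<kappa>) (push (shift u) h) = push (normalise \<kappa>) h"
proof -
  have "normalise \<kappa> \<circ> shift u = normalise \<kappa>"
    using assms by (simp add: fun_eq_iff normalise_shift)
  then show ?thesis
    using push_push[of "normalise \<kappa>" "shift u" h] normalise_finite_fibres[OF assms(3)] by simp
qed

section \<open>Dividing out an infinite cyclic group of shifts\<close>

text \<open>Passing from \<open>\<kappa>\<close> to \<open>\<kappa>'\<close> divides out the shifts
  by multiples of \<open>e\<close> in addition: \<open>\<kappa>\<close> does not see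
  \<open>e\<close>, and on the kernel of \<open>\<kappa>\<close> the values of
  \<open>\<kappa>'\<close> are multiples of \<open>e\<close>.\<close>

definition cyclic_step ::
    "(int \<times> int \<Rightarrow> int \<times> int) \<Rightarrow> (int \<times> int \<Rightarrow> int \<times> int) \<Rightarrow> int \<times> int \<Rightarrow> bool" where
  "cyclic_step \<kappa> \<kappa>' e \<longleftrightarrow> level_map \<kappa> \<and> level_map \<kappa>' \<and> \<kappa> e = 0 \<and> \<kappa>' e = e \<and> e \<noteq> 0 \<and>
     (\<forall>v. \<kappa>' (\<kappa> v) = \<kappa> v) \<and> (\<forall>v. \<kappa>' v = 0 \<longrightarrow> \<kappa> v = 0) \<and>
     (\<forall>v. \<kappa> v = 0 \<longrightarrow> (\<exists>j. \<kappa>' v = (j * fst e, j * snd e)))"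

lemma cyclic_stepD:
  assumes "cyclic_step \<kappa> \<kappa>' e"
  shows "level_map \<kappa>" "level_map \<kappa>'" "\<kappa> e = 0" "\<kappa>' e = e" "e \<noteq> 0" "\<kappa>' (\<kappa> v) = \<kappa> v"
    "\<kappa>' v = 0 \<Longrightarrow> \<kappa> v = 0" "\<kappa> v = 0 \<Longrightarrow> \<exists>j. \<kappa>' v = (j * fst e, j * snd e)"
proof -
  note c1 = assms[unfolded cyclic_step_def]
  note c2 = c1[THEN conjunct2] note c3 = c2[THEN conjunct2] note c4 = c3[THEN conjunct2]
  note c5 = c4[THEN conjunct2] note c6 = c5[THEN conjunct2] note c7 = c6[THEN conjunct2]
  note c8 = c7[THEN conjunct2]
  show "level_map \<kappa>" "level_map \<kappa>'" "\<kappa> e = 0" "\<kappa>' e = e" "e \<noteq> 0"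
    by (rule c1[THEN conjunct1] c2[THEN conjunct1] c3[THEN conjunct1] c4[THEN conjunct1] c5[THEN conjunct1])+
  show "\<kappa>' (\<kappa> v) = \<kappa> v" by (rule c6[THEN conjunct1, THEN spec])
  show "\<kappa> v = 0" if "\<kappa>' v = 0" using that by (rule c7[THEN conjunct1, THEN spec, THEN mp])
  show "\<exists>j. \<kappa>' v = (j * fst e, j * snd e)" if "\<kappa> v = 0" using that by (rule c8[THEN spec, THEN mp])
qed

lemma level_map_multiple:
  assumes "level_map \<kappa>" "\<kappa> e = 0" shows "\<kappa> (j * fst e, j * snd e) = 0"
proof (induction j rule: int_induct[where k = 0])
  case base
  show ?case using level_map_simps(2)[OF assms(1)] by (simp add: zero_prod_def)
next
  case (step1 i)
  have "((i + 1) * fst e, (i + 1) * snd e) = (i * fst e, i * snd e) + e"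
    by (simp add: prod_eq_iff algebra_simps)
  then show ?case using step1 assms by (simp only: level_map_simps add_0_right)
next
  case (step2 i)
  have "((i - 1) * fst e, (i - 1) * snd e) = (i * fst e, i * snd e) - e"
    by (simp add: prod_eq_iff algebra_simps)
  then show ?case using step2 assms by (simp only: level_map_simps diff_0_right)
qed

text \<open>Telescoping: 1 - T^j is divisible by 1 - T for integers j of either sign, where T is the
  push along \<open>shift e\<close>.\<close>

lemma diff_shift_exists:
  assumes "level_map \<kappa>" "\<kappa> e = 0" "h \<in> lchains \<kappa> n"
  shows "\<exists>y\<in>lchains \<kappa> n. h - push (shift (j * fst e, j * snd e)) h = y - push (shift e) y"
proof -
  define S where "S j = push (shift (j * fst e, j * snd e)) h" for j
  have S: "S j \<in> lchains \<kappa> n" for j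
    unfolding S_def using assms level_map_multiple by (intro shift_in_lchains) auto
  have S_step: "S (j + 1) = push (shift e) (S j)" for j
  proof -
    have "((j + 1) * fst e, (j + 1) * snd e) = e + (j * fst e, j * snd e)"
      by (simp add: prod_eq_iff algebra_simps)
    then show ?thesis unfolding S_def push_shift_shift by (simp only:)
  qed
  have "\<exists>y\<in>lchains \<kappa> n. h - S j = y - push (shift e) y"
  proof (induction j rule: int_induct[where k = 0])
    case base
    have "S 0 = h" using push_shift_zero[of h] by (simp add: S_def zero_prod_def)
    then show ?case by (intro bexI[of _ 0]) (simp_all add: fun_eq_iff push_shift)
  next
    case (step1 j)
    then obtain y where y: "y \<in> lchains \<kappa> n" "h - S j = y - push (shift e) y" by blast
    have "h - S (j + 1) = (h - S j) + (S j - push (shift e) (S j))" by (simp add: S_step)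
    also have "\<dots> = (y + S j) - push (shift e) (y + S j)" unfolding y(2) by (simp add: push_add)
    finally show ?case using lchains_add[OF y(1) S] by blast
  next
    case (step2 j)
    then obtain y where y: "y \<in> lchains \<kappa> n" "h - S j = y - push (shift e) y" by blast
    have "h - S (j - 1) = (h - S j) - (S (j - 1) - push (shift e) (S (j - 1)))"
      using S_step[of "j - 1"] by simp
    also have "\<dots> = (y - S (j - 1)) - push (shift e) (y - S (j - 1))"
      unfolding y(2) by (simp add: push_diff)
    finally show ?case using lchains_diff[OF y(1) S] by blast
  qed
  then show ?thesis by (simp add: S_def)
qed

text \<open>Exactness in the middle of the short exact sequence: a chain killed by the projection
  lies in the image of 1 - T. On a single ball the projection is a power of T, which reduces the
  claim to \<open>diff_shift_exists\<close>.\<close>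

lemma cyclic_step_kernel:
  assumes "cyclic_step \<kappa> \<kappa>' e" "h \<in> lchains \<kappa> n"
  shows "\<exists>y\<in>lchains \<kappa> n. h - push (normalise \<kappa>') h = y - push (shift e) y"
proof -
  let ?P = "\<lambda>h. finite_fibres (normalise \<kappa>') h \<and>
    (\<exists>y\<in>lchains \<kappa> n. h - push (normalise \<kappa>') h = y - push (shift e) y)"
  have "?P h"
  proof (rule zspan_closed[where P = ?P])
    show "h \<in> zspan (nbhd_indicator ` cells \<kappa> n)" using assms(2) by (simp add: lchains_def)
    fix g assume "g \<in> nbhd_indicator ` cells \<kappa> n"
    then obtain s M where g: "g = indicator (nbhd s M)" and sM: "(s, M) \<in> cells \<kappa> n" by auto
    have s: "s \<noteq> []" "\<kappa> (fst (hd s)) = 0" using sM by (auto simp: cells_def)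
    have g': "g \<in> lchains \<kappa> n" unfolding lchains_def g using sM by (force intro: zspan_base)
    obtain j where "\<kappa>' (fst (hd s)) = (j * fst e, j * snd e)"
      using cyclic_stepD(8)[OF assms(1) s(2)] by blast
    then have j: "- \<kappa>' (fst (hd s)) = ((- j) * fst e, (- j) * snd e)" by simp
    have eq: "push (normalise \<kappa>') g = push (shift (- \<kappa>' (fst (hd s)))) g"
      unfolding g equivariant_push[OF equivariant_normalise[OF s(1)]]
        equivariant_push[OF equivariant_shift[OF s(1)]] by (simp add: normalise_def)
    have "\<exists>y\<in>lchains \<kappa> n. g - push (normalise \<kappa>') g = y - push (shift e) y"
      unfolding eq j by (rule diff_shift_exists[OF cyclic_stepD(1,3)[OF assms(1)] g'])
    then show "?P g" using normalise_finite_fibres[OF g'] by simp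
  next
    fix h k assume hk: "?P h" "?P k"
    note fin = hk[THEN conjunct1]
    obtain y where y: "y \<in> lchains \<kappa> n" "h - push (normalise \<kappa>') h = y - push (shift e) y"
      by (rule bexE[OF hk(1)[THEN conjunct2]])
    obtain z where z: "z \<in> lchains \<kappa> n" "k - push (normalise \<kappa>') k = z - push (shift e) z"
      by (rule bexE[OF hk(2)[THEN conjunct2]])
    have "h + k - push (normalise \<kappa>') (h + k) = (h - push (normalise \<kappa>') h) + (k - push (normalise \<kappa>') k)"
      using fin by (simp add: push_add)
    also have "\<dots> = (y + z) - push (shift e) (y + z)" unfolding y(2) z(2) by (simp add: push_add)
    finally show "?P (h + k)"
      using finite_fibres_add[OF fin] lchains_add[OF y(1) z(1)] by (intro conjI bexI)
    have "h - k - push (normalise \<kappa>') (h - k) = (h - push (normalise \<kappa>') h) - (k - push (normalise \<kappa>') k)"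
      using fin by (simp add: push_diff)
    also have "\<dots> = (y - z) - push (shift e) (y - z)" unfolding y(2) z(2) by (simp add: push_diff)
    finally show "?P (h - k)"
      using finite_fibres_diff[OF fin] lchains_diff[OF y(1) z(1)] by (intro conjI bexI)
  qed (auto intro!: bexI[of _ 0])
  then show ?thesis by blast
qed

lemma lchains_level_bounded:
  assumes "h \<in> lchains \<kappa> n"
  shows "\<exists>K. \<forall>t. h t \<noteq> 0 \<longrightarrow> \<bar>fst (fst (hd t))\<bar> + \<bar>snd (fst (hd t))\<bar> \<le> K"
proof -
  let ?l = "\<lambda>t :: 'r simplex. \<bar>fst (fst (hd t))\<bar> + \<bar>snd (fst (hd t))\<bar>"
  let ?P = "\<lambda>h :: 'r simplex \<Rightarrow> int. \<exists>K. \<forall>t. h t \<noteq> 0 \<longrightarrow> ?l t \<le> K"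
  show "?P h"
  proof (rule zspan_closed[where P = ?P])
    show "h \<in> zspan (nbhd_indicator ` cells \<kappa> n)" using assms(1) by (simp add: lchains_def)
    fix g assume "g \<in> nbhd_indicator ` cells \<kappa> n"
    then obtain s M where g: "g = indicator (nbhd s M)" and sM: "(s, M) \<in> cells \<kappa> n" by auto
    have "s \<noteq> []" using sM by (auto simp: cells_def)
    then have "g t \<noteq> 0 \<longrightarrow> ?l t \<le> ?l s" for t
      by (auto simp: g indicator_def nbhd_def hd_translate)
    then show "?P g" by blast
  next
    fix h k assume "?P h" "?P k"
    then obtain K K' where K: "\<And>t. h t \<noteq> 0 \<Longrightarrow> ?l t \<le> K" "\<And>t. k t \<noteq> 0 \<Longrightarrow> ?l t \<le> K'" by blast
    have "(h + k) t \<noteq> 0 \<longrightarrow> ?l t \<le> max K K'" "(h - k) t \<noteq> 0 \<longrightarrow> ?l t \<le> max K K'" for t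
      using K(1)[of t] K(2)[of t] by (cases "h t = 0"; force)+
    then show "?P (h + k)" "?P (h - k)" by blast+
  qed auto
qed

text \<open>Injectivity of 1 - T: a support invariant under the shift would contain simplices of
  arbitrarily large level.\<close>

lemma shift_fixed_eq_0:
  assumes "y \<in> lchains \<kappa> n" "push (shift e) y = y" "e \<noteq> 0" shows "y = 0"
proof (rule ext, rule ccontr)
  fix t assume "y t \<noteq> 0 t"
  then have t: "y t \<noteq> 0" by simp
  then have "t \<noteq> []" using lchains_length[OF assms(1)] by force
  obtain K where K: "\<And>t. y t \<noteq> 0 \<Longrightarrow> \<bar>fst (fst (hd t))\<bar> + \<bar>snd (fst (hd t))\<bar> \<le> K"
    using lchains_level_bounded[OF assms(1)] by blast
  have eq: "y (shift (- (int k * fst e), - (int k * snd e)) t) = y t" for k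
  proof (induction k)
    case 0
    show ?case using shift_zero[of t] by (simp add: zero_prod_def)
  next
    case (Suc k)
    let ?t = "shift (- (int k * fst e), - (int k * snd e)) t"
    have "shift (- e) ?t = shift (- (int (Suc k) * fst e), - (int (Suc k) * snd e)) t"
      unfolding shift_shift by (intro arg_cong2[where f = shift]) (simp_all add: prod_eq_iff algebra_simps)
    moreover have "y (shift (- e) ?t) = y ?t" using fun_cong[OF assms(2), of ?t] by (simp add: push_shift)
    ultimately show ?case using Suc by simp
  qed
  define v where "v = fst (hd t)"
  have bound: "\<bar>fst v - int k * fst e\<bar> + \<bar>snd v - int k * snd e\<bar> \<le> K" for k
    using K[of "shift (- (int k * fst e), - (int k * snd e)) t"] t eq[of k] \<open>t \<noteq> []\<close>
    by (simp add: hd_shift v_def)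
  \<comment> \<open>Large enough that k shifts push the level \<open>v\<close> beyond the bound
    \<open>K\<close>.\<close>
  define k where "k = nat (K + \<bar>fst v\<bar> + \<bar>snd v\<bar> + 1)"
  have "K \<ge> 0" using bound[of 0] by linarith
  then have k: "int k = K + \<bar>fst v\<bar> + \<bar>snd v\<bar> + 1" by (simp add: k_def)
  have "fst e \<noteq> 0 \<or> snd e \<noteq> 0" using assms(3) by (simp add: prod_eq_iff)
  moreover have "int k \<le> \<bar>int k * x\<bar>" if "x \<noteq> 0" for x
  proof -
    have "int k * 1 \<le> int k * \<bar>x\<bar>" using that by (intro mult_left_mono) auto
    then show ?thesis by (simp add: abs_mult)
  qed
  ultimately have "int k \<le> \<bar>int k * fst e\<bar> \<or> int k \<le> \<bar>int k * snd e\<bar>" by blast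
  moreover have "\<bar>int k * fst e\<bar> \<le> \<bar>fst v - int k * fst e\<bar> + \<bar>fst v\<bar>"
    "\<bar>int k * snd e\<bar> \<le> \<bar>snd v - int k * snd e\<bar> + \<bar>snd v\<bar>"
    by (simp_all add: abs_if)
  ultimately show False using bound[of k] k by (elim disjE) linarith+
qed

definition acyclic_at :: "(int \<times> int \<Rightarrow> int \<times> int) \<Rightarrow> nat \<Rightarrow> bool" where
  "acyclic_at \<kappa> n \<longleftrightarrow>
     (\<forall>c\<in>lchains \<kappa> n. bd \<kappa> n c = 0 \<longrightarrow> c \<in> bd \<kappa> (Suc n) ` lchains \<kappa> (Suc n))"

text \<open>The connecting map. A cycle below has a boundary upstairs that projects to 0, hence
  equals (1 - T) y, and injectivity of 1 - T makes y a cycle.\<close>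

lemma cyclic_step_lift:
  assumes step: "cyclic_step \<kappa> \<kappa>' e" and c: "c \<in> lchains \<kappa>' (Suc n)" "bd \<kappa>' (Suc n) c = 0"
  obtains y where "y \<in> lchains \<kappa> n" "bd \<kappa> (Suc n) c = y - push (shift e) y" "bd \<kappa> n y = 0"
proof -
  note \<kappa> = cyclic_stepD[OF step]
  have cD: "c \<in> lchains \<kappa> (Suc n)" using lchains_mono[of \<kappa>' \<kappa>] \<kappa>(7) c(1) by blast
  have "push (normalise \<kappa>') (bd \<kappa> (Suc n) c) = 0"
    using push_normalise_bd[OF \<kappa>(1,2,6) cD] push_normalise_eq_self[OF c(1)] c(2) by simp
  then obtain y where y: "y \<in> lchains \<kappa> n" "bd \<kappa> (Suc n) c = y - push (shift e) y"
    using cyclic_step_kernel[OF step bd_in_lchains[OF \<kappa>(1) cD]] by auto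
  have "bd \<kappa> n y = 0"
  proof (cases n)
    case (Suc m)
    have "bd \<kappa> n y - push (shift e) (bd \<kappa> n y) = bd \<kappa> n (y - push (shift e) y)"
      unfolding bd_diff[OF \<kappa>(1) y(1) shift_in_lchains[OF \<kappa>(1,3) y(1)]]
        push_shift_bd[OF \<kappa>(1,3) y(1)] ..
    also have "\<dots> = 0" using y(2) bd_bd[OF \<kappa>(1), of c m] cD Suc by simp
    finally have "push (shift e) (bd \<kappa> n y) = bd \<kappa> n y" by simp
    then show ?thesis
      using shift_fixed_eq_0[OF _ _ \<kappa>(5)] bd_in_lchains[OF \<kappa>(1)] y(1) Suc by blast
  qed (simp add: bd_def)
  then show ?thesis using that y by blast
qed

text \<open>If the connecting map yields the boundary of \<open>y\<close>, correcting
  \<open>c\<close> by (1 - T) \<open>y\<close> gives a cycle upstairs. That cycle bounds by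
  acyclicity, and projecting back gives a boundary because the correction projects to 0.\<close>

lemma cyclic_step_boundary:
  assumes step: "cyclic_step \<kappa> \<kappa>' e" and ac: "acyclic_at \<kappa> (Suc n)"
    and c: "c \<in> lchains \<kappa>' (Suc n)" and y: "y \<in> lchains \<kappa> (Suc n)"
    and eq: "bd \<kappa> (Suc n) c = bd \<kappa> (Suc n) y - push (shift e) (bd \<kappa> (Suc n) y)"
  shows "c \<in> bd \<kappa>' (Suc (Suc n)) ` lchains \<kappa>' (Suc (Suc n))"
proof -
  note \<kappa> = cyclic_stepD[OF step]
  have cD: "c \<in> lchains \<kappa> (Suc n)" using lchains_mono[of \<kappa>' \<kappa>] \<kappa>(7) c(1) by blast
  have Ty: "push (shift e) y \<in> lchains \<kappa> (Suc n)" using shift_in_lchains[OF \<kappa>(1,3) y] .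
  let ?z = "y - push (shift e) y"
  have z: "?z \<in> lchains \<kappa> (Suc n)" using lchains_diff[OF y Ty] .
  have "bd \<kappa> (Suc n) (c - ?z) = 0"
    unfolding bd_diff[OF \<kappa>(1) cD z] bd_diff[OF \<kappa>(1) y Ty]
    using eq push_shift_bd[OF \<kappa>(1,3) y] by simp
  then obtain d where d: "d \<in> lchains \<kappa> (Suc (Suc n))" "c - ?z = bd \<kappa> (Suc (Suc n)) d"
    using ac lchains_diff[OF cD z] by (auto simp: acyclic_at_def)
  have "push (normalise \<kappa>') ?z = 0"
    using push_normalise_shift[OF \<kappa>(2,4) y] normalise_finite_fibres[OF y] normalise_finite_fibres[OF Ty]
    by (simp add: push_diff)
  then have "push (normalise \<kappa>') (c - ?z) = c"
    using normalise_finite_fibres[OF cD] normalise_finite_fibres[OF z] push_normalise_eq_self[OF c]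
    by (simp add: push_diff)
  then have "c = bd \<kappa>' (Suc (Suc n)) (push (normalise \<kappa>') d)"
    unfolding d(2) using push_normalise_bd[OF \<kappa>(1,2,6) d(1)] by simp
  then show ?thesis using normalise_in_lchains[OF \<kappa>(2) d(1)] by blast
qed

text \<open>The Wang sequence: homology below vanishes in degree n + 1 if it vanishes there upstairs
  and 1 - T is injective on homology upstairs in degree n.\<close>

lemma cyclic_step_acyclic:
  assumes step: "cyclic_step \<kappa> \<kappa>' e" and ac: "acyclic_at \<kappa> (Suc n)"
    and inj: "\<And>y. y \<in> lchains \<kappa> n \<Longrightarrow> bd \<kappa> n y = 0 \<Longrightarrow>
      y - push (shift e) y \<in> bd \<kappa> (Suc n) ` lchains \<kappa> (Suc n) \<Longrightarrow> y \<in> bd \<kappa> (Suc n) ` lchains \<kappa> (Suc n)"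
  shows "acyclic_at \<kappa>' (Suc n)"
  unfolding acyclic_at_def
proof (intro ballI impI)
  fix c assume c: "c \<in> lchains \<kappa>' (Suc n)" "bd \<kappa>' (Suc n) c = 0"
  obtain y where y: "y \<in> lchains \<kappa> n" "bd \<kappa> (Suc n) c = y - push (shift e) y" "bd \<kappa> n y = 0"
    using cyclic_step_lift[OF step c] .
  have "c \<in> lchains \<kappa> (Suc n)"
    using lchains_mono[of \<kappa>' \<kappa>] c(1) cyclic_stepD(7)[OF step] by blast
  then have "y - push (shift e) y \<in> bd \<kappa> (Suc n) ` lchains \<kappa> (Suc n)"
    unfolding y(2)[symmetric] by blast
  then obtain z where "z \<in> lchains \<kappa> (Suc n)" "y = bd \<kappa> (Suc n) z"
    using inj[OF y(1,3)] by blast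
  then show "c \<in> bd \<kappa>' (Suc (Suc n)) ` lchains \<kappa>' (Suc (Suc n))"
    using cyclic_step_boundary[OF step ac c(1)] y(2) by blast
qed

end

context skipper_steinberg
begin

section \<open>The unquotiented complex is AF\<close>

abbreviation "lv0 \<equiv> \<lambda>v :: int \<times> int. 0 :: int \<times> int"

lemma level_map_lv0: "level_map lv0"
  by (simp add: level_map_def)

lemma normalise_lv0 [simp]: "normalise lv0 = (\<lambda>s. s)"
  by (simp add: normalise_def fun_eq_iff)

lemma bd_lv0: "bd lv0 (Suc n) h = (\<Sum>i\<le>Suc n. (- 1) ^ i * push (del i) h)"
  by (simp add: bd_def o_def del: sum.atMost_Suc)

text \<open>\<open>F\<close> meets \<open>small M\<close> only in 0, so their sum \<open>E\<close>
  is direct. After a representative of each coset of \<open>E\<close> is fixed,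
  \<open>\<tau> w\<close> is the \<open>F\<close>-component of the deviation of \<open>w\<close>
  from it; thus \<open>w - \<tau> w\<close> is the same for all points of one
  \<open>F\<close>-orbit.\<close>

lemma transversal_exists:
  assumes F: "finite F" "0 \<in> F" "\<And>x y. x \<in> F \<Longrightarrow> y \<in> F \<Longrightarrow> x - y \<in> F" "\<And>x. x \<in> F \<Longrightarrow> x \<in> small M \<Longrightarrow> x = 0"
  obtains \<tau> :: "'r fls \<Rightarrow> 'r fls"
  where "\<And>w. \<tau> w \<in> F" "\<And>w x. x \<in> F \<Longrightarrow> \<tau> (w + x) = \<tau> w + x" "\<And>w \<epsilon>. \<epsilon> \<in> small M \<Longrightarrow> \<tau> (w + \<epsilon>) = \<tau> w"
proof -
  define E where "E = {x + \<epsilon> | x \<epsilon>. x \<in> F \<and> \<epsilon> \<in> (small M :: 'r fls set)}"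
  have F_add: "x + y \<in> F" if "x \<in> F" "y \<in> F" for x y
    using F(3)[OF that(1) F(3)[OF F(2) that(2)]] by simp
  have E_diff: "d - e \<in> E" if "d \<in> E" "e \<in> E" for d e
  proof -
    obtain x \<epsilon> y \<delta> where "x \<in> F" "\<epsilon> \<in> small M" "d = x + \<epsilon>" "y \<in> F" "\<delta> \<in> small M" "e = y + \<delta>"
      using \<open>d \<in> E\<close> \<open>e \<in> E\<close> unfolding E_def by blast
    then have "d - e = (x - y) + (\<epsilon> - \<delta>)" "x - y \<in> F" "\<epsilon> - \<delta> \<in> small M"
      using F(3) by (auto simp: small_diff)
    then show ?thesis unfolding E_def by blast
  qed
  have F_E: "x \<in> E" if "x \<in> F" for x
    unfolding E_def by (intro CollectI exI[of _ x] exI[of _ 0]) (simp add: that)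
  have small_E: "\<epsilon> \<in> E" if "\<epsilon> \<in> small M" for \<epsilon>
    unfolding E_def by (intro CollectI exI[of _ 0] exI[of _ \<epsilon>]) (simp add: that F(2))
  note E0 = F_E[OF F(2)]
  have E_uminus: "- e \<in> E" if "e \<in> E" for e using E_diff[OF E0 that] by simp
  have E_add: "d + e \<in> E" if "d \<in> E" "e \<in> E" for d e
    using E_diff[OF that(1) E_uminus[OF that(2)]] by simp
  define rep where "rep w = (SOME w'. w - w' \<in> E)" for w
  have rep: "w - rep w \<in> E" for w
    unfolding rep_def by (rule someI[of _ w]) (simp add: E0)
  have rep_eq: "rep (w + e) = rep w" if "e \<in> E" for w e
  proof -
    have "w + e - w' \<in> E \<longleftrightarrow> w - w' \<in> E" for w'
      using E_add[OF _ that, of "w - w'"] E_diff[OF _ that, of "w + e - w'"] by (auto simp: algebra_simps)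
    then show ?thesis by (simp add: rep_def)
  qed
  define \<tau> where "\<tau> w = (SOME x. x \<in> F \<and> w - rep w - x \<in> small M)" for w
  have "\<exists>x. x \<in> F \<and> w - rep w - x \<in> small M" for w
  proof -
    obtain x \<epsilon> where "x \<in> F" "\<epsilon> \<in> small M" "w - rep w = x + \<epsilon>" using rep[of w] unfolding E_def by blast
    then show ?thesis by (intro exI[of _ x]) simp
  qed
  then have \<tau>: "\<tau> w \<in> F \<and> w - rep w - \<tau> w \<in> small M" for w
    unfolding \<tau>_def by (rule someI_ex)
  have \<tau>_eq: "\<tau> w = x" if "x \<in> F" "w - rep w - x \<in> small M" for w x
  proof -
    have "\<tau> w - x = (w - rep w - x) - (w - rep w - \<tau> w)" by simp
    then have "\<tau> w - x \<in> small M" using small_diff[OF that(2)] \<tau> by metis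
    then show ?thesis using F(4)[OF F(3)] \<tau> that(1) by (metis right_minus_eq)
  qed
  show thesis
  proof
    show "\<tau> w \<in> F" for w using \<tau> by blast
    show "\<tau> (w + x) = \<tau> w + x" if "x \<in> F" for w x
    proof (rule \<tau>_eq)
      show "\<tau> w + x \<in> F" using \<tau> F_add that by blast
      have "w + x - rep w - (\<tau> w + x) = w - rep w - \<tau> w" by simp
      then show "w + x - rep (w + x) - (\<tau> w + x) \<in> small M"
        using \<tau>[of w] rep_eq[OF F_E[OF that], of w] by metis
    qed
    show "\<tau> (w + \<epsilon>) = \<tau> w" if "\<epsilon> \<in> small M" for w \<epsilon>
    proof (rule \<tau>_eq)
      show "\<tau> w \<in> F" using \<tau> by blast
      have "w + \<epsilon> - rep w - \<tau> w = (w - rep w - \<tau> w) + \<epsilon>" by simp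
      then show "w + \<epsilon> - rep (w + \<epsilon>) - \<tau> w \<in> small M"
        using \<tau>[of w] rep_eq[OF small_E[OF that], of w] small_add[OF _ that] by metis
    qed
  qed
qed

lemma finite_small_bounds:
  assumes "finite (F :: 'r fls set)"
  shows "\<exists>K. \<forall>x\<in>F. x \<in> small K" "\<exists>M. \<forall>x\<in>F. x \<noteq> 0 \<longrightarrow> x \<notin> small M"
proof -
  show "\<exists>K. \<forall>x\<in>F. x \<in> small K"
    using assms
  proof induction
    case (insert x F)
    obtain K where "\<forall>x\<in>F. x \<in> small K" using insert.IH by blast
    moreover obtain K' where "x \<in> small K'" using small_exists by blast
    ultimately have "\<forall>y\<in>insert x F. y \<in> small (min K K')"
      using small_mono[of "min K K'" K] small_mono[of "min K K'" K'] by auto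
    then show ?case by blast
  qed simp
  show "\<exists>M. \<forall>x\<in>F. x \<noteq> 0 \<longrightarrow> x \<notin> small M"
    using assms
  proof induction
    case (insert x F)
    obtain M where M: "\<forall>x\<in>F. x \<noteq> 0 \<longrightarrow> x \<notin> small M" using insert.IH by blast
    have "x \<notin> small (fls_subdegree x + 1)" if "x \<noteq> 0"
      using nth_fls_subdegree_nonzero[OF that] by (auto simp: small_def)
    then have "\<forall>y\<in>insert x F. y \<noteq> 0 \<longrightarrow> y \<notin> small (max M (fls_subdegree x + 1))"
      using M small_mono[of M "max M (fls_subdegree x + 1)"]
        small_mono[of "fls_subdegree x + 1" "max M (fls_subdegree x + 1)"] by auto
    then show ?case by blast
  qed simp
qed

text \<open>A cycle only involves translations from a finite group \<open>F\<close>. Translating each point to a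
  representative of its \<open>F\<close>-orbit, chosen locally constantly, gives a cone point for all simplices in the
  support.\<close>

theorem acyclic_lv0: "acyclic_at lv0 (Suc n)"
  unfolding acyclic_at_def
proof (intro ballI impI)
  fix c assume c: "c \<in> lchains lv0 (Suc n)" and cycle: "bd lv0 (Suc n) c = 0"
  obtain A0 where A0: "finite A0" "A0 \<subseteq> nbhd_indicator ` cells lv0 (Suc n)" "c \<in> zspan A0"
    using zspan_finite c unfolding lchains_def by blast
  from finite_subset_image[OF A0(1,2)] obtain Q0 where Q0: "finite Q0" "Q0 \<subseteq> cells lv0 (Suc n)"
    and "A0 = nbhd_indicator ` Q0" by blast
  then have cQ0: "c \<in> zspan (nbhd_indicator ` Q0)" using A0(3) by simp
  define pts where "pts = (\<Union>(s, M)\<in>Q0. set s)"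
  have "finite pts" using Q0(1) by (auto simp: pts_def)
  define \<Delta> where "\<Delta> = (\<Union>(s, M)\<in>Q0. (\<lambda>(p, q). snd p - snd q) ` (set s \<times> set s))"
  have fin\<Delta>: "finite \<Delta>" using Q0(1) by (auto simp: \<Delta>_def)
  have sub\<Delta>: "\<Delta> \<subseteq> transl" using Q0(2) by (force simp: \<Delta>_def cells_def simplex_def)
  obtain F where F: "finite F" "\<Delta> \<subseteq> F" "F \<subseteq> transl" "0 \<in> F" "\<And>x y. x \<in> F \<Longrightarrow> y \<in> F \<Longrightarrow> x - y \<in> F"
    using finite_transl_subgroup[OF fin\<Delta> sub\<Delta>] by metis
  obtain K0 where K0: "\<forall>x\<in>F. x \<in> small K0" using finite_small_bounds(1)[OF F(1)] by blast
  \<comment> \<open>A level low enough for the apex: all vertices and all elements of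
    \<open>F\<close> lie in \<open>small K\<close>.\<close>
  define K where "K = Min (insert K0 ((\<lambda>p. fst (fst p)) ` pts))"
  have K: "x \<in> F \<Longrightarrow> x \<in> small K" "p \<in> pts \<Longrightarrow> K \<le> fst (fst p)" for x p
    using K0 \<open>finite pts\<close> small_mono[of K K0 x] by (auto simp: K_def)
  obtain M0 where M0: "\<forall>x\<in>F. x \<noteq> 0 \<longrightarrow> x \<notin> small M0" using finite_small_bounds(2)[OF F(1)] by blast
  \<comment> \<open>At least \<open>K\<close>, so that cones stay fine; at least \<open>M0\<close>,
    so that \<open>F\<close> meets \<open>small M\<close> only in 0; and at least every radius in
    \<open>Q0\<close>, so that all its balls can be refined to radius \<open>M\<close>.\<close>
  define M where "M = Max (insert K (insert M0 (snd ` Q0)))"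
  have "x \<le> M" if "x \<in> insert K (insert M0 (snd ` Q0))" for x
    unfolding M_def using Q0(1) that by (intro Max_ge) auto
  moreover have "(s, M') \<in> Q0 \<Longrightarrow> M' \<in> snd ` Q0" for s M'
    by (rule image_eqI[of _ _ "(s, M')"]) simp_all
  ultimately have M: "K \<le> M" "M0 \<le> M" "(s, M') \<in> Q0 \<Longrightarrow> M' \<le> M" for s M'
    by blast+
  have "x = 0" if "x \<in> F" "x \<in> small M" for x
    using M0 that small_mono[OF M(2)] by blast
  then obtain \<tau> where \<tau>: "\<And>w. \<tau> w \<in> F"
    "\<And>w x. x \<in> F \<Longrightarrow> \<tau> (w + x) = \<tau> w + x" "\<And>w \<epsilon>. \<epsilon> \<in> small M \<Longrightarrow> \<tau> (w + \<epsilon>) = \<tau> w"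
    using transversal_exists[OF F(1,4,5), of M] by metis
  \<comment> \<open>The refined cells. Their differences lie in \<open>F\<close> itself and not
    merely in \<open>transl\<close>, which lets all vertices of a simplex share one apex.\<close>
  define Q where "Q = {(s, M) | s. simplex s \<and> length s = Suc (Suc n) \<and> fine s M \<and>
    (\<forall>p\<in>set s. K \<le> fst (fst p)) \<and> (\<forall>p\<in>set s. \<forall>q\<in>set s. snd p - snd q \<in> F)}"
  have translate_diff: "snd p - snd q \<in> F" if "p \<in> set (translate \<epsilon> s)" "q \<in> set (translate \<epsilon> s)"
    "\<forall>p\<in>set s. \<forall>q\<in>set s. snd p - snd q \<in> F" for p q \<epsilon> s
    using that by (fastforce simp: translate_def)
  have cQ: "c \<in> zspan (nbhd_indicator ` Q)"
  proof -
    have "nbhd_indicator ` Q0 \<subseteq> zspan (nbhd_indicator ` Q)"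
    proof
      fix g assume "g \<in> nbhd_indicator ` Q0"
      then obtain s M' where g: "g = indicator (nbhd s M')" and sM: "(s, M') \<in> Q0" by auto
      have s: "simplex s" "length s = Suc (Suc n)" "fine s M'" using sM Q0(2) by (auto simp: cells_def)
      have "set s \<subseteq> pts" unfolding pts_def using sM by blast
      then have lvls: "\<forall>p\<in>set s. K \<le> fst (fst p)" using K(2) by blast
      have diffs: "\<forall>p\<in>set s. \<forall>q\<in>set s. snd p - snd q \<in> F"
      proof (intro ballI)
        fix p q assume "p \<in> set s" "q \<in> set s"
        then have "snd p - snd q \<in> (\<lambda>(p, q). snd p - snd q) ` (set s \<times> set s)" by force
        then have "snd p - snd q \<in> \<Delta>" unfolding \<Delta>_def using sM by blast
        then show "snd p - snd q \<in> F" using F(2) by blast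
      qed
      have "(translate \<epsilon> s, M) \<in> Q" if "\<epsilon> \<in> small M'" for \<epsilon>
      proof -
        have "\<forall>p\<in>set (translate \<epsilon> s). K \<le> fst (fst p)" using lvls by (auto simp: translate_def)
        moreover have "\<forall>p\<in>set (translate \<epsilon> s). \<forall>q\<in>set (translate \<epsilon> s). snd p - snd q \<in> F"
          using translate_diff[OF _ _ diffs] by blast
        ultimately show ?thesis
          using s(2) simplex_translate[OF s(1,3) that] fine_mono[OF s(3) M(3)[OF sM]]
          by (simp add: Q_def)
      qed
      then have "(\<lambda>\<epsilon>. indicator (nbhd (translate \<epsilon> s) M)) ` small M' \<subseteq> nbhd_indicator ` Q" by force
      moreover have "s \<noteq> []" using s(2) by auto
      ultimately show "g \<in> zspan (nbhd_indicator ` Q)"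
        unfolding g by (rule subsetD[OF zspan_mono nbhd_refine[OF _ M(3)[OF sM]]])
    qed
    then show ?thesis using cQ0 zspan_subset by blast
  qed
  have supp: "t \<noteq> []" "\<And>p q. p \<in> set t \<Longrightarrow> q \<in> set t \<Longrightarrow> snd p - snd q \<in> F" "length t = Suc (Suc n)"
    if ct: "c t \<noteq> 0" for t
  proof -
    obtain s M where "(s, M) \<in> Q" "t \<in> nbhd s M" using lchains_support[OF cQ ct] .
    then obtain \<epsilon> where t: "t = translate \<epsilon> s" and s: "simplex s" "length s = Suc (Suc n)"
      "\<forall>p\<in>set s. \<forall>q\<in>set s. snd p - snd q \<in> F" by (auto simp: Q_def nbhd_def)
    show "t \<noteq> []" "length t = Suc (Suc n)" using s by (auto simp: t simplex_def)
    show "snd p - snd q \<in> F" if "p \<in> set t" "q \<in> set t" for p q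
      using translate_diff[OF that[unfolded t] s(3)] .
  qed
  \<comment> \<open>The representative of the \<open>F\<close>-orbit of the first vertex. Invariance
    of \<open>\<tau>\<close> under \<open>small M\<close> makes the apex move along with the simplex
    inside a ball.\<close>
  define apex where "apex s = ((K, 0::int), snd (hd s) - \<tau> (snd (hd s)))" for s :: "'r simplex"
  define cone where "cone s = apex s # s" for s
  have apex_eq: "apex s = apex t" if "snd (hd s) - snd (hd t) \<in> F" for s t
    using \<tau>(2)[OF that, of "snd (hd t)"] by (simp add: apex_def)
  have cone_equi: "equivariant cone s M 0" and cone_cells: "(cone s, M) \<in> cells lv0 (Suc (Suc n))"
    if "(s, M) \<in> Q" for s
  proof -
    have s: "simplex s" "length s = Suc (Suc n)" "fine s M" "\<And>p. p \<in> set s \<Longrightarrow> K \<le> fst (fst p)" "s \<noteq> []"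
      using that by (auto simp: Q_def)
    show "equivariant cone s M 0"
      unfolding equivariant_def using s(5)
      by (simp add: cone_def apex_def hd_translate \<tau>(3) translate_def[of _ "_ # _"] flip: translate_def)
    have hd: "hd s \<in> set s" using s(5) by simp
    have "snd (hd s) \<in> small (fst (fst (hd s)))" using s(1) hd unfolding simplex_def by blast
    then have "snd (hd s) \<in> small K" by (rule small_mono[OF s(4)[OF hd]])
    then have "snd (apex s) \<in> small K" using K(1)[OF \<tau>(1)] by (simp add: apex_def small_diff)
    moreover have "snd (apex s) - snd p \<in> transl" if "p \<in> set s" for p
    proof -
      have "snd (hd s) - snd p - \<tau> (snd (hd s)) \<in> transl"
      proof (rule transl_diff)
        show "snd (hd s) - snd p \<in> transl" using s(1) hd that unfolding simplex_def by blast
        show "\<tau> (snd (hd s)) \<in> transl" using F(3) \<tau>(1) by blast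
      qed
      then show ?thesis by (simp add: apex_def algebra_simps)
    qed
    moreover from this have "snd p - snd (apex s) \<in> transl" if "p \<in> set s" for p
      using that transl_uminus[of "snd (apex s) - snd p"] by simp
    ultimately have "simplex (cone s)" using s(1) by (auto simp: simplex_def cone_def apex_def)
    moreover have "fine (cone s) M" using s(3) M(1) by (simp add: fine_def cone_def apex_def)
    ultimately show "(cone s, M) \<in> cells lv0 (Suc (Suc n))" using s(2) by (simp add: cells_def cone_def)
  qed
  have Q_M: "M' = M" if "(s, M') \<in> Q" for s M' using that by (simp add: Q_def)
  have d: "push cone c \<in> lchains lv0 (Suc (Suc n))"
    unfolding lchains_def
  proof (rule push_zspan[OF cQ])
    fix s M' assume sM: "(s, M') \<in> Q"
    then show "\<exists>u. equivariant cone s M' u \<and> (cone s, M' + fst u) \<in> cells lv0 (Suc (Suc n))"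
      using cone_equi cone_cells Q_M[OF sM] by (intro exI[of _ 0]) simp
  qed
  have fin0: "finite_fibres (del 0 \<circ> cone) c"
  proof -
    have "{x. (del 0 \<circ> cone) x = y \<and> c x \<noteq> 0} \<subseteq> {y}" for y by (auto simp: del_def cone_def)
    then show ?thesis unfolding finite_fibres_def by (meson finite.emptyI finite.insertI finite_subset)
  qed
  have face0: "push (del 0) (push cone c) = c"
    unfolding push_push[OF fin0] by (rule push_eq_self) (simp add: del_def cone_def)
  have face_Suc: "push (del (Suc i)) (push cone c) = push cone (push (del i) c)"
    "finite_fibres cone (push (del i) c)" if i: "i \<le> Suc n" for i
  proof -
    \<comment> \<open>Deleting a vertex may change the first one, but not its
      \<open>F\<close>-orbit, so the apex stays.\<close>
    have eq: "(del (Suc i) \<circ> cone) t = (cone \<circ> del i) t" if t: "c t \<noteq> 0" for t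
    proof -
      have "length (del i t) = Suc n" using supp(3)[OF t] i by (simp add: length_del)
      then have "hd (del i t) \<in> set t" using set_del[of i t] by (cases "del i t") auto
      then have "apex (del i t) = apex t" using supp(1,2)[OF t] by (intro apex_eq) auto
      then show ?thesis by (simp add: cone_def del_def apex_def)
    qed
    have fin: "finite_fibres (del (Suc i) \<circ> cone) c"
    proof (rule lchains_finite_fibres[OF cQ])
      fix s M' assume sM: "(s, M') \<in> Q"
      have "2 \<le> length (cone s)" "Suc i < length (cone s)" using sM i by (auto simp: Q_def cone_def)
      then have "equivariant (del (Suc i)) (cone s) (M + fst (0::int \<times> int)) 0" by (intro equivariant_del)
      from equivariant_comp[OF cone_equi this] show "\<exists>u. equivariant (del (Suc i) \<circ> cone) s M' u"
        using sM Q_M[OF sM] by blast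
    qed
    then have fin': "finite_fibres (cone \<circ> del i) c" using finite_fibres_cong eq by blast
    show "finite_fibres cone (push (del i) c)" using finite_fibres_comp(2)[OF fin'] .
    show "push (del (Suc i)) (push cone c) = push cone (push (del i) c)"
      unfolding push_push[OF fin] push_push[OF fin'] by (rule push_cong) (rule eq)
  qed
  \<comment> \<open>The usual cone formula: the boundary of the cone on c is c minus the cone on the
    boundary of c.\<close>
  have "bd lv0 (Suc (Suc n)) (push cone c) =
      (\<Sum>i\<le>Suc (Suc n). (- 1) ^ i * push (del i) (push cone c))"
    by (rule bd_lv0)
  also have "\<dots> = c + (\<Sum>i\<le>Suc n. (- 1) ^ Suc i * push (del (Suc i)) (push cone c))"
    unfolding sum.atMost_Suc_shift[of _ "Suc n"] face0 by simp
  also have "(\<Sum>i\<le>Suc n. (- 1) ^ Suc i * push (del (Suc i)) (push cone c)) =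
      (\<Sum>i\<le>Suc n. push cone (- ((- 1) ^ i * push (del i) c)))"
    using face_Suc(1) by (intro sum.cong refl) (simp add: push_uminus push_sign)
  also have "\<dots> = push cone (\<Sum>i\<le>Suc n. - ((- 1) ^ i * push (del i) c))"
    using face_Suc(2) by (intro push_sum[symmetric]) (simp add: finite_fibres_sign)
  also have "(\<Sum>i\<le>Suc n. - ((- 1) ^ i * push (del i) c)) = 0"
    using cycle unfolding bd_lv0 sum_negf by simp
  finally have "bd lv0 (Suc (Suc n)) (push cone c) = c" by (simp only: push_zero add_0_right)
  then show "c \<in> bd lv0 (Suc (Suc n)) ` lchains lv0 (Suc (Suc n))" using d by (metis image_eqI)
qed

end

lemma dvd_power_minus_1: "(x - 1 :: int) dvd x ^ n - 1"
proof (induction n)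
  case (Suc n)
  have "x ^ Suc n - 1 = x * (x ^ n - 1) + (x - 1)" by (simp add: algebra_simps)
  then show ?case using Suc by (metis dvd_add dvd_mult dvd_refl)
qed simp

lemma fls_truncate: "\<exists>w'. \<forall>i. w' $$ i = (if i < M then w $$ i else 0)" for w :: "'a::zero fls"
proof -
  have "\<forall>i < fls_subdegree w. (if i < M then w $$ i else 0) = 0" by simp
  then have "Abs_fls (\<lambda>i. if i < M then w $$ i else 0) $$ i = (if i < M then w $$ i else 0)" for i
    by (subst nth_Abs_fls_lower_bound) auto
  then show ?thesis by blast
qed

context skipper_steinberg
begin

section \<open>Homology in degree zero\<close>

abbreviation "lv1 \<equiv> \<lambda>v :: int \<times> int. (fst v, 0 :: int)"
abbreviation "lv2 \<equiv> \<lambda>v :: int \<times> int. v"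

lemma level_map_lv1: "level_map lv1" and level_map_lv2: "level_map lv2"
  by (simp_all add: level_map_def)

lemma cyclic_step_01: "cyclic_step lv0 lv1 (1, 0)"
  by (simp add: cyclic_step_def level_map_lv0[unfolded zero_prod_def] level_map_lv1 zero_prod_def)

lemma cyclic_step_12: "cyclic_step lv1 lv2 (0, 1)"
  by (auto simp: cyclic_step_def level_map_lv1 level_map_lv2 zero_prod_def)

lemma card_ge_2: "2 \<le> int CARD('r)"
proof -
  have "card {0, 1 :: 'r} \<le> CARD('r)" by (intro card_mono) auto
  then have "2 \<le> CARD('r)" by simp
  then show ?thesis by linarith
qed

definition bdry :: "(int \<times> int \<Rightarrow> int \<times> int) \<Rightarrow> ('r simplex \<Rightarrow> int) set" where
  "bdry \<kappa> = bd \<kappa> (Suc 0) ` lchains \<kappa> (Suc 0)"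

lemma bdry_zero [simp]: "0 \<in> bdry \<kappa>"
  unfolding bdry_def by (rule image_eqI[of _ _ 0]) simp_all

lemma bdry_of_int: "h \<in> bdry \<kappa> \<Longrightarrow> of_int j * h \<in> bdry \<kappa>"
  unfolding bdry_def by (auto simp: bd_of_int[symmetric] lchains_of_int)

lemma bdry_add: assumes "level_map \<kappa>" "h \<in> bdry \<kappa>" "k \<in> bdry \<kappa>" shows "h + k \<in> bdry \<kappa>"
proof -
  obtain y z where "y \<in> lchains \<kappa> (Suc 0)" "z \<in> lchains \<kappa> (Suc 0)"
    "h = bd \<kappa> (Suc 0) y" "k = bd \<kappa> (Suc 0) z" using assms(2,3) by (auto simp: bdry_def)
  then show ?thesis using bd_add[OF assms(1), of y \<kappa> "Suc 0" z] lchains_add[of y \<kappa> "Suc 0" z]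
    unfolding bdry_def by (intro image_eqI[of _ _ "y + z"]) auto
qed

lemma bdry_diff: "level_map \<kappa> \<Longrightarrow> h \<in> bdry \<kappa> \<Longrightarrow> k \<in> bdry \<kappa> \<Longrightarrow> h - k \<in> bdry \<kappa>"
  using bdry_add[of \<kappa> h "of_int (- 1) * k"] bdry_of_int[of k \<kappa> "- 1"] by simp

lemma bdry_sum:
  "level_map \<kappa> \<Longrightarrow> (\<And>i. i \<in> I \<Longrightarrow> h i \<in> bdry \<kappa>) \<Longrightarrow> sum h I \<in> bdry \<kappa>"
  by (induction I rule: infinite_finite_induct) (auto intro: bdry_add)

lemma bdry_lchains: "level_map \<kappa> \<Longrightarrow> h \<in> bdry \<kappa> \<Longrightarrow> h \<in> lchains \<kappa> 0"
  by (auto simp: bdry_def bd_in_lchains)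

lemma cell_in_lchains: "(s, M) \<in> cells \<kappa> n \<Longrightarrow> indicator (nbhd s M) \<in> lchains \<kappa> n"
  unfolding lchains_def by (force intro: zspan_base)

text \<open>Normalising an end point shifts it and so changes the radius of its ball by the x-level.
  This change of radius is where powers of q enter.\<close>

lemma bd_edge:
  "bd \<kappa> (Suc 0) (indicator (nbhd [x, y] M)) =
     indicator (nbhd (normalise \<kappa> [y]) (M - fst (\<kappa> (fst y)))) -
     indicator (nbhd (normalise \<kappa> [x]) (M - fst (\<kappa> (fst x))))"
proof -
  have *: "push (normalise \<kappa> \<circ> del i) (indicator (nbhd [x, y] M)) =
      indicator (nbhd (normalise \<kappa> (del i [x, y])) (M - fst (\<kappa> (fst (hd (del i [x, y]))))))"
    if "i < 2" for i
  proof -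
    have "equivariant (del i) [x, y] M 0" using that by (intro equivariant_del) auto
    moreover have "del i [x, y] \<noteq> []" using that length_del[of i "[x, y]"] by auto
    ultimately show ?thesis
      using equivariant_push[OF equivariant_comp[OF _ equivariant_normalise], of "del i" "[x, y]" M 0 \<kappa>] by simp
  qed
  show ?thesis using *[of 0] *[of 1] by (simp add: bd_def del_def)
qed

lemma normalise_point:
  "normalise \<kappa> [(v, w)] = [(v - \<kappa> v, scale (- \<kappa> v) * w)]"
  by (simp add: normalise_def shift_def)

text \<open>Truncation below degree M selects exactly one point in each ball
  \<open>nbhd [x] M\<close>, so counting these points counts balls.\<close>

definition representatives :: "int \<Rightarrow> 'r simplex set" where
  "representatives M = {[(v, w)] | v w. \<forall>i\<ge>M. w $$ i = 0}"

abbreviation "counted M h \<equiv> indicator (representatives M) * h"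

text \<open>For large \<open>M\<close> the tally is the invariant measure times the \<open>M\<close>-th power of the size of \<open>R\<close>;
  modulo that size minus one it does not depend on \<open>M\<close>.\<close>

definition tally :: "int \<Rightarrow> ('r simplex \<Rightarrow> int) \<Rightarrow> int" where
  "tally M h = push (\<lambda>_. ()) (counted M h) ()"

definition tallied :: "int \<Rightarrow> ('r simplex \<Rightarrow> int) \<Rightarrow> bool" where
  "tallied M h \<longleftrightarrow> finite_fibres (\<lambda>_. ()) (counted M h)"

lemma tallied_zero: "tallied M 0" and tally_zero: "tally M 0 = 0"
  unfolding tallied_def tally_def mult_zero_right by (simp_all only: finite_fibres_zero push_zero zero_fun_apply)

lemma tally_add: "tallied M h \<Longrightarrow> tallied M k \<Longrightarrow> tally M (h + k) = tally M h + tally M k"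
  and tally_diff: "tallied M h \<Longrightarrow> tallied M k \<Longrightarrow> tally M (h - k) = tally M h - tally M k"
  unfolding tallied_def tally_def distrib_left right_diff_distrib by (simp_all only: push_add push_diff plus_fun_apply minus_apply)

lemma tally_of_int: "tally M (of_int j * h) = j * tally M h"
  unfolding tally_def mult.left_commute[of _ "of_int j"] push_of_int by simp

lemma tallied_add: "tallied M h \<Longrightarrow> tallied M k \<Longrightarrow> tallied M (h + k)"
  and tallied_diff: "tallied M h \<Longrightarrow> tallied M k \<Longrightarrow> tallied M (h - k)"
  unfolding tallied_def distrib_left right_diff_distrib
  by (fact finite_fibres_add, fact finite_fibres_diff)

lemma tally_sum:
  assumes "\<And>i. i \<in> I \<Longrightarrow> tallied M (h i)"
  shows "tallied M (sum h I) \<and> tally M (sum h I) = (\<Sum>i\<in>I. tally M (h i))"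
  using assms
proof (induction I rule: infinite_finite_induct)
  case (infinite I)
  show ?case unfolding sum.infinite[OF infinite(1)] by (intro conjI tallied_zero tally_zero)
next
  case empty
  show ?case unfolding sum.empty by (intro conjI tallied_zero tally_zero)
next
  case (insert i I)
  have IH: "tallied M (sum h I)" "tally M (sum h I) = (\<Sum>i\<in>I. tally M (h i))" and hi: "tallied M (h i)"
    using insert by blast+
  show ?case
    unfolding sum.insert[OF insert.hyps] IH(2)[symmetric]
    by (intro conjI tallied_add[OF hi IH(1)] tally_add[OF hi IH(1)])
qed

lemma tally_nbhd_same: "tallied M (indicator (nbhd [x] M))" "tally M (indicator (nbhd [x] M)) = 1"
proof -
  obtain v w where x: "x = (v, w)" by (cases x)
  obtain w' where w': "\<And>i. w' $$ i = (if i < M then w $$ i else 0)" using fls_truncate by metis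
  have "w' - w \<in> small M" by (simp add: small_def w')
  then have mem: "[(v, w')] \<in> nbhd [x] M"
    unfolding nbhd_def by (intro image_eqI[of _ _ "w' - w"]) (simp_all add: x translate_def)
  have uniq: "s = [(v, w')]" if s: "s \<in> nbhd [x] M" "s \<in> representatives M" for s
  proof -
    obtain \<epsilon> where e: "\<epsilon> \<in> small M" "s = [(v, w + \<epsilon>)]" using s(1) by (auto simp: nbhd_def x translate_def)
    then have "\<forall>i\<ge>M. (w + \<epsilon>) $$ i = 0" using s(2) by (auto simp: representatives_def)
    then have "w + \<epsilon> = w'" using e(1) by (intro fls_eqI) (auto simp: w' small_def)
    then show ?thesis using e(2) by simp
  qed
  have rep: "[(v, w')] \<in> representatives M" by (simp add: representatives_def w')
  have "counted M (indicator (nbhd [x] M) :: _ \<Rightarrow> int) s = (if s = [(v, w')] then 1 else 0)" for s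
  proof (cases "s = [(v, w')]")
    case True
    then show ?thesis using mem rep by simp
  next
    case False
    then have "s \<notin> nbhd [x] M \<or> s \<notin> representatives M" using uniq by blast
    then show ?thesis using False by (elim disjE) simp_all
  qed
  then have val: "counted M (indicator (nbhd [x] M) :: _ \<Rightarrow> int) = (\<lambda>s. if s = [(v, w')] then 1 else 0)"
    by (rule ext)
  show "tallied M (indicator (nbhd [x] M))" unfolding tallied_def finite_fibres_def val by simp
  show "tally M (indicator (nbhd [x] M)) = 1" unfolding tally_def push_def val by simp
qed

text \<open>A ball splits into q balls at each increase of the radius.\<close>

lemma tally_nbhd:
  assumes "M \<le> M'"
  shows "tallied M' (indicator (nbhd [x] M)) \<and> tally M' (indicator (nbhd [x] M)) = int CARD('r) ^ nat (M' - M)"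
proof -
  have "tallied M' (indicator (nbhd [x] (M' - int k))) \<and> tally M' (indicator (nbhd [x] (M' - int k))) = int CARD('r) ^ k" for k
  proof (induction k arbitrary: x)
    case 0
    show ?case using tally_nbhd_same by simp
  next
    case (Suc k)
    have tr: "translate \<epsilon> [x] = [(fst x, snd x + \<epsilon>)]" for \<epsilon> by (simp add: translate_def split_def)
    have *: "M' - int (Suc k) + 1 = M' - int k" by simp
    let ?x = "\<lambda>c. (fst x, snd x + fls_shift (- (M' - int (Suc k))) (fls_const c))"
    have ne: "[x] \<noteq> []" by simp
    have eq: "indicator (nbhd [x] (M' - int (Suc k))) = (\<Sum>c\<in>UNIV. indicator (nbhd [?x c] (M' - int k)) :: _ \<Rightarrow> int)"
      by (subst nbhd_split[OF ne]) (simp only: tr *)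
    have IH: "tallied M' (indicator (nbhd [?x c] (M' - int k)))"
      "tally M' (indicator (nbhd [?x c] (M' - int k))) = int CARD('r) ^ k" for c
      using Suc[of "?x c"] by blast+
    have "tallied M' (\<Sum>c\<in>UNIV. indicator (nbhd [?x c] (M' - int k))) \<and>
        tally M' (\<Sum>c\<in>UNIV. indicator (nbhd [?x c] (M' - int k))) = (\<Sum>c\<in>(UNIV :: 'r set). int CARD('r) ^ k)"
      using tally_sum[of UNIV M' "\<lambda>c. indicator (nbhd [?x c] (M' - int k))"] IH by presburger
    then show ?case unfolding eq by (simp only: sum_constant power_Suc)
  qed
  from this[of "nat (M' - M)"] show ?thesis using assms by simp
qed

text \<open>The boundary of an edge is a difference of two balls, whose tallies are powers of q and
  hence congruent modulo q - 1. Without normalisation the radii are equal and the tallies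
  cancel.\<close>

lemma tally_bd:
  assumes "level_map \<kappa>" "y \<in> lchains \<kappa> (Suc 0)"
  shows "\<exists>M0. \<forall>M\<ge>M0. tallied M (bd \<kappa> (Suc 0) y) \<and> (int CARD('r) - 1) dvd tally M (bd \<kappa> (Suc 0) y) \<and>
    (\<kappa> = lv0 \<longrightarrow> tally M (bd \<kappa> (Suc 0) y) = 0)"
proof -
  let ?R = "\<lambda>M h. tallied M h \<and> (int CARD('r) - 1) dvd tally M h \<and> (\<kappa> \<noteq> lv0 \<or> tally M h = 0)"
  let ?P = "\<lambda>y. y \<in> lchains \<kappa> (Suc 0) \<and> (\<exists>M0. \<forall>M\<ge>M0. ?R M (bd \<kappa> (Suc 0) y))"
  have "?P y"
  proof (rule zspan_closed[where P = ?P])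
    show "y \<in> zspan (nbhd_indicator ` cells \<kappa> (Suc 0))" using assms(2) by (simp add: lchains_def)
    show "?P 0" using tallied_zero tally_zero by (simp only: bd_zero lchains_zero) simp
    fix g assume "g \<in> nbhd_indicator ` cells \<kappa> (Suc 0)"
    then obtain s M where g: "g = indicator (nbhd s M)" and sM: "(s, M) \<in> cells \<kappa> (Suc 0)" by auto
    have "length s = 2" using sM by (simp add: cells_def)
    then obtain x z where s: "s = [x, z]" by (auto simp: numeral_2_eq_2 length_Suc_conv)
    let ?Mx = "M - fst (\<kappa> (fst x))" and ?Mz = "M - fst (\<kappa> (fst z))"
    obtain x' z' where xz: "normalise \<kappa> [x] = [x']" "normalise \<kappa> [z] = [z']"
      using normalise_point[of \<kappa> "fst x" "snd x"] normalise_point[of \<kappa> "fst z" "snd z"] by auto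
    have bd: "bd \<kappa> (Suc 0) g = indicator (nbhd [z'] ?Mz) - indicator (nbhd [x'] ?Mx)"
      unfolding g s bd_edge xz ..
    have "?R N (bd \<kappa> (Suc 0) g)" if N: "max ?Mx ?Mz \<le> N" for N
    proof -
      have 1: "tallied N (indicator (nbhd [z'] ?Mz))" "tally N (indicator (nbhd [z'] ?Mz)) = int CARD('r) ^ nat (N - ?Mz)"
        and 2: "tallied N (indicator (nbhd [x'] ?Mx))" "tally N (indicator (nbhd [x'] ?Mx)) = int CARD('r) ^ nat (N - ?Mx)"
        using tally_nbhd[of ?Mz N] tally_nbhd[of ?Mx N] N by auto
      have "tally N (bd \<kappa> (Suc 0) g) = (int CARD('r) ^ nat (N - ?Mz) - 1) - (int CARD('r) ^ nat (N - ?Mx) - 1)"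
        unfolding bd tally_diff[OF 1(1) 2(1)] 1(2) 2(2) by simp
      moreover have "(int CARD('r) - 1) dvd (int CARD('r) ^ nat (N - ?Mz) - 1) - (int CARD('r) ^ nat (N - ?Mx) - 1)"
        by (intro dvd_diff dvd_power_minus_1)
      moreover have "tallied N (bd \<kappa> (Suc 0) g)" unfolding bd by (rule tallied_diff[OF 1(1) 2(1)])
      ultimately show ?thesis by auto
    qed
    then show "?P g" using cell_in_lchains[OF sM] unfolding g by blast
  next
    fix h k assume hk: "?P h" "?P k"
    from hk(1) obtain M0 where M0: "\<And>M. M0 \<le> M \<Longrightarrow> ?R M (bd \<kappa> (Suc 0) h)" by blast
    from hk(2) obtain M1 where M1: "\<And>M. M1 \<le> M \<Longrightarrow> ?R M (bd \<kappa> (Suc 0) k)" by blast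
    have in_ch: "h \<in> lchains \<kappa> (Suc 0)" "k \<in> lchains \<kappa> (Suc 0)" using hk by blast+
    have "?R M (bd \<kappa> (Suc 0) (h + k)) \<and> ?R M (bd \<kappa> (Suc 0) (h - k))" if "max M0 M1 \<le> M" for M
    proof -
      have R: "?R M (bd \<kappa> (Suc 0) h)" "?R M (bd \<kappa> (Suc 0) k)" using M0 M1 that by simp_all
      show ?thesis
        unfolding bd_add[OF assms(1) in_ch] bd_diff[OF assms(1) in_ch]
        using R tally_add[OF R(1)[THEN conjunct1] R(2)[THEN conjunct1]]
          tally_diff[OF R(1)[THEN conjunct1] R(2)[THEN conjunct1]]
          tallied_add[OF R(1)[THEN conjunct1] R(2)[THEN conjunct1]]
          tallied_diff[OF R(1)[THEN conjunct1] R(2)[THEN conjunct1]] by simp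
    qed
    then show "?P (h + k)" "?P (h - k)" using lchains_add[OF in_ch] lchains_diff[OF in_ch] by blast+
  qed
  then show ?thesis by blast
qed

text \<open>The ball of measure q^(-M) around the zero sequence at level zero; these represent the
  generators of Z[1/q].\<close>

definition beta :: "int \<Rightarrow> 'r simplex \<Rightarrow> int" where
  "beta M = indicator (nbhd [(0, 0)] M)"

lemma point_cell: "w \<in> small (fst v) \<Longrightarrow> fst v \<le> M \<Longrightarrow> \<kappa> v = 0 \<Longrightarrow> ([(v, w)], M) \<in> cells \<kappa> 0"
  by (simp add: cells_def simplex_def fine_def)

lemma beta_in_lchains: "level_map \<kappa> \<Longrightarrow> 0 \<le> M \<Longrightarrow> beta M \<in> lchains \<kappa> 0"
  unfolding beta_def by (intro cell_in_lchains point_cell) (simp_all add: level_map_simps)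

text \<open>The centre of a ball may be truncated to a Laurent polynomial. This is an admissible
  translation, so an edge joins the centre to the origin and moves the whole ball.\<close>

lemma point_homologous:
  assumes "w \<in> small (fst v)" "fst v \<le> M" "0 \<le> M"
  shows "indicator (nbhd [(v, w)] M) - beta M \<in> bdry lv0"
proof -
  obtain w' where w': "\<And>i. w' $$ i = (if i < M then w $$ i else 0)" using fls_truncate by metis
  have "w' - w \<in> small M" by (simp add: small_def w')
  then have "nbhd (translate (w' - w) [(v, w)]) M = nbhd [(v, w)] M" by (rule nbhd_translate)
  then have eq: "nbhd [(v, w)] M = nbhd [(v, w')] M" by (simp add: translate_def)
  have "w' \<in> transl" using transl_polynomial[of M w'] by (simp add: w')
  moreover have "w' \<in> small (fst v)" using assms(1) by (simp add: small_def w')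
  ultimately have "([(0, 0), (v, w')], M) \<in> cells lv0 (Suc 0)"
    using assms(2,3) transl_uminus[of w'] by (simp add: cells_def simplex_def fine_def)
  from cell_in_lchains[OF this] have "bd lv0 (Suc 0) (indicator (nbhd [(0, 0), (v, w')] M)) \<in> bdry lv0"
    unfolding bdry_def by blast
  then show ?thesis unfolding bd_edge normalise_lv0 beta_def eq by simp
qed

lemma beta_split: "0 \<le> M \<Longrightarrow> beta M - of_int (int CARD('r)) * beta (M + 1) \<in> bdry lv0"
proof -
  assume M: "0 \<le> M"
  let ?x = "\<lambda>c. [(0 :: int \<times> int, fls_shift (- M) (fls_const c))]"
  have "beta M - of_int (int CARD('r)) * beta (M + 1) = (\<Sum>c\<in>UNIV. indicator (nbhd (?x c) (M + 1)) - beta (M + 1))"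
    unfolding beta_def[of M] by (simp add: nbhd_split translate_def sum_subtractf)
  also have "\<dots> \<in> bdry lv0"
  proof (intro bdry_sum level_map_lv0 point_homologous)
    show "fls_shift (- M) (fls_const c) \<in> small (fst 0)" for c :: 'r using M by (auto simp: small_def)
  qed (use M in auto)
  finally show ?thesis .
qed

text \<open>The conclusion covers all large M so that two chains can be expressed by the same ball
  before they are added.\<close>

lemma homologous_to_beta:
  assumes "e \<in> lchains lv0 0"
  shows "\<exists>M0\<ge>0. \<forall>M\<ge>M0. \<exists>j. e - of_int j * beta M \<in> bdry lv0"
proof -
  let ?Q = "\<lambda>M e. \<exists>j. e - of_int j * beta M \<in> bdry lv0"
  have Q_add: "?Q M (h + k)" and Q_diff: "?Q M (h - k)" if hk: "?Q M h" "?Q M k" for M h k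
  proof -
    obtain i j where ij: "h - of_int i * beta M \<in> bdry lv0" "k - of_int j * beta M \<in> bdry lv0"
      using hk by blast
    have "h + k - of_int (i + j) * beta M = (h - of_int i * beta M) + (k - of_int j * beta M)"
      by (simp add: algebra_simps)
    then show "?Q M (h + k)" using bdry_add[OF level_map_lv0 ij] by metis
    have "h - k - of_int (i - j) * beta M = (h - of_int i * beta M) - (k - of_int j * beta M)"
      by (simp add: algebra_simps)
    then show "?Q M (h - k)" using bdry_diff[OF level_map_lv0 ij] by metis
  qed
  have Q0: "?Q M 0" for M by (rule exI[of _ 0]) simp
  let ?P = "\<lambda>e. \<exists>M0\<ge>0. \<forall>M\<ge>M0. ?Q M e"
  show "?P e"
  proof (rule zspan_closed[where P = ?P])
    show "e \<in> zspan (nbhd_indicator ` cells lv0 0)" using assms by (simp add: lchains_def)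
    show "?P 0" using Q0 by blast
    fix g assume "g \<in> nbhd_indicator ` cells lv0 0"
    then obtain s M' where g: "g = indicator (nbhd s M')" and sM: "(s, M') \<in> cells lv0 0" by auto
    have "length s = Suc 0" using sM by (simp add: cells_def)
    then obtain v w where s: "s = [(v, w)]" by (auto simp: length_Suc_conv)
    have vw: "w \<in> small (fst v)" "fst v \<le> M'" using sM by (simp_all add: cells_def simplex_def fine_def s)
    have "?Q M g" if M: "max 0 M' \<le> M" for M
    proof -
      have "M' \<le> M" "0 \<le> M" using M by auto
      have "g \<in> zspan ((\<lambda>\<epsilon>. indicator (nbhd (translate \<epsilon> s) M)) ` small M')"
        unfolding g by (rule nbhd_refine) (use \<open>M' \<le> M\<close> s in auto)
      then show ?thesis
      proof (rule zspan_closed[where P = "?Q M"])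
        fix h :: "'r simplex \<Rightarrow> int" assume "h \<in> (\<lambda>\<epsilon>. indicator (nbhd (translate \<epsilon> s) M)) ` small M'"
        then obtain \<epsilon> where "\<epsilon> \<in> small M'" "h = indicator (nbhd [(v, w + \<epsilon>)] M)"
          by (auto simp: s translate_def)
        then have "h - of_int 1 * beta M \<in> bdry lv0"
          using point_homologous[of "w + \<epsilon>" v M] vw small_add[OF vw(1) small_mono[OF vw(2)]]
            \<open>M' \<le> M\<close> \<open>0 \<le> M\<close> by simp
        then show "?Q M h" by blast
      qed (rule Q0, erule (1) Q_add, erule (1) Q_diff)
    qed
    then show "?P g" by (intro exI[of _ "max 0 M'"]) simp
  next
    fix h k assume "?P h" "?P k"
    then obtain M0 M1 where "0 \<le> M0" "\<forall>M\<ge>M0. ?Q M h" "0 \<le> M1" "\<forall>M\<ge>M1. ?Q M k" by blast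
    then show "?P (h + k)" "?P (h - k)"
      using Q_add Q_diff by (intro exI[of _ "max M0 M1"]; simp)+
  qed
qed

text \<open>The tally of j balls is j times a power of q, and q is congruent to 1 modulo q -
  1.\<close>

lemma beta_multiple_bdry:
  assumes "level_map \<kappa>" "0 \<le> M" "of_int j * beta M \<in> bdry \<kappa>"
  shows "(int CARD('r) - 1) dvd j" "\<kappa> = lv0 \<Longrightarrow> j = 0"
proof -
  obtain y where y: "y \<in> lchains \<kappa> (Suc 0)" "of_int j * beta M = bd \<kappa> (Suc 0) y"
    using assms(3) by (auto simp: bdry_def)
  obtain M0 where M0: "\<And>M'. M0 \<le> M' \<Longrightarrow> (int CARD('r) - 1) dvd tally M' (of_int j * beta M) \<and>
      (\<kappa> = lv0 \<longrightarrow> tally M' (of_int j * beta M) = 0)"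
    using tally_bd[OF assms(1) y(1)] unfolding y(2) by blast
  let ?k = "nat (max M M0 - M)"
  have t: "tally (max M M0) (of_int j * beta M) = j * int CARD('r) ^ ?k"
    unfolding tally_of_int beta_def using tally_nbhd[of M "max M M0"] by simp
  have "(int CARD('r) - 1) dvd j * int CARD('r) ^ ?k" using M0[of "max M M0"] t by simp
  moreover have "(int CARD('r) - 1) dvd j * (int CARD('r) ^ ?k - 1)" by (intro dvd_mult dvd_power_minus_1)
  moreover have "j = j * int CARD('r) ^ ?k - j * (int CARD('r) ^ ?k - 1)" by (simp add: algebra_simps)
  ultimately show "(int CARD('r) - 1) dvd j" by (metis dvd_diff)
  show "j = 0" if "\<kappa> = lv0" using M0[of "max M M0"] t that card_ge_2 by simp
qed

lemma shift_bdry: "level_map \<kappa> \<Longrightarrow> \<kappa> u = 0 \<Longrightarrow> h \<in> bdry \<kappa> \<Longrightarrow> push (shift u) h \<in> bdry \<kappa>"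
proof -
  assume \<kappa>: "level_map \<kappa>" "\<kappa> u = 0" and "h \<in> bdry \<kappa>"
  then obtain y where y: "y \<in> lchains \<kappa> (Suc 0)" "h = bd \<kappa> (Suc 0) y" by (auto simp: bdry_def)
  show ?thesis unfolding y(2) push_shift_bd[OF \<kappa> y(1)] bdry_def
    using shift_in_lchains[OF \<kappa> y(1)] by (rule imageI)
qed

lemma shift_beta:
  assumes "0 \<le> M" "0 \<le> M + fst u" shows "push (shift u) (beta M) - beta (M + fst u) \<in> bdry lv0"
proof -
  have "push (shift u) (beta M) = indicator (nbhd [(u, 0)] (M + fst u))"
    unfolding beta_def equivariant_push[OF equivariant_shift[of "[(0, 0)]"], simplified] by (simp add: shift_def)
  then show ?thesis using point_homologous[of 0 u "M + fst u"] assms by simp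
qed

text \<open>The shift by \<open>x\<close> divides the invariant measure by the size of \<open>R\<close>, so it fixes no nonzero class.\<close>

lemma shift_fixed_class:
  assumes "e \<in> lchains lv0 0" "e - push (shift (1, 0)) e \<in> bdry lv0" shows "e \<in> bdry lv0"
proof -
  note l = level_map_lv0
  obtain M j where M: "0 \<le> M" and j: "e - of_int j * beta M \<in> bdry lv0"
    using homologous_to_beta[OF assms(1)] by blast
  let ?T = "push (shift (1, 0))"
  have T: "?T (h - k) = ?T h - ?T k" "?T (of_int j * h) = of_int j * ?T h" for h k
    by (simp_all add: push_diff push_of_int)
  have a2: "?T e - of_int j * ?T (beta M) \<in> bdry lv0"
    using shift_bdry[OF l _ j, of "(1, 0)"] by (simp only: T)
  have a3: "of_int j * (?T (beta M) - beta (M + 1)) \<in> bdry lv0"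
    using shift_beta[of M "(1, 0)"] M by (intro bdry_of_int) simp
  have a4: "of_int j * (beta M - of_int (int CARD('r)) * beta (M + 1)) \<in> bdry lv0"
    by (intro bdry_of_int beta_split M)
  \<comment> \<open>With e ~ j \<open>beta M\<close>, T \<open>beta M\<close> ~
    \<open>beta (M + 1)\<close> and \<open>beta M\<close> ~ q \<open>beta (M + 1)\<close>, the class
    of e - T e is j (q - 1) \<open>beta (M + 1)\<close>, which the invariant measure
    detects.\<close>
  have "(e - ?T e) - (e - of_int j * beta M) + (?T e - of_int j * ?T (beta M)) +
      of_int j * (?T (beta M) - beta (M + 1)) - of_int j * (beta M - of_int (int CARD('r)) * beta (M + 1)) \<in> bdry lv0"
    by (rule bdry_diff[OF l bdry_add[OF l bdry_add[OF l bdry_diff[OF l assms(2) j] a2] a3] a4])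
  also have "(e - ?T e) - (e - of_int j * beta M) + (?T e - of_int j * ?T (beta M)) +
      of_int j * (?T (beta M) - beta (M + 1)) - of_int j * (beta M - of_int (int CARD('r)) * beta (M + 1)) =
      of_int (j * (int CARD('r) - 1)) * beta (M + 1)"
    by (simp add: algebra_simps)
  finally have "of_int (j * (int CARD('r) - 1)) * beta (M + 1) \<in> bdry lv0" .
  from beta_multiple_bdry(2)[OF l _ this refl] have "j * (int CARD('r) - 1) = 0" using M by simp
  then have "j = 0" using card_ge_2 by simp
  then show ?thesis using j by simp
qed

text \<open>Above degree 1 both outer terms of the Wang sequence vanish; in degree 1 the input is
  that 1 - T is injective on degree-zero homology.\<close>

theorem acyclic_lv1: "acyclic_at lv1 (Suc n)"
proof (rule cyclic_step_acyclic[OF cyclic_step_01 acyclic_lv0])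
  fix y assume y: "y \<in> lchains lv0 n" "bd lv0 n y = 0"
    "y - push (shift (1, 0)) y \<in> bd lv0 (Suc n) ` lchains lv0 (Suc n)"
  show "y \<in> bd lv0 (Suc n) ` lchains lv0 (Suc n)"
  proof (cases n)
    case 0
    then show ?thesis using shift_fixed_class y by (simp add: bdry_def)
  next
    case (Suc m)
    then show ?thesis using acyclic_lv0[of m] y(1,2) by (simp add: acyclic_at_def)
  qed
qed

lemma bdry_normalise:
  assumes "h \<in> bdry \<kappa>" "level_map \<kappa>" "level_map \<kappa>'" "\<And>v. \<kappa>' (\<kappa> v) = \<kappa> v"
  shows "push (normalise \<kappa>') h \<in> bdry \<kappa>'"
proof -
  obtain y where y: "y \<in> lchains \<kappa> (Suc 0)" "h = bd \<kappa> (Suc 0) y" using assms(1) by (auto simp: bdry_def)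
  have "push (normalise \<kappa>') h = bd \<kappa>' (Suc 0) (push (normalise \<kappa>') y)"
    unfolding y(2) using push_normalise_bd[OF assms(2-4) y(1)] .
  then show ?thesis unfolding bdry_def using normalise_in_lchains[OF assms(3) y(1)] by blast
qed

text \<open>Chains already normalised for \<open>lv1\<close> are fixed by the projection, so
  relations found upstairs persist.\<close>

lemma bdry_lv0_lv1:
  assumes "h \<in> lchains lv1 0" "k \<in> lchains lv1 0" "h - of_int j * k \<in> bdry lv0"
  shows "h - of_int j * k \<in> bdry lv1"
proof -
  have "h - of_int j * k \<in> lchains lv1 0" using assms(1,2) by (intro lchains_diff lchains_of_int)
  then show ?thesis
    using push_normalise_eq_self bdry_normalise[OF assms(3) level_map_lv0 level_map_lv1] level_map_lv1
    by (metis level_map_simps(2))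
qed

text \<open>The shift by x raises the radius by one, and it becomes trivial once x is divided
  out.\<close>

lemma beta_independent: "0 \<le> M \<Longrightarrow> beta 0 - beta M \<in> bdry lv1"
proof (induction M rule: int_ge_induct)
  case base
  show ?case by (simp only: diff_self bdry_zero)
next
  case (step M)
  have b: "beta M \<in> lchains lv0 0" by (rule beta_in_lchains[OF level_map_lv0 step.hyps])
  have "push (normalise lv1) (push (shift (1, 0)) (beta M) - beta (M + 1)) \<in> bdry lv1"
    using bdry_normalise[OF shift_beta[of M "(1, 0)"] level_map_lv0 level_map_lv1] step.hyps
    by (simp add: zero_prod_def)
  moreover have "push (normalise lv1) (push (shift (1, 0)) (beta M)) = beta M"
    using push_normalise_shift[OF level_map_lv1 _ b, of "(1, 0)"]
      push_normalise_eq_self[OF beta_in_lchains[OF level_map_lv1 step.hyps]] by simp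
  moreover have "push (normalise lv1) (beta (M + 1)) = beta (M + 1)"
    using step.hyps by (intro push_normalise_eq_self[of _ _ 0] beta_in_lchains level_map_lv1) simp
  moreover have "finite_fibres (normalise lv1) (push (shift (1, 0)) (beta M))"
    using shift_in_lchains[OF level_map_lv0 _ b] normalise_finite_fibres by blast
  moreover have "finite_fibres (normalise lv1) (beta (M + 1))"
    using step.hyps by (intro normalise_finite_fibres[of _ lv0 0] beta_in_lchains level_map_lv0) simp
  ultimately have "beta M - beta (M + 1) \<in> bdry lv1" by (simp add: push_diff)
  moreover have "beta 0 - beta (M + 1) = (beta 0 - beta M) + (beta M - beta (M + 1))" by simp
  ultimately show ?case using bdry_add[OF level_map_lv1 step.IH] by (simp only:)
qed

lemma homologous_to_beta_lv1:
  assumes "e \<in> lchains lv1 0" shows "\<exists>j. e - of_int j * beta 0 \<in> bdry lv1"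
proof -
  have "e \<in> lchains lv0 0" using assms lchains_mono[of lv1 lv0] by auto
  then obtain M j where M: "0 \<le> M" and "e - of_int j * beta M \<in> bdry lv0"
    using homologous_to_beta by blast
  then have j: "e - of_int j * beta M \<in> bdry lv1"
    using bdry_lv0_lv1[OF assms beta_in_lchains[OF level_map_lv1 M]] by blast
  have "(e - of_int j * beta M) - of_int j * (beta 0 - beta M) \<in> bdry lv1"
    by (rule bdry_diff[OF level_map_lv1 j bdry_of_int[OF beta_independent[OF M]]])
  moreover have "(e - of_int j * beta M) - of_int j * (beta 0 - beta M) = e - of_int j * beta 0"
    by (simp add: algebra_simps)
  ultimately show ?thesis by metis
qed

text \<open>Both \<open>beta 0\<close> ~ q \<open>beta 1\<close> and \<open>beta 0\<close> ~
  \<open>beta 1\<close> hold, so q - 1 kills the class; the tally shows that nothing smaller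
  does.\<close>

lemma beta_multiple_bdry_lv1: "of_int j * beta 0 \<in> bdry lv1 \<longleftrightarrow> (int CARD('r) - 1) dvd j"
proof
  assume "(int CARD('r) - 1) dvd j"
  then obtain i where j: "j = (int CARD('r) - 1) * i" by (auto elim: dvdE)
  have "beta 0 - of_int (int CARD('r)) * beta (0 + 1) \<in> bdry lv1"
    by (rule bdry_lv0_lv1[OF _ _ beta_split]) (simp_all add: beta_in_lchains level_map_lv1)
  then have split: "beta 0 - of_int (int CARD('r)) * beta 1 \<in> bdry lv1" by simp
  have "of_int i * (of_int (int CARD('r)) * (beta 0 - beta 1) - (beta 0 - of_int (int CARD('r)) * beta 1)) \<in> bdry lv1"
    by (rule bdry_of_int[OF bdry_diff[OF level_map_lv1 bdry_of_int[OF beta_independent] split]]) simp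
  moreover have "of_int i * (of_int (int CARD('r)) * (beta 0 - beta 1) - (beta 0 - of_int (int CARD('r)) * beta 1)) = of_int j * beta 0"
    by (simp add: j algebra_simps)
  ultimately show "of_int j * beta 0 \<in> bdry lv1" by simp
qed (rule beta_multiple_bdry(1)[OF level_map_lv1, of 0]; simp)

text \<open>The shift by f has x-exponent 0 and keeps the radius, so it fixes the class of
  \<open>beta 0\<close>, which generates.\<close>

lemma shift_trivial_lv1:
  assumes "e \<in> lchains lv1 0" shows "e - push (shift (0, 1)) e \<in> bdry lv1"
proof -
  obtain j where j: "e - of_int j * beta 0 \<in> bdry lv1" using homologous_to_beta_lv1[OF assms] by blast
  let ?T = "push (shift (0, 1))"
  have T: "?T (h - k) = ?T h - ?T k" "?T (of_int j * h) = of_int j * ?T h" for h k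
    by (simp_all add: push_diff push_of_int)
  have a2: "?T (e - of_int j * beta 0) \<in> bdry lv1"
    by (rule shift_bdry[OF level_map_lv1 _ j]) (simp add: zero_prod_def)
  have "?T (beta 0) - of_int 1 * beta 0 \<in> bdry lv1"
    using shift_beta[of 0 "(0, 1)"]
    by (intro bdry_lv0_lv1 shift_in_lchains beta_in_lchains level_map_lv1) (auto simp: zero_prod_def)
  then have a3: "of_int j * (?T (beta 0) - beta 0) \<in> bdry lv1" using bdry_of_int by simp
  have "(e - of_int j * beta 0) - ?T (e - of_int j * beta 0) - of_int j * (?T (beta 0) - beta 0) \<in> bdry lv1"
    by (rule bdry_diff[OF level_map_lv1 bdry_diff[OF level_map_lv1 j a2] a3])
  moreover have "(e - of_int j * beta 0) - ?T (e - of_int j * beta 0) - of_int j * (?T (beta 0) - beta 0) = e - ?T e"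
    unfolding T by (simp add: algebra_simps)
  ultimately show ?thesis by simp
qed

end

context skipper_steinberg
begin

section \<open>Homology of the quotient complex\<close>

lemma lchains_lv2_lv1: "h \<in> lchains lv2 n \<Longrightarrow> h \<in> lchains lv1 n"
  using lchains_mono[of lv2 lv1 n] by (auto simp: zero_prod_def)

abbreviation "shift_f \<equiv> push (shift (0, 1))"

lemma shift_f_diff: "shift_f (h - k) = shift_f h - shift_f k"
  by (simp add: push_diff)

lemma normalise_kernel:
  assumes "h \<in> lchains lv1 n"
  obtains y where "y \<in> lchains lv1 n" "h - push (normalise lv2) h = y - shift_f y"
  using cyclic_step_kernel[OF cyclic_step_12 assms] by blast

lemma normalise_bd_12:
  assumes "h \<in> lchains lv1 n" shows "push (normalise lv2) (bd lv1 n h) = bd lv2 n (push (normalise lv2) h)"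
  by (rule push_normalise_bd[OF level_map_lv1 level_map_lv2 _ assms]) simp

lemma shift_f_bd: "h \<in> lchains lv1 n \<Longrightarrow> shift_f (bd lv1 n h) = bd lv1 n (shift_f h)"
  by (rule push_shift_bd[OF level_map_lv1]) (simp add: zero_prod_def)

lemma shift_f_lchains: "h \<in> lchains lv1 n \<Longrightarrow> shift_f h \<in> lchains lv1 n"
  by (rule shift_in_lchains[OF level_map_lv1]) (simp add: zero_prod_def)

lemma bd_lv1_diff_shift:
  assumes "z \<in> lchains lv1 n" shows "bd lv1 n (z - shift_f z) = bd lv1 n z - shift_f (bd lv1 n z)"
  unfolding bd_diff[OF level_map_lv1 assms shift_f_lchains[OF assms]] shift_f_bd[OF assms] ..

text \<open>Dividing out f passes to the cokernel of 1 - T in degree 0, and there 1 - T has only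
  boundaries as values.\<close>

lemma bdry_lv1_iff_lv2:
  assumes "h \<in> lchains lv2 0" shows "h \<in> bdry lv1 \<longleftrightarrow> h \<in> bdry lv2"
proof
  assume "h \<in> bdry lv1"
  from bdry_normalise[OF this level_map_lv1 level_map_lv2] show "h \<in> bdry lv2"
    using push_normalise_eq_self[OF assms] by simp
next
  assume "h \<in> bdry lv2"
  then obtain y where y: "y \<in> lchains lv2 (Suc 0)" "h = bd lv2 (Suc 0) y" by (auto simp: bdry_def)
  note y1 = lchains_lv2_lv1[OF y(1)]
  let ?g = "bd lv1 (Suc 0) y"
  have g: "?g \<in> bdry lv1" unfolding bdry_def using y1 by (rule imageI)
  have "push (normalise lv2) ?g = h"
    using normalise_bd_12[OF y1] push_normalise_eq_self[OF y(1)] y(2) by simp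
  then obtain z where z: "z \<in> lchains lv1 0" "?g - h = z - shift_f z"
    using normalise_kernel[OF bdry_lchains[OF level_map_lv1 g]] by metis
  have "?g - (?g - h) \<in> bdry lv1"
    unfolding z(2) by (rule bdry_diff[OF level_map_lv1 g shift_trivial_lv1[OF z(1)]])
  then show "h \<in> bdry lv1" by simp
qed

text \<open>The choice is determined only modulo q - 1, so everything about it is a statement of
  divisibility.\<close>

definition residue :: "('r simplex \<Rightarrow> int) \<Rightarrow> int" where
  "residue e = (SOME j. e - of_int j * beta 0 \<in> bdry lv1)"

lemma residue: "e \<in> lchains lv1 0 \<Longrightarrow> e - of_int (residue e) * beta 0 \<in> bdry lv1"
  unfolding residue_def by (rule someI_ex) (rule homologous_to_beta_lv1)

lemma residue_unique:
  assumes "e \<in> lchains lv1 0" "e - of_int j * beta 0 \<in> bdry lv1"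
  shows "(int CARD('r) - 1) dvd residue e - j"
proof -
  have "(e - of_int j * beta 0) - (e - of_int (residue e) * beta 0) \<in> bdry lv1"
    by (rule bdry_diff[OF level_map_lv1 assms(2) residue[OF assms(1)]])
  moreover have "(e - of_int j * beta 0) - (e - of_int (residue e) * beta 0) = of_int (residue e - j) * beta 0"
    by (simp add: algebra_simps)
  ultimately show ?thesis by (simp only: beta_multiple_bdry_lv1)
qed

lemma residue_add:
  assumes "e \<in> lchains lv1 0" "e' \<in> lchains lv1 0"
  shows "(int CARD('r) - 1) dvd residue (e + e') - (residue e + residue e')"
proof (rule residue_unique[OF lchains_add[OF assms]])
  have "e + e' - of_int (residue e + residue e') * beta 0 =
      (e - of_int (residue e) * beta 0) + (e' - of_int (residue e') * beta 0)"
    by (simp add: algebra_simps)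
  then show "e + e' - of_int (residue e + residue e') * beta 0 \<in> bdry lv1"
    using bdry_add[OF level_map_lv1 residue[OF assms(1)] residue[OF assms(2)]] by (simp only:)
qed

lemma residue_dvd_iff:
  assumes "e \<in> lchains lv1 0" shows "(int CARD('r) - 1) dvd residue e \<longleftrightarrow> e \<in> bdry lv1"
proof
  assume "(int CARD('r) - 1) dvd residue e"
  then have "of_int (residue e) * beta 0 \<in> bdry lv1" by (simp only: beta_multiple_bdry_lv1)
  from bdry_add[OF level_map_lv1 residue[OF assms] this] show "e \<in> bdry lv1" by simp
next
  assume "e \<in> bdry lv1"
  then have "e - of_int 0 * beta 0 \<in> bdry lv1" by simp
  from residue_unique[OF assms this] show "(int CARD('r) - 1) dvd residue e" by simp
qed

lemma residue_beta: "(int CARD('r) - 1) dvd residue (of_int j * beta 0) - j"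
  by (rule residue_unique) (simp_all only: diff_self bdry_zero lchains_of_int beta_in_lchains level_map_lv1 order_refl)

definition cycles :: "nat \<Rightarrow> ('r simplex \<Rightarrow> int) set" where
  "cycles n = {h \<in> lchains lv2 n. bd lv2 n h = 0}"

definition boundaries :: "nat \<Rightarrow> ('r simplex \<Rightarrow> int) set" where
  "boundaries n = bd lv2 (Suc n) ` lchains lv2 (Suc n)"

text \<open>Says that \<open>\<rho>\<close> induces an isomorphism from homology in degree n onto
  Z/N, without forming the quotient: additive modulo N, onto, and with the boundaries as
  kernel.\<close>

definition classifies :: "(('r simplex \<Rightarrow> int) \<Rightarrow> int) \<Rightarrow> int \<Rightarrow> nat \<Rightarrow> bool" where
  "classifies \<rho> N n \<longleftrightarrow>
     (\<forall>h\<in>cycles n. \<forall>k\<in>cycles n. N dvd \<rho> (h + k) - (\<rho> h + \<rho> k)) \<and>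
     (\<forall>j. \<exists>h\<in>cycles n. N dvd \<rho> h - j) \<and>
     (\<forall>h\<in>cycles n. N dvd \<rho> h \<longleftrightarrow> h \<in> boundaries n)"

theorem classifies_0: "classifies residue (int CARD('r) - 1) 0"
proof -
  have cyc: "cycles 0 = lchains lv2 0" by (simp add: cycles_def bd_def)
  have bnd: "boundaries 0 = bdry lv2" by (simp add: boundaries_def bdry_def)
  show ?thesis
    unfolding classifies_def cyc bnd
  proof (intro conjI ballI allI)
    show "(int CARD('r) - 1) dvd residue (h + k) - (residue h + residue k)"
      if "h \<in> lchains lv2 0" "k \<in> lchains lv2 0" for h k
      using that[THEN lchains_lv2_lv1] by (rule residue_add)
    show "\<exists>h\<in>lchains lv2 0. (int CARD('r) - 1) dvd residue h - j" for j
      using residue_beta[of j] lchains_of_int[OF beta_in_lchains[OF level_map_lv2 order_refl]] by blast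
    show "(int CARD('r) - 1) dvd residue h \<longleftrightarrow> h \<in> bdry lv2" if "h \<in> lchains lv2 0" for h
      unfolding residue_dvd_iff[OF lchains_lv2_lv1[OF that]] by (rule bdry_lv1_iff_lv2[OF that])
  qed
qed

text \<open>The connecting map of the Wang sequence for f, from degree 1 to degree 0. As 1 - T is
  injective on chains, the chosen value is unique, so the map is additive on the nose.\<close>

definition lift :: "('r simplex \<Rightarrow> int) \<Rightarrow> 'r simplex \<Rightarrow> int" where
  "lift c = (SOME y. y \<in> lchains lv1 0 \<and> bd lv1 (Suc 0) c = y - shift_f y)"

lemma lift:
  assumes "c \<in> cycles (Suc 0)" shows "lift c \<in> lchains lv1 0" "bd lv1 (Suc 0) c = lift c - shift_f (lift c)"
proof -
  have "c \<in> lchains lv2 (Suc 0)" "bd lv2 (Suc 0) c = 0" using assms by (auto simp: cycles_def)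
  then obtain y where "y \<in> lchains lv1 0" "bd lv1 (Suc 0) c = y - shift_f y"
    by (rule cyclic_step_lift[OF cyclic_step_12])
  then have "\<exists>y. y \<in> lchains lv1 0 \<and> bd lv1 (Suc 0) c = y - shift_f y" by blast
  from someI_ex[OF this] show "lift c \<in> lchains lv1 0" "bd lv1 (Suc 0) c = lift c - shift_f (lift c)"
    unfolding lift_def by blast+
qed

lemma lift_unique:
  assumes "c \<in> cycles (Suc 0)" "y \<in> lchains lv1 0" "bd lv1 (Suc 0) c = y - shift_f y"
  shows "lift c = y"
proof -
  have "lift c - y \<in> lchains lv1 0" using lift(1)[OF assms(1)] assms(2) by (rule lchains_diff)
  moreover have "shift_f (lift c - y) = lift c - y"
    using lift(2)[OF assms(1)] assms(3) unfolding shift_f_diff by (simp add: algebra_simps)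
  ultimately have "lift c - y = 0" by (rule shift_fixed_eq_0) (simp add: zero_prod_def)
  then show ?thesis by simp
qed

lemma cycles_add:
  assumes "h \<in> cycles n" "k \<in> cycles n" shows "h + k \<in> cycles n"
proof -
  have "h \<in> lchains lv2 n" "k \<in> lchains lv2 n" "bd lv2 n h = 0" "bd lv2 n k = 0"
    using assms by (auto simp: cycles_def)
  then show ?thesis using bd_add[OF level_map_lv2, of h lv2 n k] lchains_add[of h lv2 n k]
    by (simp only: cycles_def mem_Collect_eq) simp
qed

lemma lift_add:
  assumes "c \<in> cycles (Suc 0)" "c' \<in> cycles (Suc 0)" shows "lift (c + c') = lift c + lift c'"
proof (rule lift_unique[OF cycles_add[OF assms] lchains_add[OF lift(1)[OF assms(1)] lift(1)[OF assms(2)]]])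
  have "c \<in> lchains lv1 (Suc 0)" "c' \<in> lchains lv1 (Suc 0)"
    using assms lchains_lv2_lv1 by (auto simp: cycles_def)
  from bd_add[OF level_map_lv1 this]
  show "bd lv1 (Suc 0) (c + c') = lift c + lift c' - shift_f (lift c + lift c')"
    unfolding lift(2)[OF assms(1)] lift(2)[OF assms(2)] by (simp add: push_add)
qed

text \<open>The connecting map is injective on homology because \<open>lv1\<close> is acyclic in
  degree 1, and well defined because a boundary below differs from its counterpart upstairs by some
  (1 - T) z.\<close>

lemma lift_dvd_iff:
  assumes c: "c \<in> cycles (Suc 0)"
  shows "lift c \<in> bdry lv1 \<longleftrightarrow> c \<in> boundaries (Suc 0)"
proof
  have c2: "c \<in> lchains lv2 (Suc 0)" using c by (simp add: cycles_def)
  note c1 = lchains_lv2_lv1[OF c2]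
  {
    assume "lift c \<in> bdry lv1"
    then obtain y where y: "y \<in> lchains lv1 (Suc 0)" "lift c = bd lv1 (Suc 0) y" by (auto simp: bdry_def)
    from cyclic_step_boundary[OF cyclic_step_12 acyclic_lv1 c2 y(1)] lift(2)[OF c, unfolded y(2)]
    show "c \<in> boundaries (Suc 0)" unfolding boundaries_def .
  next
    assume "c \<in> boundaries (Suc 0)"
    then obtain d where d: "d \<in> lchains lv2 (Suc (Suc 0))" "c = bd lv2 (Suc (Suc 0)) d"
      by (auto simp: boundaries_def)
    note d1 = lchains_lv2_lv1[OF d(1)]
    let ?g = "bd lv1 (Suc (Suc 0)) d"
    have g: "?g \<in> lchains lv1 (Suc 0)" by (rule bd_in_lchains[OF level_map_lv1 d1])
    have "push (normalise lv2) ?g = c"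
      using normalise_bd_12[OF d1] push_normalise_eq_self[OF d(1)] d(2) by simp
    then obtain z where z: "z \<in> lchains lv1 (Suc 0)" "?g - c = z - shift_f z"
      using normalise_kernel[OF g] by metis
    let ?b = "bd lv1 (Suc 0) z"
    have b: "?b \<in> bdry lv1" unfolding bdry_def using z(1) by (rule imageI)
    have "bd lv1 (Suc 0) (?g - c) = ?b - shift_f ?b" unfolding z(2) by (rule bd_lv1_diff_shift[OF z(1)])
    moreover have "bd lv1 (Suc 0) (?g - c) = 0 - bd lv1 (Suc 0) c"
      unfolding bd_diff[OF level_map_lv1 g c1] bd_bd[OF level_map_lv1 d1] ..
    \<comment> \<open>Uniqueness of the lift turns this identity into the statement that the lift is
      minus the boundary of \<open>z\<close>.\<close>
    ultimately have eq: "bd lv1 (Suc 0) c = (0 - ?b) - shift_f (0 - ?b)"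
      unfolding shift_f_diff by (simp add: algebra_simps)
    have "0 - ?b \<in> bdry lv1" by (rule bdry_diff[OF level_map_lv1 bdry_zero b])
    moreover from lift_unique[OF c bdry_lchains[OF level_map_lv1 this] eq] have "lift c = 0 - ?b" .
    ultimately show "lift c \<in> bdry lv1" by (simp only:)
  }
qed

text \<open>Exactness identifies degree 1 with the kernel of 1 - T on the degree-zero homology of
  \<open>lv1\<close>, which is everything.\<close>

theorem classifies_1: "classifies (\<lambda>c. residue (lift c)) (int CARD('r) - 1) (Suc 0)"
  unfolding classifies_def
proof (intro conjI ballI allI)
  show "(int CARD('r) - 1) dvd residue (lift (h + k)) - (residue (lift h) + residue (lift k))"
    if "h \<in> cycles (Suc 0)" "k \<in> cycles (Suc 0)" for h k
    unfolding lift_add[OF that] by (rule residue_add[OF lift(1)[OF that(1)] lift(1)[OF that(2)]])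
  show "(int CARD('r) - 1) dvd residue (lift c) \<longleftrightarrow> c \<in> boundaries (Suc 0)" if "c \<in> cycles (Suc 0)" for c
    unfolding residue_dvd_iff[OF lift(1)[OF that]] by (rule lift_dvd_iff[OF that])
  show "\<exists>c\<in>cycles (Suc 0). (int CARD('r) - 1) dvd residue (lift c) - j" for j
  proof -
    let ?e = "of_int j * beta 0"
    have e: "?e \<in> lchains lv1 0" by (rule lchains_of_int[OF beta_in_lchains[OF level_map_lv1 order_refl]])
    have "?e - shift_f ?e \<in> bdry lv1" by (rule shift_trivial_lv1[OF e])
    \<comment> \<open>\<open>y\<close> fills the difference of the class and its shift; once f is
      divided out its ends are identified and it becomes a cycle.\<close>
    then obtain y where y: "y \<in> lchains lv1 (Suc 0)" "?e - shift_f ?e = bd lv1 (Suc 0) y"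
      unfolding bdry_def by blast
    let ?c = "push (normalise lv2) y"
    have c2: "?c \<in> lchains lv2 (Suc 0)" by (rule normalise_in_lchains[OF level_map_lv2 y(1)])
    have "bd lv2 (Suc 0) ?c = push (normalise lv2) (?e - shift_f ?e)"
      unfolding normalise_bd_12[OF y(1), symmetric] y(2) ..
    also have "\<dots> = push (normalise lv2) ?e - push (normalise lv2) (shift_f ?e)"
      by (rule push_diff[OF normalise_finite_fibres[OF e] normalise_finite_fibres[OF shift_f_lchains[OF e]]])
    also have "\<dots> = 0" using push_normalise_shift[OF level_map_lv2 _ e, of "(0, 1)"] by simp
    finally have c: "?c \<in> cycles (Suc 0)" using c2 by (simp add: cycles_def)
    obtain z where z: "z \<in> lchains lv1 (Suc 0)" "y - ?c = z - shift_f z"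
      using normalise_kernel[OF y(1)] .
    let ?b = "bd lv1 (Suc 0) z"
    have b: "?b \<in> bdry lv1" unfolding bdry_def using z(1) by (rule imageI)
    have "bd lv1 (Suc 0) (y - ?c) = ?b - shift_f ?b" unfolding z(2) by (rule bd_lv1_diff_shift[OF z(1)])
    moreover have "bd lv1 (Suc 0) (y - ?c) = (?e - shift_f ?e) - bd lv1 (Suc 0) ?c"
      unfolding bd_diff[OF level_map_lv1 y(1) lchains_lv2_lv1[OF c2]] y(2) ..
    \<comment> \<open>Replacing \<open>y\<close> by its normalisation changes the lift from
      \<open>?e\<close> to \<open>?e - ?b\<close>, hence only by a boundary, which leaves the
      residue alone.\<close>
    ultimately have eq: "bd lv1 (Suc 0) ?c = (?e - ?b) - shift_f (?e - ?b)"
      unfolding shift_f_diff by (simp add: algebra_simps)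
    have eb: "?e - ?b \<in> lchains lv1 0" by (rule lchains_diff[OF e bdry_lchains[OF level_map_lv1 b]])
    have "(?e - ?b) - ?e \<in> bdry lv1" using bdry_diff[OF level_map_lv1 bdry_zero b] by simp
    then have "(int CARD('r) - 1) dvd residue (lift ?c) - j"
      unfolding lift_unique[OF c eb eq] by (rule residue_unique[OF eb])
    then show ?thesis using c by blast
  qed
qed

text \<open>Acyclicity is expressed with N = 1, so that one final theorem serves all
  degrees.\<close>

theorem classifies_ge_2: "classifies (\<lambda>_. 0) 1 (Suc (Suc n))"
proof -
  have "acyclic_at lv2 (Suc (Suc n))"
  proof (rule cyclic_step_acyclic[OF cyclic_step_12 acyclic_lv1])
    fix y assume "y \<in> lchains lv1 (Suc n)" "bd lv1 (Suc n) y = 0"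
    then show "y \<in> bd lv1 (Suc (Suc n)) ` lchains lv1 (Suc (Suc n))"
      using acyclic_lv1[of n] by (simp add: acyclic_at_def)
  qed
  then have "h \<in> boundaries (Suc (Suc n))" if "h \<in> cycles (Suc (Suc n))" for h
    using that by (auto simp: acyclic_at_def cycles_def boundaries_def)
  moreover have "0 \<in> cycles (Suc (Suc n))" by (simp add: cycles_def)
  ultimately show ?thesis unfolding classifies_def by auto
qed

lemma boundaries_subset_cycles: "boundaries n \<subseteq> cycles n"
proof
  fix h assume "h \<in> boundaries n"
  then obtain y where y: "y \<in> lchains lv2 (Suc n)" "h = bd lv2 (Suc n) y" by (auto simp: boundaries_def)
  have "bd lv2 n h = 0"
  proof (cases n)
    case (Suc m)
    then show ?thesis using bd_bd[OF level_map_lv2, of y m] y by simp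
  qed (simp add: bd_def)
  then show "h \<in> cycles n" using bd_in_lchains[OF level_map_lv2 y(1)] y(2) by (simp add: cycles_def)
qed

end

context skipper_steinberg
begin

section \<open>Simplices as composable tuples of germs\<close>

type_synonym 's pt = "(int \<times> int) \<times> 's fls"

definition is_point :: "'r pt \<Rightarrow> bool" where
  "is_point p \<longleftrightarrow> snd p \<in> small (fst (fst p))"

definition move :: "'r fls \<Rightarrow> 'r pt \<Rightarrow> 'r pt" where
  "move \<epsilon> p = (fst p, snd p + \<epsilon>)"

text \<open>For a genuine point the quotient by x^k f^m has no negative powers, so
  \<open>fls_regpart\<close> loses nothing.\<close>

definition word_of :: "'r pt \<Rightarrow> 'r word" where
  "word_of p = fps_nth (fls_regpart (scale (- fst p) * snd p))"

lemma Abs_fps_nth [simp]: "Abs_fps (fps_nth p) = p"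
  by (simp add: fps_eq_iff)

lemma word_fls_word_of:
  assumes "is_point p" shows "word_fls (word_of p) = scale (- fst p) * snd p"
proof -
  have "scale (- fst p) * snd p \<in> small 0"
    using assms by (simp add: is_point_def scale_small_iff)
  from small_0E[OF this] show ?thesis by (simp add: word_of_def)
qed

lemma word_of_eqI: "is_point p \<Longrightarrow> word_fls y = scale (- fst p) * snd p \<Longrightarrow> word_of p = y"
  using word_fls_word_of[of p] word_fls_inject[of "word_of p" y] by simp

lemma snd_point: "is_point p \<Longrightarrow> snd p = scale (fst p) * word_fls (word_of p)"
  by (simp add: word_fls_word_of scale_cancel)

lemma point_eqI: "is_point p \<Longrightarrow> is_point p' \<Longrightarrow> fst p = fst p' \<Longrightarrow> word_of p = word_of p' \<Longrightarrow> p = p'"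
  using snd_point[of p] snd_point[of p'] by (metis prod_eqI)

lemma point_of_word: "is_point (v, scale v * word_fls y)" "word_of (v, scale v * word_fls y) = y"
proof -
  have "word_fls y \<in> small (fst v - fst v)" using fps_to_fls_small by simp
  then show 1: "is_point (v, scale v * word_fls y)" by (simp only: is_point_def scale_small_iff fst_conv snd_conv)
  show "word_of (v, scale v * word_fls y) = y" by (rule word_of_eqI[OF 1]) (simp add: scale_cancel)
qed

lemma word_of_shift: "word_of (fst p + u, scale u * snd p) = word_of p"
proof -
  have "scale (- (fst p + u)) * (scale u * snd p) = scale (- fst p) * (scale (- u) * (scale u * snd p))"
    by (simp only: minus_add_distrib scale_add mult.assoc)
  then show ?thesis unfolding word_of_def by (simp add: scale_cancel)
qed

lemma is_point_move: "is_point p \<Longrightarrow> fst (fst p) \<le> M \<Longrightarrow> \<epsilon> \<in> small M \<Longrightarrow> is_point (move \<epsilon> p)"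
  unfolding is_point_def move_def by (auto intro: small_add small_mono)

lemma word_of_move:
  assumes "is_point p" "is_point (move \<epsilon> p)"
  shows "word_fls (word_of (move \<epsilon> p)) = word_fls (word_of p) + scale (- fst p) * \<epsilon>"
  unfolding word_fls_word_of[OF assms(1)] word_fls_word_of[OF assms(2)] by (simp add: move_def distrib_left)

definition edge :: "'r pt \<Rightarrow> 'r pt \<Rightarrow> bool" where
  "edge p p' \<longleftrightarrow> is_point p \<and> is_point p' \<and> snd p - snd p' \<in> transl"

lemma edge_move: "edge p p' \<Longrightarrow> fst (fst p) \<le> M \<Longrightarrow> fst (fst p') \<le> M \<Longrightarrow> \<epsilon> \<in> small M \<Longrightarrow>
    edge (move \<epsilon> p) (move \<epsilon> p')"
  unfolding edge_def using is_point_move[of p M \<epsilon>] is_point_move[of p' M \<epsilon>] by (simp add: move_def)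

lemma edge_refl: "is_point p \<Longrightarrow> edge p p"
  by (simp add: edge_def)

text \<open>The arrow goes from \<open>p'\<close> to \<open>p\<close>. As a vertex is its sequence
  times x^k f^m, congruent series make the linear part the quotient of the scales, in the order
  \<open>fst p' - fst p\<close>.\<close>

definition represents :: "('r list \<times> ((int \<Rightarrow>\<^sub>0 'r) \<times> int) \<times> 'r list) option \<Rightarrow> 'r pt \<Rightarrow> 'r pt \<Rightarrow> bool" where
  "represents \<alpha> p p' \<longleftrightarrow> word_of p' \<in> triple_dom \<alpha> \<and> triple_act \<alpha> (word_of p') = word_of p \<and>
     deg \<alpha> = fst p' - fst p"

definition arrow :: "'r pt \<Rightarrow> 'r pt \<Rightarrow> (('r list \<times> ((int \<Rightarrow>\<^sub>0 'r) \<times> int) \<times> 'r list) option \<times> 'r word) set" where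
  "arrow p p' = germ (SOME \<alpha>. represents \<alpha> p p') (word_of p')"

lemma represents_exists:
  assumes "edge p p'" shows "\<exists>\<alpha>. represents \<alpha> p p'"
proof -
  have pts: "is_point p" "is_point p'" using assms by (simp_all add: edge_def)
  have "scale (fst p' - fst p) * (scale (- fst p') * snd p') = scale (- fst p) * snd p'"
    by (simp add: mult.assoc[symmetric] scale_add[symmetric])
  then have "word_fls (word_of p) - scale (fst p' - fst p) * word_fls (word_of p') =
      scale (- fst p) * (snd p - snd p')"
    unfolding word_fls_word_of[OF pts(1)] word_fls_word_of[OF pts(2)] right_diff_distrib by simp
  moreover have "scale (- fst p) * (snd p - snd p') \<in> transl"
    using assms by (simp add: edge_def transl_scale)
  ultimately show ?thesis unfolding represents_def by (intro triple_exists) simp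
qed

lemma represents_germ_eq: "represents \<alpha> p p' \<Longrightarrow> represents \<beta> p p' \<Longrightarrow> germ \<alpha> (word_of p') = germ \<beta> (word_of p')"
  by (subst germ_eq_iff) (auto simp: represents_def)

lemma arrow_eq_germ: "represents \<alpha> p p' \<Longrightarrow> arrow p p' = germ \<alpha> (word_of p')"
  unfolding arrow_def by (rule represents_germ_eq[OF someI[of "\<lambda>\<alpha>. represents \<alpha> p p'"]])

lemma arrow_eq_iff:
  assumes "edge p p'" "edge t t'"
  shows "arrow p p' = arrow t t' \<longleftrightarrow>
    word_of p = word_of t \<and> word_of p' = word_of t' \<and> fst p' - fst p = fst t' - fst t"
proof -
  obtain \<alpha> \<beta> where r: "represents \<alpha> p p'" "represents \<beta> t t'" using represents_exists assms by blast
  then show ?thesis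
    unfolding arrow_eq_germ[OF r(1)] arrow_eq_germ[OF r(2)]
    by (subst germ_eq_iff) (auto simp: represents_def)
qed

text \<open>Once the target vertex is fixed, the degree forces the level of the source vertex. This
  extends a simplex by one arrow.\<close>

lemma represents_source:
  assumes "y \<in> triple_dom \<alpha>" "is_point p" "word_of p = triple_act \<alpha> y"
  obtains p' where "edge p p'" "represents \<alpha> p p'" "word_of p' = y"
proof
  define v where "v = fst p + deg \<alpha>"
  let ?p' = "(v, scale v * word_fls y)"
  note pt = point_of_word[of v y]
  have "snd p = scale (fst p) * (scale (deg \<alpha>) * word_fls y + translation \<alpha>)"
    unfolding snd_point[OF assms(2)] assms(3) word_fls_triple_act[OF assms(1)] ..
  then have "snd p - snd ?p' = scale (fst p) * translation \<alpha>"
    by (simp add: v_def scale_add distrib_left mult.assoc)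
  then have "snd p - snd ?p' \<in> transl" using transl_scale[OF translation_transl] by simp
  then show "edge p ?p'" unfolding edge_def using assms(2) pt(1) by blast
  show "represents \<alpha> p ?p'" unfolding represents_def pt(2) using assms by (simp add: v_def)
  show "word_of ?p' = y" by (rule pt(2))
qed

lemma germ_is_arrow:
  assumes "y \<in> triple_dom \<alpha>"
  obtains p p' where "edge p p'" "represents \<alpha> p p'" "word_of p' = y" "germ \<alpha> y = arrow p p'"
proof -
  obtain p' where p': "edge (0, scale 0 * word_fls (triple_act \<alpha> y)) p'"
    "represents \<alpha> (0, scale 0 * word_fls (triple_act \<alpha> y)) p'" "word_of p' = y"
    using represents_source[OF assms point_of_word] .
  then show ?thesis using that arrow_eq_germ by metis
qed

text \<open>The same affine map serves displaced ends: a displacement of the source, divided by its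
  scale and multiplied by the linear part, is the displacement of the target divided by its own
  scale.\<close>

lemma represents_move:
  assumes "edge p p'" "edge (move \<epsilon> p) (move \<epsilon> p')" "represents \<alpha> p p'" "word_of (move \<epsilon> p') \<in> triple_dom \<alpha>"
  shows "represents \<alpha> (move \<epsilon> p) (move \<epsilon> p')"
proof -
  have pts: "is_point p" "is_point p'" "is_point (move \<epsilon> p)" "is_point (move \<epsilon> p')"
    using assms(1,2) by (simp_all add: edge_def)
  have r: "word_of p' \<in> triple_dom \<alpha>" "triple_act \<alpha> (word_of p') = word_of p" "deg \<alpha> = fst p' - fst p"
    using assms(3) by (simp_all add: represents_def)
  have "scale (fst p' - fst p) * (scale (- fst p') * \<epsilon>) = scale (- fst p) * \<epsilon>"
    by (simp add: mult.assoc[symmetric] scale_add[symmetric])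
  then have "word_fls (triple_act \<alpha> (word_of (move \<epsilon> p'))) = word_fls (triple_act \<alpha> (word_of p')) + scale (- fst p) * \<epsilon>"
    unfolding word_fls_triple_act[OF r(1)] word_fls_triple_act[OF assms(4)] word_of_move[OF pts(2,4)] r(3)
    by (simp add: distrib_left)
  also have "\<dots> = word_fls (word_of (move \<epsilon> p))" unfolding r(2) word_of_move[OF pts(1,3)] ..
  finally have "triple_act \<alpha> (word_of (move \<epsilon> p')) = word_of (move \<epsilon> p)" by (simp only: word_fls_inject)
  then show ?thesis using assms(4) r(3) by (simp add: represents_def move_def)
qed

lemma src_arrow: "edge p p' \<Longrightarrow> src action_groupoid (arrow p p') = unit_germ (word_of p')"
proof -
  assume "edge p p'"
  then obtain \<alpha> where "represents \<alpha> p p'" using represents_exists by blast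
  then show ?thesis unfolding arrow_eq_germ[OF \<open>represents \<alpha> p p'\<close>]
    by (intro src_germ) (simp add: represents_def)
qed

lemma tgt_arrow: "edge p p' \<Longrightarrow> tgt action_groupoid (arrow p p') = unit_germ (word_of p)"
proof -
  assume "edge p p'"
  then obtain \<alpha> where r: "represents \<alpha> p p'" using represents_exists by blast
  then have "word_of p' \<in> triple_dom \<alpha>" "triple_act \<alpha> (word_of p') = word_of p" by (simp_all add: represents_def)
  then show ?thesis unfolding arrow_eq_germ[OF r] using tgt_germ[of "word_of p'" \<alpha>] by simp
qed

lemma comp_arrow:
  assumes "edge p p'" "edge p' p''"
  shows "comp action_groupoid (arrow p p') (arrow p' p'') = arrow p p''"
proof -
  obtain \<alpha> \<beta> where r: "represents \<alpha> p p'" "represents \<beta> p' p''" using represents_exists assms by blast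
  then have dom: "word_of p'' \<in> triple_dom \<beta>" "triple_act \<beta> (word_of p'') \<in> triple_dom \<alpha>"
    and eq: "triple_act \<beta> (word_of p'') = word_of p'" by (simp_all add: represents_def)
  have "represents (triple_mult \<alpha> \<beta>) p p''"
    using triple_mult_act[OF dom] r by (simp add: represents_def)
  from arrow_eq_germ[OF this] show ?thesis
    using comp_germ[OF dom] unfolding eq arrow_eq_germ[OF r(1)] arrow_eq_germ[OF r(2)] by simp
qed

lemma unit_germ_arrow: "is_point p \<Longrightarrow> unit_germ (word_of p) = arrow p p"
proof -
  have "represents idt p p" using idt_simps by (simp add: represents_def)
  from arrow_eq_germ[OF this] show ?thesis by (simp add: unit_germ_def)
qed

lemma arrow_space_eq: "arrow_space action_groupoid = germ_topology"
  by (simp add: action_groupoid_def)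

section \<open>The topology of the nerve\<close>

definition agree :: "nat \<Rightarrow> 'r word \<Rightarrow> 'r word set" where
  "agree N y = {y'. \<forall>i<N. y' i = y i}"

lemma self_agree: "y \<in> agree N y"
  by (simp add: agree_def)

lemma openin_sequences_prefix: "openin sequences (agree N y)"
proof -
  have "agree N y = (\<Pi>\<^sub>E i\<in>UNIV. if i < N then {y i} else UNIV)"
    by (auto simp: agree_def PiE_def Pi_def split: if_splits)
  moreover have "openin sequences (\<Pi>\<^sub>E i\<in>UNIV. if i < N then {y i} else UNIV)"
    unfolding sequences_def
    by (rule product_topology_basis) (auto intro: finite_subset[of _ "{..<N}"] split: if_splits)
  ultimately show ?thesis by simp
qed

lemma openin_sequences_iff:
  "openin sequences U \<longleftrightarrow> (\<forall>y\<in>U. \<exists>N. agree N y \<subseteq> U)"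
proof
  assume U: "openin sequences U"
  show "\<forall>y\<in>U. \<exists>N. agree N y \<subseteq> U"
  proof
    fix y assume "y \<in> U"
    from product_topology_open_contains_basis[OF U[unfolded sequences_def] this]
    obtain X where X: "y \<in> (\<Pi>\<^sub>E i\<in>UNIV. X i)" "finite {i. X i \<noteq> topspace (discrete_topology (UNIV :: 'r set))}"
      "(\<Pi>\<^sub>E i\<in>UNIV. X i) \<subseteq> U" by blast
    obtain N where N: "\<And>i. i \<in> {i. X i \<noteq> topspace (discrete_topology (UNIV :: 'r set))} \<Longrightarrow> i < N"
      using X(2) unfolding finite_nat_set_iff_bounded by blast
    have "agree N y \<subseteq> (\<Pi>\<^sub>E i\<in>UNIV. X i)"
    proof
      fix y' assume y': "y' \<in> agree N y"
      have "y' i \<in> X i" for i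
      proof (cases "i < N")
        case True
        then show ?thesis using y' X(1) by (auto simp: agree_def PiE_def Pi_def)
      next
        case False
        then have "X i = UNIV" using N[of i] by auto
        then show ?thesis by simp
      qed
      then show "y' \<in> (\<Pi>\<^sub>E i\<in>UNIV. X i)" by (simp add: PiE_def)
    qed
    then show "\<exists>N. agree N y \<subseteq> U" using X(3) by blast
  qed
next
  assume *: "\<forall>y\<in>U. \<exists>N. agree N y \<subseteq> U"
  show "openin sequences U"
  proof (rule iffD2[OF openin_subopen], rule ballI)
    fix y assume "y \<in> U"
    then obtain N where "agree N y \<subseteq> U" using * by blast
    with openin_sequences_prefix[of N y] self_agree[of y N]
    have "openin sequences (agree N y) \<and> y \<in> agree N y \<and> agree N y \<subseteq> U" by (intro conjI)
    then show "\<exists>T. openin sequences T \<and> y \<in> T \<and> T \<subseteq> U" by (rule exI)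
  qed
qed

lemma agree_iff: "y' \<in> agree N y \<longleftrightarrow> word_fls y' - word_fls y \<in> small (int N)"
proof
  assume small: "word_fls y' - word_fls y \<in> small (int N)"
  have *: "(word_fls y' - word_fls y) $$ int i = 0" if "i < N" for i
  proof -
    have "int i < int N" using that by simp
    then show ?thesis using small unfolding small_def by blast
  qed
  show "y' \<in> agree N y" using * by (simp add: agree_def)
qed (auto simp: small_def agree_def)

text \<open>With \<open>openin_germ_topologyI\<close>, this shows that the germ topology is
  generated by common small displacements of both ends of an arrow.\<close>

lemma openin_germ_topologyD:
  assumes "openin germ_topology W" "edge p p'" "arrow p p' \<in> W"
  shows "\<exists>M. \<forall>\<epsilon>\<in>small M. arrow (move \<epsilon> p) (move \<epsilon> p') \<in> W"
proof -
  have "generate_topology_on {germ \<alpha> ` U | \<alpha> U. \<alpha> \<in> triples \<and> U \<subseteq> triple_dom \<alpha> \<and> openin sequences U} W"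
    using assms(1) unfolding germ_topology_def openin_topology_generated_by_iff .
  then show ?thesis
    using assms(3)
  proof induction
    case (Int A B)
    then obtain M M' where "\<forall>\<epsilon>\<in>small M. arrow (move \<epsilon> p) (move \<epsilon> p') \<in> A"
      "\<forall>\<epsilon>\<in>small M'. arrow (move \<epsilon> p) (move \<epsilon> p') \<in> B" by blast
    then have "\<forall>\<epsilon>\<in>small (max M M'). arrow (move \<epsilon> p) (move \<epsilon> p') \<in> A \<inter> B"
      using small_mono[of M "max M M'"] small_mono[of M' "max M M'"] by auto
    then show ?case by blast
  next
    case (UN K)
    then show ?case by blast
  next
    case (Basis V)
    then obtain \<alpha> U where V: "V = germ \<alpha> ` U" "U \<subseteq> triple_dom \<alpha>" "openin sequences U" by blast
    then obtain y where y: "y \<in> U" "arrow p p' = germ \<alpha> y" using Basis.prems by blast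
    obtain \<beta> where \<beta>: "represents \<beta> p p'" using represents_exists[OF assms(2)] by blast
    have "germ \<beta> (word_of p') = germ \<alpha> y" using y(2) arrow_eq_germ[OF \<beta>] by simp
    then have eq: "word_of p' = y" "triple_act \<beta> (word_of p') = triple_act \<alpha> y" "deg \<beta> = deg \<alpha>"
      using germ_eq_iff[of "word_of p'" \<beta> y \<alpha>] \<beta> y(1) V(2) by (auto simp: represents_def)
    then have \<alpha>: "represents \<alpha> p p'" using \<beta> y(1) V(2) by (auto simp: represents_def)
    obtain N where N: "agree N y \<subseteq> U" using V(3) y(1) openin_sequences_iff by blast
    \<comment> \<open>Displacements must respect both levels and must leave the first
      \<open>N\<close> letters of the source sequence unchanged; dividing by the scale costs the
      level of \<open>p'\<close>.\<close>
    define M where "M = max (max (fst (fst p)) (fst (fst p'))) (int N + fst (fst p'))"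
    have "arrow (move \<epsilon> p) (move \<epsilon> p') \<in> V" if e: "\<epsilon> \<in> small M" for \<epsilon>
    proof -
      have edge: "edge (move \<epsilon> p) (move \<epsilon> p')"
        by (rule edge_move[OF assms(2) _ _ e]) (simp_all add: M_def)
      have "\<epsilon> \<in> small (int N + fst (fst p'))" by (rule small_mono[OF _ e]) (simp add: M_def)
      then have "scale (- fst p') * \<epsilon> \<in> small (int N)" by (simp add: scale_small_iff)
      then have "word_fls (word_of (move \<epsilon> p')) - word_fls y \<in> small (int N)"
        using word_of_move[of p' \<epsilon>] edge assms(2) eq(1) by (simp add: edge_def)
      then have "word_of (move \<epsilon> p') \<in> U" using N agree_iff by blast
      then show ?thesis
        using arrow_eq_germ[OF represents_move[OF assms(2) edge \<alpha>]] V(1,2) by blast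
    qed
    then show ?case by blast
  qed blast
qed

lemma openin_germ_topologyI:
  assumes "\<And>\<gamma>. \<gamma> \<in> W \<Longrightarrow> \<exists>p p' M. edge p p' \<and> \<gamma> = arrow p p' \<and>
    (\<forall>\<epsilon>\<in>small M. arrow (move \<epsilon> p) (move \<epsilon> p') \<in> W)"
  shows "openin germ_topology W"
proof (rule iffD2[OF openin_subopen], rule ballI)
  fix \<gamma> assume "\<gamma> \<in> W"
  then obtain p p' M where pp: "edge p p'" "\<gamma> = arrow p p'"
    and M: "\<And>\<epsilon>. \<epsilon> \<in> small M \<Longrightarrow> arrow (move \<epsilon> p) (move \<epsilon> p') \<in> W"
    using assms[OF \<open>\<gamma> \<in> W\<close>] by blast
  obtain \<alpha> where \<alpha>: "represents \<alpha> p p'" using represents_exists[OF pp(1)] by blast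
  then obtain l g q w where q: "\<alpha> = Some (l, g, q)" "word_of p' = q \<frown> w"
    by (cases \<alpha>) (auto simp: represents_def cylinder_iff)
  \<comment> \<open>Agreement on \<open>N\<close> letters keeps the sequence in the domain of
    \<open>\<alpha>\<close> and yields a displacement that is in \<open>small M\<close> and respects
    the level of \<open>p\<close>.\<close>
  define N where "N = max (length q) (nat (max (M - fst (fst p')) (fst (fst p) - fst (fst p'))))"
  have N: "length q \<le> N" "M \<le> int N + fst (fst p')" "fst (fst p) \<le> int N + fst (fst p')"
    by (auto simp: N_def)
  define U where "U = agree N (word_of p')"
  have U_dom: "U \<subseteq> triple_dom \<alpha>"
  proof
    fix y' assume "y' \<in> U"
    then have y': "y' i = word_of p' i" if "i < N" for i using that by (simp add: U_def agree_def)
    have "y' = q \<frown> Omega_Words_Fun.suffix (length q) y'"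
    proof
      show "y' i = (q \<frown> Omega_Words_Fun.suffix (length q) y') i" for i
        using y'[of i] N(1) q(2) by (cases "i < length q") (simp_all add: conc_def Omega_Words_Fun.suffix_def)
    qed
    then show "y' \<in> triple_dom \<alpha>" unfolding q(1) triple_dom.simps cylinder_iff by blast
  qed
  have "openin sequences U" unfolding U_def by (rule openin_sequences_prefix)
  then have "germ \<alpha> ` U \<in> {germ \<alpha> ` U | \<alpha> U. \<alpha> \<in> triples \<and> U \<subseteq> triple_dom \<alpha> \<and> openin sequences U}"
    using U_dom unfolding triples_UNIV by blast
  then have "openin germ_topology (germ \<alpha> ` U)"
    unfolding germ_topology_def openin_topology_generated_by_iff by (rule generate_topology_on.Basis)
  moreover have "\<gamma> \<in> germ \<alpha> ` U"
    unfolding pp(2) arrow_eq_germ[OF \<alpha>] U_def by (rule imageI[OF self_agree])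
  moreover have "germ \<alpha> ` U \<subseteq> W"
  proof
    fix \<delta> assume "\<delta> \<in> germ \<alpha> ` U"
    then obtain y' where y': "y' \<in> U" "\<delta> = germ \<alpha> y'" by blast
    have pts: "is_point p" "is_point p'" using pp(1) by (simp_all add: edge_def)
    define \<epsilon> where "\<epsilon> = scale (fst p') * (word_fls y' - word_fls (word_of p'))"
    have "word_fls y' - word_fls (word_of p') \<in> small (int N)"
      using y'(1) agree_iff[of y' N "word_of p'"] by (simp add: U_def)
    then have e: "\<epsilon> \<in> small (int N + fst (fst p'))" unfolding \<epsilon>_def by (rule scale_small)
    have edge: "edge (move \<epsilon> p) (move \<epsilon> p')"
      by (rule edge_move[OF pp(1) _ _ e]) (use N in simp_all)
    have "scale (- fst p') * \<epsilon> = word_fls y' - word_fls (word_of p')"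
      unfolding \<epsilon>_def scale_cancel ..
    then have "word_fls (word_of (move \<epsilon> p')) = word_fls y'"
      using word_of_move[OF pts(2)] edge by (simp add: edge_def)
    then have w: "word_of (move \<epsilon> p') = y'" by (simp only: word_fls_inject)
    then have "word_of (move \<epsilon> p') \<in> triple_dom \<alpha>" using y'(1) U_dom by blast
    from arrow_eq_germ[OF represents_move[OF pp(1) edge \<alpha> this]]
    have "\<delta> = arrow (move \<epsilon> p) (move \<epsilon> p')" unfolding w y'(2) by simp
    then show "\<delta> \<in> W" using M[OF small_mono[OF N(2) e]] by simp
  qed
  ultimately show "\<exists>T. openin germ_topology T \<and> \<gamma> \<in> T \<and> T \<subseteq> W" by blast
qed

lemma topspace_germ_topology: "\<gamma> \<in> topspace germ_topology \<longleftrightarrow> (\<exists>p p'. edge p p' \<and> \<gamma> = arrow p p')"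
proof
  assume "\<gamma> \<in> topspace germ_topology"
  then have "\<gamma> \<in> \<Union> {germ \<alpha> ` U | \<alpha> U. \<alpha> \<in> triples \<and> U \<subseteq> triple_dom \<alpha> \<and> openin sequences U}"
    unfolding germ_topology_def topology_generated_by_topspace .
  then obtain \<alpha> y where "y \<in> triple_dom \<alpha>" "\<gamma> = germ \<alpha> y" by blast
  then show "\<exists>p p'. edge p p' \<and> \<gamma> = arrow p p'" using germ_is_arrow by metis
next
  assume "\<exists>p p'. edge p p' \<and> \<gamma> = arrow p p'"
  then obtain p p' where pp: "edge p p'" "\<gamma> = arrow p p'" by blast
  define M where "M = max (fst (fst p)) (fst (fst p'))"
  have edge: "edge (move \<epsilon> p) (move \<epsilon> p')" if "\<epsilon> \<in> small M" for \<epsilon>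
    by (rule edge_move[OF pp(1) _ _ that]) (simp_all add: M_def)
  have "openin germ_topology {arrow t t' | t t'. edge t t'}"
  proof (rule openin_germ_topologyI)
    fix \<delta> assume "\<delta> \<in> {arrow t t' | t t'. edge t t'}"
    then obtain t t' where t: "edge t t'" "\<delta> = arrow t t'" by blast
    have "edge (move \<epsilon> t) (move \<epsilon> t')" if "\<epsilon> \<in> small (max (fst (fst t)) (fst (fst t')))" for \<epsilon>
      by (rule edge_move[OF t(1) _ _ that]) simp_all
    then show "\<exists>p p' M. edge p p' \<and> \<delta> = arrow p p' \<and>
        (\<forall>\<epsilon>\<in>small M. arrow (move \<epsilon> p) (move \<epsilon> p') \<in> {arrow t t' | t t'. edge t t'})"
      using t by blast
  qed
  from openin_subset[OF this] show "\<gamma> \<in> topspace germ_topology" using pp by blast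
qed

end

context skipper_steinberg
begin

abbreviation "\<G> \<equiv> action_groupoid"

definition idx :: "nat \<Rightarrow> nat set" where
  "idx n = (if n = 0 then {0} else {1..n})"

text \<open>In degree \<open>0\<close> the only index is \<open>i = 0\<close>, where \<open>i - 1 = i\<close> and the arrow is a unit.\<close>

definition tuple :: "nat \<Rightarrow> 'r simplex \<Rightarrow> nat \<Rightarrow> (('r list \<times> ((int \<Rightarrow>\<^sub>0 'r) \<times> int) \<times> 'r list) option \<times> 'r word) set" where
  "tuple n s = (\<lambda>i\<in>idx n. arrow (s ! (i - 1)) (s ! i))"

text \<open>Level zero at the first vertex fixes the shift, so each composable tuple has exactly one
  such simplex.\<close>

definition nsimplices :: "nat \<Rightarrow> 'r simplex set" where
  "nsimplices n = {s. simplex s \<and> length s = Suc n \<and> fst (hd s) = 0}"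

definition composable :: "nat \<Rightarrow> (nat \<Rightarrow> (('r list \<times> ((int \<Rightarrow>\<^sub>0 'r) \<times> int) \<times> 'r list) option \<times> 'r word) set) set" where
  "composable n = (if n = 0 then {u. u 0 \<in> unit_arrows \<G>}
     else {g. \<forall>i\<in>{1..<n}. src \<G> (g i) = tgt \<G> (g (Suc i))})"

lemma nerve_eq: "nerve \<G> n = subtopology (product_topology (\<lambda>_. germ_topology) (idx n)) (composable n)"
  by (simp add: nerve_def idx_def composable_def arrow_space_eq)

lemma topspace_nerve: "topspace (nerve \<G> n) = (\<Pi>\<^sub>E i\<in>idx n. topspace germ_topology) \<inter> composable n"
  by (simp add: nerve_eq)

lemma topspace_germ_topologyE:
  assumes "\<gamma> \<in> topspace germ_topology" obtains p p' where "edge p p'" "\<gamma> = arrow p p'"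
  using assms that unfolding topspace_germ_topology by blast

lemma finite_idx [simp]: "finite (idx n)"
  by (simp add: idx_def)

lemma idx_less: "i \<in> idx n \<Longrightarrow> i < Suc n" "i \<in> idx n \<Longrightarrow> i - 1 < Suc n"
  by (auto simp: idx_def split: if_splits)

lemma simplex_point: "simplex s \<Longrightarrow> i < length s \<Longrightarrow> is_point (s ! i)"
  by (simp add: simplex_def is_point_def)

lemma simplex_edge: "simplex s \<Longrightarrow> i < length s \<Longrightarrow> j < length s \<Longrightarrow> edge (s ! i) (s ! j)"
  by (simp add: edge_def simplex_point) (simp add: simplex_def)

lemma nth_translate_move: "i < length s \<Longrightarrow> translate \<epsilon> s ! i = move \<epsilon> (s ! i)"
  by (simp add: nth_translate move_def)

lemma fine_nth: "fine s M \<Longrightarrow> i < length s \<Longrightarrow> fst (fst (s ! i)) \<le> M"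
  by (simp add: fine_def)

lemma tuple_in_topspace:
  assumes "simplex s" "length s = Suc n" shows "tuple n s \<in> topspace (nerve \<G> n)"
proof -
  have edge: "edge (s ! i) (s ! j)" if "i < Suc n" "j < Suc n" for i j
    using simplex_edge[OF assms(1)] assms(2) that by simp
  have "arrow (s ! (i - 1)) (s ! i) \<in> topspace germ_topology" if "i \<in> idx n" for i
    using edge[OF idx_less(2,1)[OF that]] topspace_germ_topology by blast
  then have "tuple n s \<in> (\<Pi>\<^sub>E i\<in>idx n. topspace germ_topology)" by (auto simp: tuple_def)
  moreover have "tuple n s \<in> composable n"
  proof (cases "n = 0")
    case True
    let ?p = "s ! 0"
    have "is_point ?p" using simplex_point[OF assms(1), of 0] assms(2) by simp
    then have "arrow ?p ?p = src \<G> (arrow ?p ?p)" using src_arrow[OF edge_refl] unit_germ_arrow by simp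
    moreover have "arrow ?p ?p \<in> topspace germ_topology" using edge_refl[OF \<open>is_point ?p\<close>] topspace_germ_topology by blast
    ultimately have "arrow ?p ?p \<in> unit_arrows \<G>" unfolding unit_arrows_def arrow_space_eq by blast
    then show ?thesis using True by (simp add: composable_def tuple_def idx_def)
  next
    case False
    have "src \<G> (tuple n s i) = tgt \<G> (tuple n s (Suc i))" if "i \<in> {1..<n}" for i
    proof -
      have idx: "i \<in> idx n" "Suc i \<in> idx n" using that False by (auto simp: idx_def)
      have "src \<G> (arrow (s ! (i - 1)) (s ! i)) = unit_germ (word_of (s ! i))"
        by (rule src_arrow[OF edge]) (use idx_less[OF idx(1)] in auto)
      moreover have "tgt \<G> (arrow (s ! i) (s ! Suc i)) = unit_germ (word_of (s ! i))"
        by (rule tgt_arrow[OF edge]) (use idx_less[OF idx(2)] in auto)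
      ultimately show ?thesis using idx by (simp add: tuple_def)
    qed
    then show ?thesis using False by (simp add: composable_def)
  qed
  ultimately show ?thesis unfolding topspace_nerve by blast
qed

text \<open>The simplex grows from its first vertex, placed at level zero over the range of the
  first arrow; each further arrow determines the next vertex.\<close>

lemma tuple_surj:
  assumes "g \<in> topspace (nerve \<G> n)" shows "\<exists>s\<in>nsimplices n. g = tuple n s"
proof (cases "n = 0")
  case True
  have g: "g \<in> (\<Pi>\<^sub>E i\<in>{0}. topspace germ_topology)" "g 0 \<in> unit_arrows \<G>"
    using assms True by (auto simp: topspace_nerve idx_def composable_def)
  obtain \<gamma> where \<gamma>: "\<gamma> \<in> topspace germ_topology" "g 0 = src \<G> \<gamma>"
    using g(2) unfolding unit_arrows_def arrow_space_eq by blast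
  obtain p p' where pp: "edge p p'" "\<gamma> = arrow p p'"
    using topspace_germ_topologyE[OF \<gamma>(1)] .
  let ?p = "(0, scale 0 * word_fls (word_of p'))"
  note pt = point_of_word[of 0 "word_of p'"]
  have "g 0 = arrow ?p ?p"
    unfolding \<gamma>(2) pp(2) src_arrow[OF pp(1)] using unit_germ_arrow[OF pt(1)] unfolding pt(2) .
  moreover have "g i = undefined" if "i \<noteq> 0" for i using g(1) that by (auto simp: PiE_def extensional_def)
  ultimately have "g = tuple n [?p]" using True by (auto simp: fun_eq_iff tuple_def idx_def)
  moreover have "[?p] \<in> nsimplices n"
    using pt(1) True unfolding nsimplices_def simplex_def is_point_def by simp
  ultimately show ?thesis by blast
next
  case False
  have gE: "g \<in> (\<Pi>\<^sub>E i\<in>{1..n}. topspace germ_topology)"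
    and comp: "\<And>i. i \<in> {1..<n} \<Longrightarrow> src \<G> (g i) = tgt \<G> (g (Suc i))"
    using assms False by (auto simp: topspace_nerve idx_def composable_def)
  have "\<exists>s. simplex s \<and> length s = Suc k \<and> fst (hd s) = 0 \<and> (\<forall>i\<in>{1..k}. g i = arrow (s ! (i - 1)) (s ! i)) \<and>
      tgt \<G> (g 1) = unit_germ (word_of (hd s))" if "k \<le> n" for k
    using that
  proof (induction k)
    case 0
    have "g 1 \<in> topspace germ_topology" using gE False by auto
    then obtain p p' where pp: "edge p p'" "g 1 = arrow p p'" by (rule topspace_germ_topologyE)
    note pt = point_of_word[of 0 "word_of p"]
    show ?case
    proof (intro exI conjI)
      show "simplex [(0, scale 0 * word_fls (word_of p))]"
        using pt(1) unfolding simplex_def is_point_def by simp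
      show "tgt \<G> (g 1) = unit_germ (word_of (hd [(0, scale 0 * word_fls (word_of p))]))"
        unfolding pp(2) tgt_arrow[OF pp(1)] list.sel(1) pt(2) ..
    qed simp_all
  next
    case (Suc k)
    then obtain s where s: "simplex s" "length s = Suc k" "fst (hd s) = 0"
      "\<And>i. i \<in> {1..k} \<Longrightarrow> g i = arrow (s ! (i - 1)) (s ! i)" "tgt \<G> (g 1) = unit_germ (word_of (hd s))"
      by auto
    have "g (Suc k) \<in> topspace germ_topology" using gE Suc.prems by auto
    then obtain p p' where pp: "edge p p'" "g (Suc k) = arrow p p'" by (rule topspace_germ_topologyE)
    obtain \<alpha> where \<alpha>: "represents \<alpha> p p'" using represents_exists[OF pp(1)] by blast
    let ?l = "s ! k"
    have l: "is_point ?l" using simplex_point[OF s(1), of k] s(2) by simp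
    have "tgt \<G> (g (Suc k)) = unit_germ (word_of ?l)"
    proof (cases "k = 0")
      case True
      have "hd s = s ! 0" using s(2) by (intro hd_conv_nth) auto
      then show ?thesis using s(5) True by simp
    next
      case False
      then have "tgt \<G> (g (Suc k)) = src \<G> (g k)" using comp[of k] Suc.prems by simp
      also have "\<dots> = unit_germ (word_of ?l)"
        using s(4)[of k] src_arrow[OF simplex_edge[OF s(1)], of "k - 1" k] s(2) False by simp
      finally show ?thesis .
    qed
    then have w: "word_of ?l = word_of p" using tgt_arrow[OF pp(1)] pp(2) by (simp add: unit_germ_eq_iff)
    have "word_of p' \<in> triple_dom \<alpha>" "word_of ?l = triple_act \<alpha> (word_of p')"
      using \<alpha> by (simp_all add: represents_def w)
    then obtain q where q: "edge ?l q" "represents \<alpha> ?l q" "word_of q = word_of p'"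
      using represents_source[OF _ l] by metis
    have g: "g (Suc k) = arrow ?l q"
      unfolding pp(2) arrow_eq_germ[OF \<alpha>] arrow_eq_germ[OF q(2)] q(3) ..
    have diff: "snd x - snd q \<in> transl" "snd q - snd x \<in> transl" if x: "x \<in> set s" for x
    proof -
      have "?l \<in> set s" using s(2) by simp
      then have "snd x - snd ?l \<in> transl" using s(1) x by (simp add: simplex_def)
      moreover have "snd ?l - snd q \<in> transl" using q(1) by (simp add: edge_def)
      ultimately show "snd x - snd q \<in> transl" using transl_add by force
      then show "snd q - snd x \<in> transl" using transl_uminus by force
    qed
    have "is_point q" using q(1) by (simp add: edge_def)
    then have "simplex (s @ [q])" using s(1) diff by (auto simp: simplex_def is_point_def)
    moreover have "g i = arrow ((s @ [q]) ! (i - 1)) ((s @ [q]) ! i)" if "i \<in> {1..Suc k}" for i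
    proof (cases "i = Suc k")
      case True
      then show ?thesis using g s(2) by (simp add: nth_append)
    next
      case False
      then have i: "i \<in> {1..k}" using that by auto
      then have "i - 1 < length s" "i < length s" using s(2) by auto
      then show ?thesis using s(4)[OF i] by (simp only: nth_append if_True)
    qed
    moreover have "hd (s @ [q]) = hd s" using s(2) by (cases s) auto
    ultimately show ?case using s(2,3,5) by (intro exI[of _ "s @ [q]"]) simp
  qed
  from this[OF order_refl] obtain s where s: "simplex s" "length s = Suc n" "fst (hd s) = 0"
    "\<forall>i\<in>{1..n}. g i = arrow (s ! (i - 1)) (s ! i)" by blast
  have "g = tuple n s"
  proof
    show "g i = tuple n s i" for i
      using s(4) gE False by (cases "i \<in> {1..n}") (auto simp: tuple_def idx_def PiE_def extensional_def)
  qed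
  then show ?thesis using s by (auto simp: nsimplices_def)
qed

text \<open>Arrows give the sequences of the vertices and the differences of their levels; the level
  of the first vertex is fixed.\<close>

lemma tuple_inj: "inj_on (tuple n) (nsimplices n)"
proof (rule inj_onI)
  fix s t assume st: "s \<in> nsimplices n" "t \<in> nsimplices n" and eq: "tuple n s = tuple n t"
  have s: "simplex s" "length s = Suc n" "fst (s ! 0) = 0" and t: "simplex t" "length t = Suc n" "fst (t ! 0) = 0"
    using st by (auto simp: nsimplices_def hd_conv_nth simplex_def)
  have arr: "arrow (s ! (i - 1)) (s ! i) = arrow (t ! (i - 1)) (t ! i)" if "i \<in> idx n" for i
    using fun_cong[OF eq, of i] that by (simp add: tuple_def)
  have coords: "word_of (s ! (i - 1)) = word_of (t ! (i - 1)) \<and> word_of (s ! i) = word_of (t ! i) \<and>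
      fst (s ! i) - fst (s ! (i - 1)) = fst (t ! i) - fst (t ! (i - 1))" if "i \<in> idx n" for i
  proof -
    have "i - 1 < length s" "i < length s" "i - 1 < length t" "i < length t"
      using idx_less[OF that] s(2) t(2) by simp_all
    then show ?thesis using arr[OF that] simplex_edge[OF s(1)] simplex_edge[OF t(1)] by (subst (asm) arrow_eq_iff) auto
  qed
  have "s ! i = t ! i" if "i \<le> n" for i
    using that
  proof (induction i)
    case 0
    have "word_of (s ! 0) = word_of (t ! 0)"
      using coords[of 0] coords[of 1] by (cases "n = 0") (auto simp: idx_def)
    then show ?case using s t by (intro point_eqI simplex_point) simp_all
  next
    case (Suc i)
    then have "Suc i \<in> idx n" by (simp add: idx_def)
    from coords[OF this] have "word_of (s ! Suc i) = word_of (t ! Suc i)" "fst (s ! Suc i) = fst (t ! Suc i)"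
      using Suc by auto
    then show ?case using s t Suc.prems by (intro point_eqI simplex_point) simp_all
  qed
  then show "s = t" using s(2) t(2) by (intro nth_equalityI) auto
qed

lemma tuple_shift:
  assumes "simplex s" "length s = Suc n" shows "tuple n (shift u s) = tuple n s"
proof
  fix i
  show "tuple n (shift u s) i = tuple n s i"
  proof (cases "i \<in> idx n")
    case True
    then have i: "i - 1 < length s" "i < length s" using idx_less[OF True] assms(2) by simp_all
    then have "edge (shift u s ! (i - 1)) (shift u s ! i)" "edge (s ! (i - 1)) (s ! i)"
      using simplex_edge[OF simplex_shift[OF assms(1)]] simplex_edge[OF assms(1)] by simp_all
    then have "arrow (shift u s ! (i - 1)) (shift u s ! i) = arrow (s ! (i - 1)) (s ! i)"
      using i word_of_shift by (subst arrow_eq_iff) (simp_all add: nth_shift)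
    then show ?thesis using True by (simp add: tuple_def)
  qed (simp add: tuple_def)
qed

lemma tuple_normalise:
  "simplex s \<Longrightarrow> length s = Suc n \<Longrightarrow> tuple n (normalise \<kappa> s) = tuple n s"
  unfolding normalise_def by (rule tuple_shift)

lemma nbhd_nsimplices: "s \<in> nsimplices n \<Longrightarrow> fine s M \<Longrightarrow> nbhd s M \<subseteq> nsimplices n"
proof
  fix t assume s: "s \<in> nsimplices n" "fine s M" and "t \<in> nbhd s M"
  then obtain \<epsilon> where e: "\<epsilon> \<in> small M" "t = translate \<epsilon> s" by (auto simp: nbhd_def)
  have "s \<noteq> []" using s(1) by (auto simp: nsimplices_def)
  then show "t \<in> nsimplices n"
    using s(1) simplex_translate[OF _ s(2) e(1)] by (simp add: nsimplices_def e(2) hd_translate)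
qed

lemma openin_nerveD:
  assumes "openin (nerve \<G> n) W" "simplex s" "length s = Suc n" "tuple n s \<in> W"
  shows "\<exists>M. fine s M \<and> tuple n ` nbhd s M \<subseteq> W"
proof -
  obtain T where T: "openin (product_topology (\<lambda>_. germ_topology) (idx n)) T" "W = T \<inter> composable n"
    using assms(1) unfolding nerve_eq openin_subtopology by blast
  have "tuple n s \<in> T" using assms(4) T(2) by blast
  from product_topology_open_contains_basis[OF T(1) this]
  obtain X where X: "tuple n s \<in> (\<Pi>\<^sub>E i\<in>idx n. X i)" "\<And>i. openin germ_topology (X i)" "(\<Pi>\<^sub>E i\<in>idx n. X i) \<subseteq> T"
    by blast
  have "\<exists>M. \<forall>\<epsilon>\<in>small M. arrow (move \<epsilon> (s ! (i - 1))) (move \<epsilon> (s ! i)) \<in> X i" if i: "i \<in> idx n" for i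
  proof (rule openin_germ_topologyD[OF X(2)])
    show "edge (s ! (i - 1)) (s ! i)" using simplex_edge[OF assms(2)] idx_less[OF i] assms(3) by simp
    show "arrow (s ! (i - 1)) (s ! i) \<in> X i" using PiE_mem[OF X(1) i] i by (simp add: tuple_def)
  qed
  then obtain m where m: "\<And>i \<epsilon>. i \<in> idx n \<Longrightarrow> \<epsilon> \<in> small (m i) \<Longrightarrow> arrow (move \<epsilon> (s ! (i - 1))) (move \<epsilon> (s ! i)) \<in> X i"
    by metis
  obtain M0 where M0: "fine s M0" using fine_exists by blast
  define M where "M = Max (insert M0 (m ` idx n))"
  have M: "M0 \<le> M" "i \<in> idx n \<Longrightarrow> m i \<le> M" for i by (auto simp: M_def intro!: Max_ge)
  have fine: "fine s M" by (rule fine_mono[OF M0 M(1)])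
  have "tuple n (translate \<epsilon> s) \<in> W" if e: "\<epsilon> \<in> small M" for \<epsilon>
  proof -
    have "tuple n (translate \<epsilon> s) i \<in> X i" if i: "i \<in> idx n" for i
      using m[OF i small_mono[OF M(2)[OF i] e]] i idx_less[OF i] assms(3)
      by (simp add: tuple_def nth_translate_move)
    then have "tuple n (translate \<epsilon> s) \<in> (\<Pi>\<^sub>E i\<in>idx n. X i)" by (auto simp: tuple_def)
    moreover have "tuple n (translate \<epsilon> s) \<in> composable n"
      using tuple_in_topspace[OF simplex_translate[OF assms(2) fine e]] assms(3) unfolding topspace_nerve by simp
    ultimately show ?thesis using X(3) T(2) by blast
  qed
  then show ?thesis using fine unfolding nbhd_def by blast
qed

text \<open>The image is an open box cut down to composable tuples. In the box each arrow is
  displaced independently, and composability forces the displacements to coincide.\<close>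

lemma openin_tuple_nbhd:
  assumes s: "simplex s" "length s = Suc n" and fine: "fine s M"
  shows "openin (nerve \<G> n) (tuple n ` nbhd s M)"
proof -
  define Z where "Z i = (\<lambda>\<epsilon>. arrow (move \<epsilon> (s ! (i - 1))) (move \<epsilon> (s ! i))) ` small M" for i
  have edge: "edge (move \<epsilon> (s ! i)) (move \<epsilon> (s ! j))" if "i < Suc n" "j < Suc n" "\<epsilon> \<in> small M" for i j \<epsilon>
    using edge_move[OF simplex_edge[OF s(1)] _ _ that(3)] fine_nth[OF fine] that s(2) by simp
  have Z: "openin germ_topology (Z i)" if i: "i \<in> idx n" for i
  proof (rule openin_germ_topologyI)
    fix \<gamma> assume "\<gamma> \<in> Z i"
    then obtain \<epsilon> where e: "\<epsilon> \<in> small M" "\<gamma> = arrow (move \<epsilon> (s ! (i - 1))) (move \<epsilon> (s ! i))"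
      by (auto simp: Z_def)
    have "arrow (move \<delta> (move \<epsilon> (s ! (i - 1)))) (move \<delta> (move \<epsilon> (s ! i))) \<in> Z i" if "\<delta> \<in> small M" for \<delta>
    proof -
      have "move \<delta> (move \<epsilon> p) = move (\<epsilon> + \<delta>) p" for p by (simp add: move_def add.assoc)
      then show ?thesis unfolding Z_def using small_add[OF e(1) that] by simp
    qed
    then show "\<exists>p p' M. edge p p' \<and> \<gamma> = arrow p p' \<and> (\<forall>\<epsilon>\<in>small M. arrow (move \<epsilon> p) (move \<epsilon> p') \<in> Z i)"
      using e edge[OF idx_less(2,1)[OF i] e(1)] by blast
  qed
  have "tuple n ` nbhd s M = (\<Pi>\<^sub>E i\<in>idx n. Z i) \<inter> composable n"
  proof (intro equalityI subsetI)
    fix g assume "g \<in> tuple n ` nbhd s M"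
    then obtain \<epsilon> where e: "\<epsilon> \<in> small M" "g = tuple n (translate \<epsilon> s)" by (auto simp: nbhd_def)
    have "g i \<in> Z i" if i: "i \<in> idx n" for i
      using e(1) i idx_less[OF i] s(2) unfolding e(2) Z_def by (simp add: tuple_def nth_translate_move)
    moreover have "g \<in> composable n"
      using tuple_in_topspace[OF simplex_translate[OF s(1) fine e(1)]] s(2) unfolding topspace_nerve e(2) by simp
    ultimately show "g \<in> (\<Pi>\<^sub>E i\<in>idx n. Z i) \<inter> composable n" unfolding e(2) by (auto simp: tuple_def)
  next
    fix g assume g: "g \<in> (\<Pi>\<^sub>E i\<in>idx n. Z i) \<inter> composable n"
    then have "\<forall>i\<in>idx n. \<exists>\<epsilon>. \<epsilon> \<in> small M \<and> g i = arrow (move \<epsilon> (s ! (i - 1))) (move \<epsilon> (s ! i))"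
      by (fastforce simp: Z_def)
    then obtain e where e: "\<And>i. i \<in> idx n \<Longrightarrow> e i \<in> small M"
      "\<And>i. i \<in> idx n \<Longrightarrow> g i = arrow (move (e i) (s ! (i - 1))) (move (e i) (s ! i))" by metis
    \<comment> \<open>The common vertex of two consecutive arrows is displaced by both; equal
      sequences at equal level mean equal displacements.\<close>
    have step: "e (Suc i) = e i" if i: "i \<in> {1..<n}" for i
    proof -
      have idx: "i \<in> idx n" "Suc i \<in> idx n" using i by (auto simp: idx_def)
      have "src \<G> (g i) = tgt \<G> (g (Suc i))" using g i by (auto simp: composable_def)
      then have "unit_germ (word_of (move (e i) (s ! i))) = unit_germ (word_of (move (e (Suc i)) (s ! i)))"
        unfolding e(2)[OF idx(1)] e(2)[OF idx(2)]
        using src_arrow[OF edge[OF idx_less(2,1)[OF idx(1)] e(1)[OF idx(1)]]]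
          tgt_arrow[OF edge[OF idx_less(2,1)[OF idx(2)] e(1)[OF idx(2)]]] by simp
      then have "move (e i) (s ! i) = move (e (Suc i)) (s ! i)"
        using edge[OF idx_less(1)[OF idx(1)] idx_less(1)[OF idx(1)]] e(1)[OF idx(1)] e(1)[OF idx(2)]
        by (intro point_eqI) (auto simp: unit_germ_eq_iff edge_def move_def)
      then show ?thesis by (simp add: move_def)
    qed
    define k where "k = Min (idx n)"
    have k: "k = (if n = 0 then 0 else 1)" by (auto simp: k_def idx_def intro!: Min_eqI)
    have const: "e i = e k" if "i \<in> idx n" for i
    proof (cases "n = 0")
      case True
      then show ?thesis using that k by (simp add: idx_def)
    next
      case False
      then have "1 \<le> i" "i \<le> n" using that by (auto simp: idx_def)
      then have "e i = e 1"
      proof (induction i rule: dec_induct)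
        case (step j)
        then show ?case using \<open>\<And>i. i \<in> {1..<n} \<Longrightarrow> e (Suc i) = e i\<close>[of j] by simp
      qed simp
      then show ?thesis using k False by simp
    qed
    have k_idx: "k \<in> idx n" by (simp add: k idx_def)
    have "g = tuple n (translate (e k) s)"
    proof
      fix i
      show "g i = tuple n (translate (e k) s) i"
      proof (cases "i \<in> idx n")
        case True
        then show ?thesis using e(2)[OF True] const[OF True] idx_less[OF True] s(2)
          by (simp add: tuple_def nth_translate_move)
      next
        case False
        then show ?thesis using g by (auto simp: tuple_def PiE_def extensional_def)
      qed
    qed
    then show "g \<in> tuple n ` nbhd s M" using e(1)[OF k_idx] by (auto simp: nbhd_def)
  qed
  moreover have "openin (product_topology (\<lambda>_. germ_topology) (idx n)) (\<Pi>\<^sub>E i\<in>idx n. Z i)"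
    using Z by (simp add: openin_PiE)
  ultimately show ?thesis unfolding nerve_eq openin_subtopology by blast
qed

text \<open>A ball is the continuous image of the compact space of sequences, with y acting as the
  displacement x^M y.\<close>

lemma compactin_tuple_nbhd:
  assumes s: "simplex s" "length s = Suc n" and fine: "fine s M"
  shows "compactin (nerve \<G> n) (tuple n ` nbhd s M)"
proof -
  define e where "e y = fls_shift (- M) (word_fls y)" for y
  have e: "e y \<in> small M" for y by (simp add: e_def small_def)
  define f where "f y = tuple n (translate (e y) s)" for y
  have "continuous_map sequences (nerve \<G> n) f"
    unfolding continuous_map_def
  proof (intro conjI allI impI)
    show "f \<in> topspace sequences \<rightarrow> topspace (nerve \<G> n)"
      using tuple_in_topspace[OF simplex_translate[OF s(1) fine e]] s(2) by (auto simp: f_def)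
    fix U assume U: "openin (nerve \<G> n) U"
    show "openin sequences {y \<in> topspace sequences. f y \<in> U}"
      unfolding openin_sequences_iff
    proof (rule ballI)
      fix y assume "y \<in> {y \<in> topspace sequences. f y \<in> U}"
      then have y: "tuple n (translate (e y) s) \<in> U" by (simp add: f_def)
      obtain M' where M': "tuple n ` nbhd (translate (e y) s) M' \<subseteq> U"
        using openin_nerveD[OF U simplex_translate[OF s(1) fine e] _ y] s(2) by auto
      have "f y' \<in> U" if y': "y' \<in> agree (nat (M' - M)) y" for y'
      proof -
        have "word_fls y' - word_fls y \<in> small (M' - M)"
          by (rule small_mono[OF _ y'[unfolded agree_iff]]) simp
        moreover have "fls_shift (- M) d \<in> small M'" if "d \<in> small (M' - M)" for d :: "'r fls"
          using that by (simp add: small_def)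
        ultimately have "e y' - e y \<in> small M'"
          unfolding e_def fls_shift_minus[symmetric] by blast
        then have "translate (e y' - e y) (translate (e y) s) \<in> nbhd (translate (e y) s) M'"
          by (auto simp: nbhd_def)
        then show ?thesis using M' by (auto simp: translate_translate f_def)
      qed
      then show "\<exists>N. agree N y \<subseteq> {y \<in> topspace sequences. f y \<in> U}" by auto
    qed
  qed
  moreover have "compactin sequences UNIV"
  proof -
    have "compact_space sequences"
      unfolding sequences_def by (simp add: compact_space_product_topology compact_space_discrete_topology)
    then show ?thesis by (simp add: compact_space_def)
  qed
  ultimately have "compactin (nerve \<G> n) (f ` UNIV)" using image_compactin[of sequences UNIV "nerve \<G> n" f] by simp
  moreover have "f ` UNIV = tuple n ` nbhd s M"
  proof -
    have "small M \<subseteq> range e"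
    proof
      fix \<epsilon> :: "'r fls" assume "\<epsilon> \<in> small M"
      then have "fls_shift M \<epsilon> \<in> small 0" by (simp add: small_def)
      then have "word_fls (fps_nth (fls_regpart (fls_shift M \<epsilon>))) = fls_shift M \<epsilon>"
        using small_0E by simp
      then have "\<epsilon> = e (fps_nth (fls_regpart (fls_shift M \<epsilon>)))" unfolding e_def by simp
      then show "\<epsilon> \<in> range e" by blast
    qed
    then have "range e = small M" using e by (intro equalityI subsetI) auto
    then have "nbhd s M = (\<lambda>y. translate (e y) s) ` UNIV"
      unfolding nbhd_def by (simp only: image_image flip: \<open>range e = small M\<close>)
    then show ?thesis by (simp add: image_image f_def)
  qed
  ultimately show ?thesis by (simp only:)
qed

text \<open>Distinct simplices have disjoint balls of large radius index: a nonzero displacement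
  leaves \<open>small M\<close> once M exceeds its order.\<close>

lemma Hausdorff_nerve: "Hausdorff_space (nerve \<G> n)"
  unfolding Hausdorff_space_def
proof (intro allI impI, elim conjE)
  fix x y assume "x \<in> topspace (nerve \<G> n)" "y \<in> topspace (nerve \<G> n)" "x \<noteq> y"
  then obtain s t where st: "s \<in> nsimplices n" "t \<in> nsimplices n" "x = tuple n s" "y = tuple n t"
    using tuple_surj by metis
  have ne: "s \<noteq> t" using \<open>x \<noteq> y\<close> st by auto
  have s: "simplex s" "length s = Suc n" "s \<noteq> []" and t: "simplex t" "length t = Suc n"
    using st by (auto simp: nsimplices_def)
  obtain M1 M2 where M12: "fine s M1" "fine t M2" using fine_exists by metis
  have "\<exists>M. t \<notin> nbhd s M"
  proof (cases "t \<in> nbhd s 0")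
    case True
    then obtain \<epsilon> where e: "t = translate \<epsilon> s" by (auto simp: nbhd_def)
    then have "\<epsilon> \<noteq> 0" using ne by auto
    have "t \<notin> nbhd s (fls_subdegree \<epsilon> + 1)"
    proof
      assume "t \<in> nbhd s (fls_subdegree \<epsilon> + 1)"
      then have "\<epsilon> \<in> small (fls_subdegree \<epsilon> + 1)" using e translate_inject[OF s(3)] by (auto simp: nbhd_def)
      then show False using nth_fls_subdegree_nonzero[OF \<open>\<epsilon> \<noteq> 0\<close>] by (simp add: small_def)
    qed
    then show ?thesis by blast
  qed blast
  then obtain M3 where M3: "t \<notin> nbhd s M3" by blast
  define M where "M = max (max M1 M2) M3"
  have fine: "fine s M" "fine t M"
    using fine_mono[OF M12(1), of M] fine_mono[OF M12(2), of M] by (simp_all add: M_def)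
  have "t \<notin> nbhd s M" using M3 nbhd_mono[of M3 M s] by (auto simp: M_def)
  then have "nbhd s M \<inter> nbhd t M = {}" using nbhd_eq_or_disjoint[of s M t] self_in_nbhd[of t M] by blast
  then have "tuple n ` nbhd s M \<inter> tuple n ` nbhd t M = {}"
    using inj_on_image_Int[OF tuple_inj nbhd_nsimplices[OF st(1) fine(1)] nbhd_nsimplices[OF st(2) fine(2)]] by simp
  then show "\<exists>U V. openin (nerve \<G> n) U \<and> openin (nerve \<G> n) V \<and> x \<in> U \<and> y \<in> V \<and> disjnt U V"
    unfolding disjnt_def st(3,4)
    by (intro exI[of _ "tuple n ` nbhd s M"] exI[of _ "tuple n ` nbhd t M"] conjI
        openin_tuple_nbhd s(1,2) t fine imageI self_in_nbhd)
qed

end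

context skipper_steinberg
begin

section \<open>Homology of the groupoid\<close>

text \<open>Two balls are nested or disjoint, so a product of their indicators is again such an
  indicator or 0.\<close>

lemma lchains_mult:
  assumes "h \<in> lchains \<kappa> n" "k \<in> lchains \<kappa> n" shows "h * k \<in> lchains \<kappa> n"
proof -
  have gen: "g * g' \<in> lchains \<kappa> n"
    if g: "g \<in> nbhd_indicator ` cells \<kappa> n" "g' \<in> nbhd_indicator ` cells \<kappa> n" for g g'
  proof -
    obtain s M s' M' where s: "(s, M) \<in> cells \<kappa> n" "g = indicator (nbhd s M)"
      and s': "(s', M') \<in> cells \<kappa> n" "g' = indicator (nbhd s' M')"
      using g by auto
    have inter: "indicator (nbhd t L \<inter> nbhd t' L') \<in> lchains \<kappa> n"
      if t: "(t', L') \<in> cells \<kappa> n" "L \<le> L'" for t L t' L'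
    proof (cases "nbhd t L = nbhd t' L")
      case True
      then have "nbhd t L \<inter> nbhd t' L' = nbhd t' L'" using nbhd_mono[OF t(2), of t'] by blast
      then show ?thesis using cell_in_lchains[OF t(1)] by simp
    next
      case False
      then have "nbhd t L \<inter> nbhd t' L = {}" using nbhd_eq_or_disjoint[of t L t'] by blast
      then have "nbhd t L \<inter> nbhd t' L' = {}" using nbhd_mono[OF t(2), of t'] by blast
      moreover have "indicator {} = (0 :: 'r simplex \<Rightarrow> int)" by (simp add: fun_eq_iff)
      ultimately show ?thesis by simp
    qed
    have "g * g' = indicator (nbhd s M \<inter> nbhd s' M')"
      unfolding s(2) s'(2) by (simp add: fun_eq_iff indicator_def)
    then show ?thesis
      using inter[OF s'(1), of M s] inter[OF s(1), of M' s'] linear[of M M'] by (auto simp: Int_commute)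
  qed
  have step: "h * g' \<in> lchains \<kappa> n" if g': "g' \<in> nbhd_indicator ` cells \<kappa> n" for g'
    by (rule zspan_closed[where P = "\<lambda>h. h * g' \<in> lchains \<kappa> n", OF assms(1)[unfolded lchains_def]])
      (simp_all only: mult_zero_left lchains_zero gen[OF _ g'] distrib_right left_diff_distrib lchains_add lchains_diff)
  show ?thesis
    by (rule zspan_closed[where P = "\<lambda>k. h * k \<in> lchains \<kappa> n", OF assms(2)[unfolded lchains_def]])
      (simp_all only: mult_zero_right lchains_zero step distrib_left right_diff_distrib lchains_add lchains_diff)
qed

text \<open>Inclusion and exclusion; products stay within the chains.\<close>

lemma finite_union_in_lchains:
  assumes "finite Q" "Q \<subseteq> cells \<kappa> n"
  shows "indicator (\<Union>(s, M)\<in>Q. nbhd s M) \<in> lchains \<kappa> n"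
  using assms
proof (induction Q rule: finite_induct)
  case empty
  have "indicator (\<Union>(s, M)\<in>{}. nbhd s M) = (0 :: 'r simplex \<Rightarrow> int)" by (simp add: fun_eq_iff)
  then show ?case by (simp only: lchains_zero)
next
  case (insert q Q)
  obtain s M where q: "q = (s, M)" by (cases q)
  let ?A = "nbhd s M" and ?B = "\<Union>(s, M)\<in>Q. nbhd s M"
  have mem: "indicator ?A \<in> lchains \<kappa> n" "indicator ?B \<in> lchains \<kappa> n"
    using insert.prems insert.IH by (auto simp: q intro!: cell_in_lchains)
  have "indicator (\<Union>(s, M)\<in>insert q Q. nbhd s M) =
      indicator ?A + indicator ?B - indicator ?A * (indicator ?B :: 'r simplex \<Rightarrow> int)"
    unfolding q by (auto simp: fun_eq_iff indicator_def)
  then show ?case using lchains_diff[OF lchains_add[OF mem] lchains_mult[OF mem]] by (simp only:)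
qed

lemma lchains_nsimplices:
  assumes "h \<in> lchains lv2 n" "h s \<noteq> 0" shows "s \<in> nsimplices n"
proof -
  obtain t M where t: "(t, M) \<in> cells lv2 n" "s \<in> nbhd t M"
    using lchains_support[OF assms(1)[unfolded lchains_def] assms(2)] .
  have "t \<in> nsimplices n" "fine t M" using t(1) by (auto simp: cells_def nsimplices_def)
  then show ?thesis using nbhd_nsimplices t(2) by blast
qed

lemma nsimplices_cell: "s \<in> nsimplices n \<Longrightarrow> fine s M \<Longrightarrow> (s, M) \<in> cells lv2 n"
  by (simp add: nsimplices_def cells_def)

lemma cellD: "(s, M) \<in> cells lv2 n \<Longrightarrow> s \<in> nsimplices n \<and> fine s M \<and> simplex s \<and> length s = Suc n"
  by (simp add: nsimplices_def cells_def)

lemma finite_fibres_tuple: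
  assumes "h \<in> lchains lv2 n" shows "finite_fibres (tuple n) h"
proof -
  have "finite {x. id x = y \<and> h x \<noteq> 0}" for y by (rule finite_subset[of _ "{y}"]) auto
  then have "finite_fibres id h" by (simp add: finite_fibres_def)
  from finite_fibres_inj_on[OF this tuple_inj, of n] show ?thesis using lchains_nsimplices[OF assms] by simp
qed

text \<open>A left inverse of \<open>push (tuple n)\<close> on chains, which carries a function on
  the nerve back to simplices.\<close>

definition pull :: "nat \<Rightarrow> ((nat \<Rightarrow> (('r list \<times> ((int \<Rightarrow>\<^sub>0 'r) \<times> int) \<times> 'r list) option \<times> 'r word) set) \<Rightarrow> int) \<Rightarrow> 'r simplex \<Rightarrow> int" where
  "pull n x s = (if s \<in> nsimplices n then x (tuple n s) else 0)"

lemma pull_push: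
  assumes "h \<in> lchains lv2 n" shows "pull n (push (tuple n) h) = h"
proof
  fix s
  show "pull n (push (tuple n) h) s = h s"
  proof (cases "s \<in> nsimplices n")
    case True
    have "{t. tuple n t = tuple n s \<and> h t \<noteq> 0} \<subseteq> {s}"
      using inj_onD[OF tuple_inj _ lchains_nsimplices[OF assms] True] by blast
    then have "push (tuple n) h (tuple n s) = sum h {s}" by (intro push_eq_sum) auto
    then show ?thesis using True by (simp add: pull_def)
  next
    case False
    then have "h s = 0" using lchains_nsimplices[OF assms] by blast
    then show ?thesis using False by (simp add: pull_def)
  qed
qed

lemma push_tuple_indicator:
  "V \<subseteq> nsimplices n \<Longrightarrow> push (tuple n) (indicator V) = indicator (tuple n ` V)"
  by (rule push_indicator) (rule inj_on_subset[OF tuple_inj])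

text \<open>Balls form a basis, so a compact open set is a finite union of them.\<close>

lemma compact_open_indicator:
  assumes "compactin (nerve \<G> n) U" "openin (nerve \<G> n) U"
  shows "indicator U \<in> push (tuple n) ` lchains lv2 n"
proof -
  let ?Q = "{(s, M). (s, M) \<in> cells lv2 n \<and> tuple n ` nbhd s M \<subseteq> U}"
  let ?c = "\<lambda>(s, M). tuple n ` nbhd s M"
  have "U \<subseteq> \<Union> (?c ` ?Q)"
  proof
    fix x assume x: "x \<in> U"
    then have "x \<in> topspace (nerve \<G> n)" using openin_subset[OF assms(2)] by blast
    then obtain s where s: "s \<in> nsimplices n" "x = tuple n s" using tuple_surj by blast
    then obtain M where M: "fine s M" "tuple n ` nbhd s M \<subseteq> U"
      using openin_nerveD[OF assms(2), of s] x by (auto simp: nsimplices_def)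
    have "(s, M) \<in> ?Q" using nsimplices_cell[OF s(1) M(1)] M(2) by simp
    moreover have "x \<in> ?c (s, M)" using s(2) self_in_nbhd by auto
    ultimately show "x \<in> \<Union> (?c ` ?Q)" by blast
  qed
  moreover have "openin (nerve \<G> n) W" if "W \<in> ?c ` ?Q" for W
    using that openin_tuple_nbhd by (auto dest: cellD)
  ultimately obtain \<F> where F: "finite \<F>" "\<F> \<subseteq> ?c ` ?Q" "U \<subseteq> \<Union>\<F>"
    using compactinD[OF assms(1), of "?c ` ?Q"] by auto
  obtain Q where Q: "Q \<subseteq> ?Q" "finite Q" "\<F> = ?c ` Q"
    using finite_subset_image[OF F(1,2)] by auto
  let ?V = "\<Union>(s, M)\<in>Q. nbhd s M"
  have "tuple n ` ?V = \<Union> (?c ` Q)" by auto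
  also have "\<dots> = U" using F(3) Q(1) unfolding Q(3) by blast
  finally have U: "tuple n ` ?V = U" .
  have "?V \<subseteq> nsimplices n"
    using Q(1) nbhd_nsimplices cellD by blast
  then have "push (tuple n) (indicator ?V) = indicator U"
    by (simp only: push_tuple_indicator U)
  moreover have "indicator ?V \<in> lchains lv2 n"
    by (rule finite_union_in_lchains[OF Q(2)]) (use Q(1) in auto)
  ultimately show ?thesis by (intro image_eqI[where x = "indicator ?V"]) (simp_all only:)
qed

abbreviation "gchains n \<equiv> groupoid_chains \<G> n"

lemma carrier_chains: "carrier (gchains n) = push (tuple n) ` lchains lv2 n"
proof -
  let ?A = "{indicator U | U. compactin (nerve \<G> n) U \<and> openin (nerve \<G> n) U \<and>
    Hausdorff_space (subtopology (nerve \<G> n) U)} :: (_ \<Rightarrow> int) set"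
  have "carrier (gchains n) = zspan ?A"
    unfolding groupoid_chains_def by (rule carrier_generated_int_functions)
  also have "\<dots> = push (tuple n) ` lchains lv2 n"
  proof (intro equalityI subsetI)
    fix x assume "x \<in> zspan ?A"
    then show "x \<in> push (tuple n) ` lchains lv2 n"
    proof (rule zspan_closed[where P = "\<lambda>x. x \<in> push (tuple n) ` lchains lv2 n"])
      show "0 \<in> push (tuple n) ` lchains lv2 n" by (rule image_eqI[of _ _ 0]) simp_all
      show "g \<in> push (tuple n) ` lchains lv2 n" if "g \<in> ?A" for g
        using that compact_open_indicator by blast
      fix x y assume "x \<in> push (tuple n) ` lchains lv2 n" "y \<in> push (tuple n) ` lchains lv2 n"
      then obtain h k where hk: "h \<in> lchains lv2 n" "k \<in> lchains lv2 n" "x = push (tuple n) h" "y = push (tuple n) k"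
        by blast
      show "x + y \<in> push (tuple n) ` lchains lv2 n"
        using push_add[OF hk(1,2)[THEN finite_fibres_tuple]] lchains_add[OF hk(1,2)] hk(3,4)
        by (intro image_eqI[of _ _ "h + k"]) (simp_all only:)
      show "x - y \<in> push (tuple n) ` lchains lv2 n"
        using push_diff[OF hk(1,2)[THEN finite_fibres_tuple]] lchains_diff[OF hk(1,2)] hk(3,4)
        by (intro image_eqI[of _ _ "h - k"]) (simp_all only:)
    qed
  next
    fix x assume "x \<in> push (tuple n) ` lchains lv2 n"
    then obtain h where h: "h \<in> lchains lv2 n" "x = push (tuple n) h" by blast
    have "finite_fibres (tuple n) h \<and> push (tuple n) h \<in> zspan ?A"
    proof (rule zspan_closed[where P = "\<lambda>h. finite_fibres (tuple n) h \<and> push (tuple n) h \<in> zspan ?A",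
          OF h(1)[unfolded lchains_def]])
      fix g assume "g \<in> nbhd_indicator ` cells lv2 n"
      then obtain s M where s: "(s, M) \<in> cells lv2 n" "g = indicator (nbhd s M)" by auto
      note c = cellD[OF s(1)]
      have "push (tuple n) g = indicator (tuple n ` nbhd s M)"
        unfolding s(2) using c by (intro push_tuple_indicator nbhd_nsimplices) auto
      moreover have "indicator (tuple n ` nbhd s M) \<in> ?A"
        using compactin_tuple_nbhd[of s n M] openin_tuple_nbhd[of s n M] c
          Hausdorff_space_subtopology[OF Hausdorff_nerve] by blast
      ultimately show "finite_fibres (tuple n) g \<and> push (tuple n) g \<in> zspan ?A"
        using finite_fibres_tuple[OF cell_in_lchains[OF s(1)]] zspan_base[of _ ?A] s(2)
        by (simp only: simp_thms)
    qed (simp_all only: finite_fibres_zero push_zero zspan.zero finite_fibres_add push_add zspan_add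
        finite_fibres_diff push_diff zspan_diff simp_thms)
    then show "x \<in> zspan ?A" using h(2) by blast
  qed
  finally show ?thesis .
qed

text \<open>Dropping a vertex drops an end arrow or composes the two arrows that meet there. From
  degree 1 to 0 an arrow is replaced by the unit at the vertex that remains.\<close>

lemma face_tuple:
  assumes s: "simplex s" "length s = Suc (Suc n)" and i: "i \<le> Suc n"
  shows "face \<G> (Suc n) i (tuple (Suc n) s) = tuple n (del i s)"
proof (cases "n = 0")
  case True
  have del0: "i = 0 \<Longrightarrow> del 0 s ! 0 = s ! Suc 0" "i \<noteq> 0 \<Longrightarrow> del i s ! 0 = s ! 0"
    using nth_del[of i s 0] s(2) i True by simp_all
  have edge: "edge (s ! 0) (s ! Suc 0)" using simplex_edge[OF s(1), of 0 "Suc 0"] s(2) by simp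
  have pt: "is_point (s ! 0)" "is_point (s ! Suc 0)" using edge by (simp_all add: edge_def)
  have "tuple (Suc n) s 1 = arrow (s ! 0) (s ! Suc 0)" using True by (simp add: tuple_def idx_def)
  then show ?thesis
    using True src_arrow[OF edge] tgt_arrow[OF edge] unit_germ_arrow pt
    by (simp add: face_def fun_eq_iff tuple_def idx_def del0)
next
  case False
  show ?thesis
  proof
    fix j
    show "face \<G> (Suc n) i (tuple (Suc n) s) j = tuple n (del i s) j"
    proof (cases "j \<in> {1..n}")
      case True
      have dj: "del i s ! (j - 1) = (if j - 1 < i then s ! (j - 1) else s ! j)"
        using nth_del[of i s "j - 1"] s(2) i True by (auto simp: Suc_diff_le)
      have dj': "del i s ! j = (if j < i then s ! j else s ! Suc j)"
        using nth_del[of i s j] s(2) i True by auto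
      have idx: "j \<in> idx n" "j \<in> idx (Suc n)" "Suc j \<in> idx (Suc n)" using True by (auto simp: idx_def)
      have "tuple n (del i s) j = arrow (del i s ! (j - 1)) (del i s ! j)"
        using idx by (simp add: tuple_def)
      moreover have tup: "tuple (Suc n) s j = arrow (s ! (j - 1)) (s ! j)"
        "tuple (Suc n) s (Suc j) = arrow (s ! j) (s ! Suc j)"
        using idx by (simp_all add: tuple_def)
      moreover have "comp \<G> (arrow (s ! (j - 1)) (s ! j)) (arrow (s ! j) (s ! Suc j)) =
          arrow (s ! (j - 1)) (s ! Suc j)"
        by (rule comp_arrow) (use simplex_edge[OF s(1)] s(2) True in auto)
      moreover have "j - 1 < i \<longleftrightarrow> j \<le> i" using True by auto
      ultimately show ?thesis
        using True False dj dj' by (auto simp: face_def)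
    next
      case False
      then show ?thesis using \<open>n \<noteq> 0\<close> by (auto simp: face_def tuple_def idx_def)
    qed
  qed
qed

text \<open>The isomorphism of complexes. The additional normalisation in \<open>bd\<close> is
  invisible to \<open>tuple\<close>, and chains are supported in the nerve, so
  \<open>pushforward\<close> and \<open>push\<close> agree.\<close>

lemma boundary_push:
  assumes h: "h \<in> lchains lv2 (Suc n)"
  shows "boundary \<G> (Suc n) (push (tuple (Suc n)) h) = push (tuple n) (bd lv2 (Suc n) h)"
proof -
  let ?T = "tuple (Suc n)" and ?N = "nerve \<G> (Suc n)"
  note supp = lchains_nsimplices[OF h]
  have top: "x \<in> topspace ?N" if "push ?T h x \<noteq> 0" for x
  proof -
    obtain s where "?T s = x" "h s \<noteq> 0" using push_support[OF \<open>push ?T h x \<noteq> 0\<close>] by blast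
    then show ?thesis using supp[of s] tuple_in_topspace[of s "Suc n"] by (auto simp: nsimplices_def)
  qed
  have face: "push (face \<G> (Suc n) i) (push ?T h) = push (tuple n) (push (normalise lv2 \<circ> del i) h)"
    and fin: "finite_fibres (tuple n) ((- 1) ^ i * push (normalise lv2 \<circ> del i) h)" if i: "i \<le> Suc n" for i
  proof -
    let ?d = "normalise lv2 \<circ> del i"
    have eq: "(face \<G> (Suc n) i \<circ> ?T) s = (tuple n \<circ> ?d) s" "?d s \<in> nsimplices n" if "h s \<noteq> 0" for s
    proof -
      have s: "simplex s" "length s = Suc (Suc n)" using supp[OF that] by (auto simp: nsimplices_def)
      then have d: "simplex (del i s)" "length (del i s) = Suc n"
        using simplex_del[OF s(1), of i] length_del[of i s] i by auto
      show "(face \<G> (Suc n) i \<circ> ?T) s = (tuple n \<circ> ?d) s"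
        using face_tuple[OF s i] tuple_normalise[OF d] by simp
      have "simplex (normalise lv2 (del i s))" unfolding normalise_def by (rule simplex_shift[OF d(1)])
      moreover have "del i s \<noteq> []" using d(2) by auto
      ultimately show "?d s \<in> nsimplices n"
        using normalise_level[OF level_map_lv2, of "del i s"] d(2) by (simp add: nsimplices_def)
    qed
    have fin_d: "finite_fibres ?d h" by (rule face_finite_fibres[OF level_map_lv2 h i])
    have fin1: "finite_fibres (tuple n \<circ> ?d) h"
      by (rule finite_fibres_inj_on[OF fin_d tuple_inj eq(2)])
    moreover have "finite_fibres (face \<G> (Suc n) i \<circ> ?T) h \<longleftrightarrow> finite_fibres (tuple n \<circ> ?d) h"
      by (rule finite_fibres_cong[OF eq(1)])
    ultimately have "push (face \<G> (Suc n) i) (push ?T h) = push (face \<G> (Suc n) i \<circ> ?T) h"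
      by (intro push_push) (simp only:)
    also have "\<dots> = push (tuple n \<circ> ?d) h" by (rule push_cong[OF eq(1)])
    also have "\<dots> = push (tuple n) (push ?d h)" by (rule push_push[OF fin1, symmetric])
    finally show "push (face \<G> (Suc n) i) (push ?T h) = push (tuple n) (push ?d h)" .
    show "finite_fibres (tuple n) ((- 1) ^ i * push ?d h)"
      by (intro finite_fibres_sign finite_fibres_tuple face_in_lchains[OF level_map_lv2 h i])
  qed
  have "boundary \<G> (Suc n) (push ?T h) = (\<Sum>i\<le>Suc n. (- 1) ^ i * push (face \<G> (Suc n) i) (push ?T h))"
    by (simp add: boundary_def fun_eq_iff pushforward_eq_push[OF top] del: sum.atMost_Suc)
  also have "\<dots> = (\<Sum>i\<le>Suc n. push (tuple n) ((- 1) ^ i * push (normalise lv2 \<circ> del i) h))"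
    by (intro sum.cong refl) (simp only: face atMost_iff push_sign)
  also have "\<dots> = push (tuple n) (\<Sum>i\<le>Suc n. (- 1) ^ i * push (normalise lv2 \<circ> del i) h)"
    using fin by (intro push_sum[symmetric]) (simp only: atMost_iff)
  also have "\<dots> = push (tuple n) (bd lv2 (Suc n) h)" by (simp only: bd_def nat.distinct if_False)
  finally show ?thesis .
qed

lemma push_tuple_eq_0_iff: "h \<in> lchains lv2 n \<Longrightarrow> push (tuple n) h = 0 \<longleftrightarrow> h = 0"
  using pull_push[of h n] pull_push[of 0 n] by (metis lchains_zero push_zero)

lemma kernel_boundary: "kernel (gchains n) int_functions (boundary \<G> n) = push (tuple n) ` cycles n"
proof -
  have "boundary \<G> n (push (tuple n) h) = 0 \<longleftrightarrow> bd lv2 n h = 0" if h: "h \<in> lchains lv2 n" for h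
  proof (cases n)
    case 0
    then show ?thesis by (simp add: boundary_def bd_def fun_eq_iff)
  next
    case (Suc m)
    then show ?thesis
      using boundary_push[of h m] push_tuple_eq_0_iff[OF bd_in_lchains[OF level_map_lv2, of h m]] h by simp
  qed
  then show ?thesis unfolding kernel_def carrier_chains cycles_def int_functions_simps by blast
qed

lemma image_boundary:
  "boundary \<G> (Suc n) ` carrier (gchains (Suc n)) = push (tuple n) ` boundaries n"
  unfolding carrier_chains boundaries_def image_image
  by (rule image_cong[OF refl boundary_push])

lemma cycles_zero: "0 \<in> cycles n"
  by (simp add: cycles_def)

lemma cycles_uminus: "h \<in> cycles n \<Longrightarrow> - h \<in> cycles n"
  using bd_diff[OF level_map_lv2, of 0 lv2 n h] lchains_diff[of 0 lv2 n h] by (auto simp: cycles_def)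

text \<open>The first isomorphism theorem for \<open>\<rho>\<close> modulo N, transported to
  functions on the nerve by \<open>pull\<close>.\<close>

theorem homology_classified:
  assumes cl: "classifies \<rho> (int N) n" and N: "0 < N"
  shows "group (groupoid_homology \<G> n)" "groupoid_homology \<G> n \<cong> integer_mod_group N"
proof -
  let ?T = "push (tuple n)"
  define K where "K = ?T ` cycles n"
  define H where "H = subgroup_generated (gchains n) K"
  define \<phi> where "\<phi> x = \<rho> (pull n x) mod int N" for x
  have cyc: "h \<in> lchains lv2 n" if "h \<in> cycles n" for h using that by (simp add: cycles_def)
  have pull: "pull n (?T h) = h" if "h \<in> cycles n" for h by (rule pull_push[OF cyc[OF that]])
  have push_cycles_add: "?T (h + k) = ?T h + ?T k" if "h \<in> cycles n" "k \<in> cycles n" for h k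
    by (rule push_add[OF that[THEN cyc, THEN finite_fibres_tuple]])
  have "subgroup K int_functions"
  proof
    show "\<one>\<^bsub>int_functions\<^esub> \<in> K"
      unfolding K_def int_functions_simps by (rule image_eqI[OF _ cycles_zero]) simp
    show "x \<otimes>\<^bsub>int_functions\<^esub> y \<in> K" if xy: "x \<in> K" "y \<in> K" for x y
    proof -
      obtain h k where hk: "h \<in> cycles n" "k \<in> cycles n" "x = ?T h" "y = ?T k" using xy unfolding K_def by blast
      then have "x \<otimes>\<^bsub>int_functions\<^esub> y = ?T (h + k)"
        using push_cycles_add[OF hk(1,2)] by (simp only: int_functions_simps)
      then show ?thesis unfolding K_def using cycles_add[OF hk(1,2)] by (rule image_eqI)
    qed
    show "inv\<^bsub>int_functions\<^esub> x \<in> K" if "x \<in> K" for x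
    proof -
      obtain h where h: "h \<in> cycles n" "x = ?T h" using \<open>x \<in> K\<close> unfolding K_def by blast
      then have "inv\<^bsub>int_functions\<^esub> x = ?T (- h)" by (simp only: inv_int_functions push_uminus)
      then show ?thesis unfolding K_def using cycles_uminus[OF h(1)] by (rule image_eqI)
    qed
  qed simp
  moreover have "K \<subseteq> carrier (gchains n)" unfolding K_def carrier_chains using cyc by blast
  ultimately have "subgroup K (gchains n)"
    unfolding groupoid_chains_def group.subgroup_subgroup_generated_iff[OF group_int_functions] by blast
  then have carrier: "carrier H = K"
    unfolding H_def by (rule subgroup.carrier_subgroup_generated_subgroup)
  have mult: "x \<otimes>\<^bsub>H\<^esub> y = x + y" for x y
    by (simp add: H_def groupoid_chains_def subgroup_generated_def)
  have "group (gchains n)"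
    unfolding groupoid_chains_def by (rule group.group_subgroup_generated[OF group_int_functions])
  then have H: "group H" unfolding H_def by (rule group.group_subgroup_generated)
  have mod_eq: "\<rho> (h + k) mod int N = (\<rho> h mod int N + \<rho> k mod int N) mod int N"
    if "h \<in> cycles n" "k \<in> cycles n" for h k
    using cl that unfolding classifies_def by (simp add: mod_eq_dvd_iff mod_add_eq)
  have "\<phi> \<in> hom H (integer_mod_group N)"
  proof (rule homI)
    show "\<phi> x \<in> carrier (integer_mod_group N)" for x
      using N by (simp add: carrier_integer_mod_group \<phi>_def)
    show "\<phi> (x \<otimes>\<^bsub>H\<^esub> y) = \<phi> x \<otimes>\<^bsub>integer_mod_group N\<^esub> \<phi> y" if xy: "x \<in> carrier H" "y \<in> carrier H" for x y
    proof -
      obtain h k where hk: "h \<in> cycles n" "k \<in> cycles n" "x = ?T h" "y = ?T k"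
        using xy unfolding carrier K_def by blast
      have "x \<otimes>\<^bsub>H\<^esub> y = ?T (h + k)" using push_cycles_add[OF hk(1,2)] hk(3,4) by (simp only: mult)
      then show ?thesis
        using pull[OF hk(1)] pull[OF hk(2)] pull[OF cycles_add[OF hk(1,2)]] mod_eq[OF hk(1,2)] hk(3,4)
        by (simp only: \<phi>_def mult_integer_mod_group)
    qed
  qed
  then interpret group_hom H "integer_mod_group N" \<phi>
    using H by (simp add: group_hom_def group_hom_axioms_def)
  have ker: "kernel H (integer_mod_group N) \<phi> = boundary \<G> (Suc n) ` carrier (gchains (Suc n))"
  proof -
    have "\<phi> (?T h) = 0 \<longleftrightarrow> h \<in> boundaries n" if "h \<in> cycles n" for h
      using cl that unfolding classifies_def \<phi>_def pull[OF that] by (simp add: dvd_eq_mod_eq_0)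
    then show ?thesis
      unfolding image_boundary kernel_def carrier K_def one_integer_mod_group
      using boundaries_subset_cycles[of n] by blast
  qed
  have quotient: "groupoid_homology \<G> n = H Mod kernel H (integer_mod_group N) \<phi>"
    unfolding ker by (simp only: groupoid_homology_def kernel_boundary H_def K_def)
  have "\<phi> ` carrier H = carrier (integer_mod_group N)"
  proof (intro equalityI subsetI)
    fix j assume j: "j \<in> carrier (integer_mod_group N)"
    obtain h where h: "h \<in> cycles n" "int N dvd \<rho> h - j" using cl unfolding classifies_def by blast
    then have "\<phi> (?T h) = j"
      using j N unfolding \<phi>_def pull[OF h(1)] by (simp add: carrier_integer_mod_group flip: mod_eq_dvd_iff)
    then show "j \<in> \<phi> ` carrier H" using h(1) unfolding carrier K_def by blast
  qed auto
  from FactGroup_iso[OF this] show "groupoid_homology \<G> n \<cong> integer_mod_group N"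
    unfolding quotient .
  from normal.factorgroup_is_group[OF normal_kernel] show "group (groupoid_homology \<G> n)"
    unfolding quotient .
qed

end

theorem theorem8p2:
  fixes r a b :: "'r :: {finite, comm_ring_1}"
  assumes "r dvd 1" and "(a - b) dvd 1"
  shows "groupoid_homology (ss_groupoid r a b) 0 \<cong> integer_mod_group (CARD('r) - 1) \<and>
         groupoid_homology (ss_groupoid r a b) 1 \<cong> integer_mod_group (CARD('r) - 1) \<and>
         (\<forall>n\<ge>2. trivial_group (groupoid_homology (ss_groupoid r a b) n))"
proof (intro conjI allI impI)
  interpret skipper_steinberg r a b by unfold_locales fact+
  have N: "int CARD('r) - 1 = int (CARD('r) - 1)" "0 < CARD('r) - 1" using card_ge_2 by simp_all
  show "groupoid_homology (ss_groupoid r a b) 0 \<cong> integer_mod_group (CARD('r) - 1)"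
    by (rule homology_classified(2)[OF classifies_0[unfolded N(1)] N(2)])
  show "groupoid_homology (ss_groupoid r a b) 1 \<cong> integer_mod_group (CARD('r) - 1)"
    using homology_classified(2)[OF classifies_1[unfolded N(1)] N(2)] by (simp only: One_nat_def)
  fix n :: nat assume "2 \<le> n"
  then obtain m where m: "n = Suc (Suc m)" by (metis add_2_eq_Suc le_Suc_ex)
  have "classifies (\<lambda>_. 0) (int 1) n" unfolding m using classifies_ge_2 by simp
  note hom = homology_classified[OF this zero_less_one]
  show "trivial_group (groupoid_homology (ss_groupoid r a b) n)"
    using isomorphic_group_triviality[OF hom(2,1)] trivial_integer_mod_group[of 1] by simp
qed

end
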